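(* Let $\Omega\subset\mathbb R^N$ be a bounded domain with smooth boundary, let $1<p,q<\infty$, and let $\alpha,\beta>0$ satisfy $\frac{\alpha}{p}+\frac{\beta}{q}=1$. Let $\{\lambda_k\}_{k\in\mathbb N}$ be the sequence of variational eigenvalues of the system $$-\Delta_p u=\lambda\alpha|u|^{\alpha-2}u|v|^\beta,\qquad -\Delta_q v=\lambda\beta|u|^\alpha|v|^{\beta-2}v\quad\text{in }\Omega,\qquad u=v=0\text{ on }\partial\Omega.$$ Then there exist positive constants $c<C$, depending on $p,q,\alpha,\beta$ and $N$, such that $$c\left(\frac{k}{|\Omega|}\right)^{\frac{\alpha+\beta}{N}}\le\lambda_k\le C\left(\frac{k}{|\Omega|}\right)^{\frac{\alpha+\beta}{N}}$$ as $k\to\infty$ (i.e. for all sufficiently large $k$).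
   Context: $\Delta_s u=\operatorname{div}(|\nabla u|^{s-2}\nabla u)$. The variational eigenvalues are $$\lambda_k=\inf_{C\in\mathcal C_k}\sup_{(u,v)\in C}\frac{\frac1p\int_\Omega|\nabla u|^p\,dx+\frac1q\int_\Omega|\nabla v|^q\,dx}{\int_\Omega|u|^\alpha|v|^\beta\,dx},$$ where $\mathcal C_k$ is the class of compact symmetric ($C=-C$) subsets of $W^{1,p}_0(\Omega)\times W^{1,q}_0(\Omega)$ of Krasnoselskii genus at least $k$. Eigenvalues are counted with multiplicity; $|\Omega|$ denotes Lebesgue measure. *)

theory Defs
  imports "HOL-Analysis.Analysis"
begin

definition partial_deriv :: "(real^'n \<Rightarrow> real) \<Rightarrow> 'n \<Rightarrow> real^'n \<Rightarrow> real" where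
  "partial_deriv f i x = frechet_derivative f (at x) (axis i 1)"

definition grad :: "(real^'n \<Rightarrow> real) \<Rightarrow> real^'n \<Rightarrow> real^'n" where
  "grad f x = (\<chi> i. partial_deriv f i x)"

fun Ck_on :: "nat \<Rightarrow> (real^'n \<Rightarrow> real) \<Rightarrow> (real^'n) set \<Rightarrow> bool" where
  "Ck_on 0 f S = continuous_on S f"
| "Ck_on (Suc k) f S = (continuous_on S f \<and> f differentiable_on S \<and>
      (\<forall>i. Ck_on k (partial_deriv f i) S))"

definition smooth_on :: "(real^'n \<Rightarrow> real) \<Rightarrow> (real^'n) set \<Rightarrow> bool" where
  "smooth_on f S = (\<forall>k. Ck_on k f S)"

definition test_fun :: "(real^'n) set \<Rightarrow> (real^'n \<Rightarrow> real) \<Rightarrow> bool" where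
  "test_fun \<Omega> \<phi> = (smooth_on \<phi> UNIV \<and> compact (closure {x. \<phi> x \<noteq> 0})
                      \<and> closure {x. \<phi> x \<noteq> 0} \<subseteq> \<Omega>)"

definition smooth_bounded_domain :: "(real^'n) set \<Rightarrow> bool" where
  "smooth_bounded_domain \<Omega> = (open \<Omega> \<and> connected \<Omega> \<and> \<Omega> \<noteq> {} \<and> bounded \<Omega> \<and>
     (\<forall>x\<in>frontier \<Omega>. \<exists>r>0. \<exists>\<rho>. smooth_on \<rho> (ball x r) \<and> grad \<rho> x \<noteq> 0 \<and>
          \<Omega> \<inter> ball x r = {y\<in>ball x r. \<rho> y < 0}))"

text \<open>An element of W_0^{1,s}(Omega) is represented by a pair (u, g) where g is the
  (weak) gradient of u: (u, g) lies in the closure in L^s x (L^s)^N of the graph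
  {(phi, grad phi) | phi in C_c^infinity(Omega)}.\<close>

definition Lp_dist :: "real \<Rightarrow> (real^'n) set \<Rightarrow> (real^'n \<Rightarrow> 'a::euclidean_space)
     \<Rightarrow> (real^'n \<Rightarrow> 'a) \<Rightarrow> real" where
  "Lp_dist s \<Omega> f g = (LINT x:\<Omega>|lebesgue. norm (f x - g x) powr s) powr (1/s)"

definition Lp_fun :: "real \<Rightarrow> (real^'n) set \<Rightarrow> (real^'n \<Rightarrow> 'a::euclidean_space) \<Rightarrow> bool" where
  "Lp_fun s \<Omega> f = (f \<in> borel_measurable lebesgue \<and>
       set_integrable lebesgue \<Omega> (\<lambda>x. norm (f x) powr s))"

definition W0 :: "real \<Rightarrow> (real^'n) set
     \<Rightarrow> ((real^'n \<Rightarrow> real) \<times> (real^'n \<Rightarrow> real^'n)) set" where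
  "W0 s \<Omega> = {(u, g). Lp_fun s \<Omega> u \<and> Lp_fun s \<Omega> g \<and>
      (\<exists>\<phi> :: nat \<Rightarrow> real^'n \<Rightarrow> real. (\<forall>n. test_fun \<Omega> (\<phi> n)) \<and>
         (\<lambda>n. Lp_dist s \<Omega> (\<phi> n) u) \<longlonglongrightarrow> 0 \<and>
         (\<lambda>n. Lp_dist s \<Omega> (grad (\<phi> n)) g) \<longlonglongrightarrow> 0)}"

type_synonym 'n sob = "(real^'n \<Rightarrow> real) \<times> (real^'n \<Rightarrow> real^'n)"

definition Wdist :: "real \<Rightarrow> real \<Rightarrow> (real^'n) set \<Rightarrow> ('n::finite) sob \<times> 'n sob \<Rightarrow> ('n::finite) sob \<times> 'n sob \<Rightarrow> real" where
  "Wdist p q \<Omega> X Y = (case X of ((u, g), (v, h)) \<Rightarrow> case Y of ((u', g'), (v', h')) \<Rightarrow>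
      Lp_dist p \<Omega> u u' + Lp_dist p \<Omega> g g' + Lp_dist q \<Omega> v v' + Lp_dist q \<Omega> h h')"

definition neg_pt :: "('n::finite) sob \<times> 'n sob \<Rightarrow> ('n::finite) sob \<times> 'n sob" where
  "neg_pt X = (case X of ((u, g), (v, h)) \<Rightarrow> ((\<lambda>x. - u x, \<lambda>x. - g x), (\<lambda>x. - v x, \<lambda>x. - h x)))"

definition d_compact :: "('a \<Rightarrow> 'a \<Rightarrow> real) \<Rightarrow> 'a set \<Rightarrow> bool" where
  "d_compact d C = (\<forall>s :: nat \<Rightarrow> 'a. (\<forall>n. s n \<in> C) \<longrightarrow>
      (\<exists>r x. strict_mono r \<and> x \<in> C \<and> (\<lambda>n. d (s (r n)) x) \<longlonglongrightarrow> 0))"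

definition d_continuous_on :: "('a \<Rightarrow> 'a \<Rightarrow> real) \<Rightarrow> 'a set \<Rightarrow> ('a \<Rightarrow> real) \<Rightarrow> bool" where
  "d_continuous_on d C f = (\<forall>x\<in>C. \<forall>e>0. \<exists>\<delta>>0. \<forall>y\<in>C. d x y < \<delta> \<longrightarrow> \<bar>f y - f x\<bar> < e)"

text \<open>Krasnoselskii genus at least k: there is no continuous odd map
  C \<rightarrow> R^m - {0} with m < k (components h 0, ..., h (m-1)).\<close>
definition genus_ge :: "('a \<Rightarrow> 'a \<Rightarrow> real) \<Rightarrow> ('a \<Rightarrow> 'a) \<Rightarrow> 'a set \<Rightarrow> nat \<Rightarrow> bool" where
  "genus_ge d neg C k = (\<forall>m<k. \<not> (\<exists>h :: nat \<Rightarrow> 'a \<Rightarrow> real.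
       (\<forall>i<m. d_continuous_on d C (h i) \<and> (\<forall>x\<in>C. h i (neg x) = - h i x)) \<and>
       (\<forall>x\<in>C. \<exists>i<m. h i x \<noteq> 0)))"

definition denom :: "real \<Rightarrow> real \<Rightarrow> (real^'n) set \<Rightarrow> ('n::finite) sob \<times> 'n sob \<Rightarrow> real" where
  "denom \<alpha> \<beta> \<Omega> X = (case X of ((u, g), (v, h)) \<Rightarrow>
      LINT x:\<Omega>|lebesgue. \<bar>u x\<bar> powr \<alpha> * \<bar>v x\<bar> powr \<beta>)"

definition rayleigh :: "real \<Rightarrow> real \<Rightarrow> real \<Rightarrow> real \<Rightarrow> (real^'n) set \<Rightarrow> ('n::finite) sob \<times> 'n sob \<Rightarrow> real" where
  "rayleigh p q \<alpha> \<beta> \<Omega> X = (case X of ((u, g), (v, h)) \<Rightarrow>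
      ((1/p) * (LINT x:\<Omega>|lebesgue. norm (g x) powr p) +
       (1/q) * (LINT x:\<Omega>|lebesgue. norm (h x) powr q)) / denom \<alpha> \<beta> \<Omega> X)"

text \<open>Admissible sets: compact symmetric subsets of W_0^{1,p} x W_0^{1,q} of genus \<ge> k.
  Sets containing a point where the denominator vanishes have supremum +\<infinity> and are
  therefore irrelevant for the infimum; they are excluded.\<close>
definition admissible :: "real \<Rightarrow> real \<Rightarrow> real \<Rightarrow> real \<Rightarrow> (real^'n) set \<Rightarrow> nat
      \<Rightarrow> (('n::finite) sob \<times> 'n sob) set \<Rightarrow> bool" where
  "admissible p q \<alpha> \<beta> \<Omega> k C = (C \<subseteq> W0 p \<Omega> \<times> W0 q \<Omega> \<and>
      (\<forall>X\<in>C. denom \<alpha> \<beta> \<Omega> X > 0) \<and>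
      d_compact (Wdist p q \<Omega>) C \<and> (\<forall>X\<in>C. neg_pt X \<in> C) \<and>
      genus_ge (Wdist p q \<Omega>) neg_pt C k)"

definition var_eig :: "real \<Rightarrow> real \<Rightarrow> real \<Rightarrow> real \<Rightarrow> (real^'n) set \<Rightarrow> nat \<Rightarrow> real" where
  "var_eig p q \<alpha> \<beta> \<Omega> k =
     Inf ((\<lambda>C. Sup (rayleigh p q \<alpha> \<beta> \<Omega> ` C)) ` {C. admissible p q \<alpha> \<beta> \<Omega> k C})"

end

(* A set of genus at least k carries a zero of any fewer than k odd continuous functionals. Cover Omega by
   m < k/2 grid cells of side h, with h^N comparable to |Omega|/k (possible since the boundary is null), and take the
   averages of u and of v over the cells as functionals: at a common zero the Poincare inequality on each cell
   gives |u|_p <= C h |grad u|_p and |v|_q <= C h |grad v|_q, and Young's inequality with weights alpha/p, beta/q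
   bounds the Rayleigh quotient below by a multiple of h^-(alpha+beta).

   Conversely, k disjoint cells of side h fit into Omega for such h. With a bump phi_i in each, the pairs
   (sum_i h sgn(w_i)|w_i|^(1/p) phi_i, sum_i h sgn(w_i)|w_i|^(1/q) phi_i), w on the l1 sphere of R^k, form a compact
   symmetric set on which the Rayleigh quotient is at most a multiple of h^-(alpha+beta); it has genus at least k
   by the Borsuk-Ulam theorem.

   Borsuk-Ulam itself is proved combinatorially. Fine triangulated hemispheres satisfy, mod 2, the boundary relation
   d(hemi (i+1)) = hemi i + (-hemi i). Pairing hemi n with the cup product of the coboundaries of n odd 0-cochains
   (the signs of the given functions) gives 1, so some simplex has a sign change of the i-th function along its
   i-th edge for every i; a limit point of such simplices is a common zero. *)

theory Submission
  imports Defs "HOL-Library.Z2"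
begin

section \<open>The Borsuk-Ulam theorem on the l1 sphere\<close>

text \<open>The quotient is not invariant under a common scaling of u and v, but under passing to
  (t^(1/p) u, t^(1/q) v) with t > 0: numerator and denominator both gain the factor t, the latter
  because \<alpha>/p + \<beta>/q = 1. A linear span of bumps is therefore not a suitable trial set.
  With the roots of w as coefficients all integrals involved become linear in |w_i|, so the l1 norm
  is the natural normalisation of w. In the lower bound, Young's inequality is applied to |u|/h and
  |v|/h, for which the Poincare constants are free of h; this is where the exponent \<alpha> +
  \<beta> comes from. The constants must not depend on Omega. Poincare's inequality is therefore
  used on cubes only, which are all similar, with test functions extended by zero across the
  boundary. The shape of Omega enters only the threshold for k, through how fine a grid must be
  before |Omega| controls the number of its cells. Infima and suprema are taken in the reals, so
  boundedness of the quotient on each admissible set and existence of admissible sets have to be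
  proved as well.\<close>

primrec faces :: "'a list \<Rightarrow> 'a list list" where
  "faces [] = []"
| "faces (x # xs) = xs # map ((#) x) (faces xs)"

text \<open>The standard triangulation of simplex times interval: vertices are mapped by f up to
  some vertex and by g from that vertex on. It is the chain homotopy between the maps induced by f
  and g.\<close>

primrec prism :: "('a \<Rightarrow> 'b) \<Rightarrow> ('a \<Rightarrow> 'b) \<Rightarrow> 'a list \<Rightarrow> 'b list list" where
  "prism f g [] = []"
| "prism f g (x # xs) = (f x # g x # map g xs) # map ((#) (f x)) (prism f g xs)"

text \<open>Chains modulo 2 are lists of simplices; two lists represent the same chain when
  \<open>csum F\<close> agrees on them for all F. Repeated simplices cancel in the sum, so no
  quotient has to be formed.\<close>

definition csum :: "('a \<Rightarrow> bit) \<Rightarrow> 'a list \<Rightarrow> bit" where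
  "csum F c = sum_list (map F c)"

definition bdry :: "'a list list \<Rightarrow> 'a list list" where
  "bdry c = concat (map faces c)"

text \<open>Keeps sums and products of bits in ring form, so that the general algebraic lemmas
  apply.\<close>

declare add_bit_eq_xor [simp del] mult_bit_eq_and [simp del]

lemma bit_add_self [simp]: "(x::bit) + x = 0"
  by (cases x) simp_all

lemma bit_add_left_self [simp]: "(x::bit) + (x + y) = y"
  by (cases x; cases y) simp_all

lemma bit_add_eq_iff: "(x::bit) + y = z \<longleftrightarrow> x = z + y"
  by (cases x; cases y; cases z) simp_all

lemma csum_simps [simp]:
  "csum F [] = 0" "csum F (x # xs) = F x + csum F xs"
  "csum F (xs @ ys) = csum F xs + csum F ys"
  by (simp_all add: csum_def)

lemma csum_map [simp]: "csum F (map g xs) = csum (\<lambda>x. F (g x)) xs"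
  by (simp add: csum_def o_def)

lemma csum_zero [simp]: "csum (\<lambda>_. 0) c = 0"
  by (induction c) simp_all

lemma csum_concat: "csum F (concat cs) = csum (csum F) cs"
  by (induction cs) simp_all

lemma csum_add: "csum (\<lambda>x. F x + G x) c = csum F c + csum G c"
  by (induction c) (simp_all add: ac_simps)

lemma csum_mult: "csum (\<lambda>x. k * F x) c = k * csum F c"
  by (induction c) (simp_all add: algebra_simps)

lemma csum_cong: "(\<And>x. x \<in> set c \<Longrightarrow> F x = G x) \<Longrightarrow> csum F c = csum G c"
  by (induction c) simp_all

lemma csum_bdry: "csum F (bdry c) = csum (\<lambda>\<sigma>. csum F (faces \<sigma>)) c"
  by (simp add: bdry_def csum_concat)

lemma faces_map: "faces (map f xs) = map (map f) (faces xs)"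
  by (induction xs) (simp_all add: o_def)

text \<open>This is dP + Pd = f + g, without signs because the coefficients are bits. The induction
  varies F, because prefixing \<open>f x\<close> to all simplices can be absorbed into F.\<close>

lemma prism_boundary:
  "csum F (bdry (prism f g \<sigma>)) + csum (\<lambda>\<tau>. csum F (prism f g \<tau>)) (faces \<sigma>)
     = F (map f \<sigma>) + F (map g \<sigma>)"
proof (induction \<sigma> arbitrary: F)
  case Nil
  show ?case by (simp add: bdry_def)
next
  case (Cons x xs)
  have IH: "csum (\<lambda>\<sigma>. csum (\<lambda>\<tau>. F (f x # \<tau>)) (faces \<sigma>)) (prism f g xs)
      = F (f x # map f xs) + F (f x # map g xs) + csum (\<lambda>\<tau>. csum (\<lambda>\<rho>. F (f x # \<rho>)) (prism f g \<tau>)) (faces xs)"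
    using Cons.IH[of "\<lambda>\<tau>. F (f x # \<tau>)"] unfolding csum_bdry bit_add_eq_iff .
  show ?case
    by (simp add: csum_bdry csum_add IH faces_map)
qed

text \<open>The term Pd drops out on a cycle: the hypothesis is applied to the functional that sums
  F over the prism on a face.\<close>

lemma prism_cycle:
  assumes "\<And>F. csum F (bdry z) = 0"
  shows "csum F (bdry (concat (map (prism f g) z))) = csum (\<lambda>\<sigma>. F (map f \<sigma>)) z + csum (\<lambda>\<sigma>. F (map g \<sigma>)) z"
proof -
  have "csum F (bdry (concat (map (prism f g) z))) = csum (\<lambda>\<sigma>. csum F (bdry (prism f g \<sigma>))) z"
    by (simp add: csum_bdry csum_concat)
  also have "\<dots> = csum (\<lambda>\<sigma>. (F (map f \<sigma>) + F (map g \<sigma>)) + csum (\<lambda>\<tau>. csum F (prism f g \<tau>)) (faces \<sigma>)) z"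
  proof (rule csum_cong)
    fix \<sigma>
    show "csum F (bdry (prism f g \<sigma>)) = (F (map f \<sigma>) + F (map g \<sigma>)) + csum (\<lambda>\<tau>. csum F (prism f g \<tau>)) (faces \<sigma>)"
      using prism_boundary[of F f g \<sigma>] unfolding bit_add_eq_iff .
  qed
  also have "\<dots> = csum (\<lambda>\<sigma>. F (map f \<sigma>)) z + csum (\<lambda>\<sigma>. F (map g \<sigma>)) z + csum (\<lambda>\<tau>. csum F (prism f g \<tau>)) (bdry z)"
    by (simp add: csum_add csum_bdry)
  finally show ?thesis using assms by simp
qed

text \<open>Slice at height \<open>t\<close> of the suspension structure on the \<open>\<ell>\<^sup>1\<close> sphere: \<open>t = 0\<close> is the equator, \<open>t = 1\<close> the pole.\<close>

definition level :: "nat \<Rightarrow> real \<Rightarrow> (nat \<Rightarrow> real) \<Rightarrow> nat \<Rightarrow> real" where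
  "level i t z = (\<lambda>j. (1 - t) * z j + (if j = i then t else 0))"

text \<open>\<open>hemi M i\<close> is the upper hemisphere of the \<open>i\<close>-sphere: the prisms between \<open>M\<close> successive
  parallels, over both hemispheres of the equator.\<close>

primrec hemi :: "nat \<Rightarrow> nat \<Rightarrow> (nat \<Rightarrow> real) list list" where
  "hemi M 0 = [[\<lambda>j. if j = 0 then 1 else 0]]"
| "hemi M (Suc i) = concat (map (\<lambda>j. concat (map
      (prism (level (Suc i) (real j / real M)) (level (Suc i) (real (Suc j) / real M)))
      (hemi M i @ map (map uminus) (hemi M i)))) [0..<M])"

lemma csum_telescope: "csum (\<lambda>j. \<Phi> j + \<Phi> (Suc j)) [0..<M] = \<Phi> 0 + \<Phi> M"
  by (induction M) (simp_all add: ac_simps)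

lemma uminus_uminus_fun: "uminus \<circ> uminus = (id :: (nat \<Rightarrow> real) \<Rightarrow> _)"
  by (auto simp: fun_eq_iff)

text \<open>The two relations support each other. The boundary of the next hemisphere is computed
  from the cycle property of the present sphere; that property one dimension up then holds because
  the equator and its antipode occur twice. Hence \<open>step\<close> is first stated under the
  cycle hypothesis.\<close>

lemma hemi_boundary:
  assumes M: "M > 0"
  shows "csum F (bdry (hemi M i @ map (map uminus) (hemi M i))) = 0"
    and "csum F (bdry (hemi M (Suc i))) = csum F (hemi M i) + csum (\<lambda>\<sigma>. F (map uminus \<sigma>)) (hemi M i)"
proof -
  have step: "csum F (bdry (hemi M (Suc i))) = csum F (hemi M i) + csum (\<lambda>\<sigma>. F (map uminus \<sigma>)) (hemi M i)"
    if cyc: "\<And>F. csum F (bdry (hemi M i @ map (map uminus) (hemi M i))) = 0" for i F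
  proof -
    let ?z = "hemi M i @ map (map uminus) (hemi M i)"
    define \<Phi> where "\<Phi> j = csum (\<lambda>\<sigma>. F (map (level (Suc i) (real j / real M)) \<sigma>)) ?z" for j :: nat
    have "csum F (bdry (hemi M (Suc i))) = csum (\<lambda>j. \<Phi> j + \<Phi> (Suc j)) [0..<M]"
      unfolding hemi.simps csum_bdry csum_concat[of _ "map _ [0..<M]"] csum_map
      unfolding csum_bdry[symmetric] prism_cycle[OF cyc] \<Phi>_def ..
    also have "\<dots> = \<Phi> 0 + \<Phi> M"
      by (rule csum_telescope)
    also have "\<Phi> 0 = csum F (hemi M i) + csum (\<lambda>\<sigma>. F (map uminus \<sigma>)) (hemi M i)"
    proof -
      have "level (Suc i) 0 = id" by (auto simp: level_def fun_eq_iff)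
      then show ?thesis unfolding \<Phi>_def by simp
    qed
    \<comment> \<open>At height 1 every vertex goes to the pole, so a simplex and its antipode have
      the same (degenerate) image and cancel.\<close>
    also have "\<Phi> M = 0"
    proof -
      have 1: "level (Suc i) 1 (- z) = level (Suc i) 1 z" for z by (auto simp: level_def fun_eq_iff)
      then show ?thesis using M unfolding \<Phi>_def by (simp add: o_def)
    qed
    finally show ?thesis by (simp only: add_0_right)
  qed
  have cyc: "csum F (bdry (hemi M i @ map (map uminus) (hemi M i))) = 0" for F
  proof (induction i arbitrary: F)
    case 0
    \<comment> \<open>The complex is augmented: \<open>faces\<close> maps a vertex to the empty
      simplex, so that a pair of points is a cycle modulo 2.\<close>
    show ?case by (simp add: bdry_def)
  next
    case (Suc i)
    show ?case
      unfolding csum_bdry csum_simps csum_map faces_map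
      unfolding csum_bdry[symmetric] step[OF Suc]
      by (simp add: uminus_uminus_fun ac_simps)
  qed
  show "csum F (bdry (hemi M i @ map (map uminus) (hemi M i))) = 0" by (rule cyc)
  show "csum F (bdry (hemi M (Suc i))) = csum F (hemi M i) + csum (\<lambda>\<sigma>. F (map uminus \<sigma>)) (hemi M i)"
    by (rule step[OF cyc])
qed

text \<open>The cup product of the coboundaries of the \<open>0\<close>-cochains in the list.\<close>

fun cup :: "('a \<Rightarrow> bit) list \<Rightarrow> 'a list \<Rightarrow> bit" where
  "cup [] \<sigma> = 1"
| "cup (s # ss) (v # v' # vs) = (s v + s v') * cup ss (v' # vs)"
| "cup (s # ss) _ = 0"

section \<open>Closedness and exactness of cup products of coboundaries\<close>

text \<open>A cup product of coboundaries is a cocycle. After the induction hypothesis every term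
  carries the factor \<open>cup ss (c # xs)\<close>, with total coefficient (s b + s c) + (s a + s
  c) + (s a + s b) = 0.\<close>

lemma cup_coboundary: 
  "length \<sigma> = length ss + 2 \<Longrightarrow> csum (cup ss) (faces \<sigma>) = 0"
proof (induction ss arbitrary: \<sigma>)
  case Nil
  then obtain a b where "\<sigma> = [a, b]" by (auto simp: numeral_2_eq_2 length_Suc_conv)
  then show ?case by simp
next
  case (Cons s ss)
  then obtain a b c xs where \<sigma>: "\<sigma> = a # b # c # xs" and l: "length (b # c # xs) = length ss + 2"
    by (auto simp: numeral_2_eq_2 length_Suc_conv)
  have "cup ss (c # xs) + (cup ss (b # xs) + csum (\<lambda>x. cup ss (b # c # x)) (faces xs)) = 0"
    using Cons.IH[OF l] by simp
  then have e: "cup ss (b # xs) + csum (\<lambda>x. cup ss (b # c # x)) (faces xs) = cup ss (c # xs)"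
    by (metis add.right_neutral bit_add_left_self)
  have "csum (cup (s # ss)) (faces \<sigma>) = (s b + s c) * cup ss (c # xs) + ((s a + s c) * cup ss (c # xs)
      + (s a + s b) * (cup ss (b # xs) + csum (\<lambda>x. cup ss (b # c # x)) (faces xs)))"
    unfolding \<sigma> by (simp add: csum_mult distrib_left)
  also have "\<dots> = 0" unfolding e 
    by (cases "s a"; cases "s b"; cases "s c"; simp)
  finally show ?case .
qed

text \<open>Let c be the cup product of the remaining coboundaries. As c is closed, ds cup c = d(s
  cup c), and s cup c is the cochain \<open>s (hd \<tau>) * cup ss \<tau>\<close>. This moves a
  pairing with a chain to the boundary of the chain.\<close>

lemma cup_exact:
  assumes "length \<sigma> = length ss + 2"
  shows "cup (s # ss) \<sigma> = csum (\<lambda>\<tau>. s (hd \<tau>) * cup ss \<tau>) (faces \<sigma>)"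
proof -
  obtain a b xs where \<sigma>: "\<sigma> = a # b # xs" 
    using assms by (auto simp: numeral_2_eq_2 length_Suc_conv)
  have "cup ss (b # xs) + csum (\<lambda>x. cup ss (a # x)) (faces (b # xs)) = 0"
    using cup_coboundary[OF assms] by (simp add: \<sigma>)
  then have "csum (\<lambda>x. cup ss (a # x)) (faces (b # xs)) = cup ss (b # xs)"
    by (metis add.right_neutral bit_add_left_self)
  then show ?thesis
    unfolding \<sigma> by (simp add: csum_mult flip: distrib_left) (simp add: algebra_simps)
qed

section \<open>The l1 spheres and the mesh of their triangulations\<close>

text \<open>The l1 norm is chosen because \<open>level\<close> is affine and still maps a sphere
  into the next one, with no normalisation. Finitely supported sequences put the spheres of all
  dimensions into one type, each inside the next.\<close>

definition l1_sphere :: "nat \<Rightarrow> (nat \<Rightarrow> real) set" where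
  "l1_sphere n = {x. (\<forall>j>n. x j = 0) \<and> (\<Sum>j\<le>n. \<bar>x j\<bar>) = 1}"

lemma l1_sphere_uminus [simp]: "- x \<in> l1_sphere n \<longleftrightarrow> x \<in> l1_sphere n"
  by (simp add: l1_sphere_def)

lemma l1_sphere_coord: assumes "x \<in> l1_sphere n" shows "\<bar>x j\<bar> \<le> 1"
proof (cases "j \<le> n")
  case True
  then have "\<bar>x j\<bar> \<le> (\<Sum>j\<le>n. \<bar>x j\<bar>)" by (intro member_le_sum) auto
  then show ?thesis using assms by (simp add: l1_sphere_def)
qed (use assms in \<open>auto simp: l1_sphere_def\<close>)

lemma l1_sphere_mono: "m \<le> n \<Longrightarrow> l1_sphere m \<subseteq> l1_sphere n"
proof
  fix x assume "m \<le> n" and x: "x \<in> l1_sphere m"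
  have "(\<Sum>j\<le>n. \<bar>x j\<bar>) = (\<Sum>j\<le>m. \<bar>x j\<bar>)"
    using \<open>m \<le> n\<close> x by (intro sum.mono_neutral_right) (auto simp: l1_sphere_def)
  then show "x \<in> l1_sphere n" using x \<open>m \<le> n\<close> by (auto simp: l1_sphere_def)
qed

lemma level_in_l1_sphere:
  assumes "z \<in> l1_sphere i" "0 \<le> t" "t \<le> 1"
  shows "level (Suc i) t z \<in> l1_sphere (Suc i)"
proof -
  have "(\<Sum>j\<le>i. \<bar>(1 - t) * z j\<bar>) = (1 - t) * (\<Sum>j\<le>i. \<bar>z j\<bar>)"
    using assms by (simp add: sum_distrib_left abs_mult)
  then show ?thesis using assms by (auto simp: level_def l1_sphere_def)
qed

lemma prism_set:
  assumes "\<tau> \<in> set (prism f g \<sigma>)" 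
  shows "length \<tau> = Suc (length \<sigma>)" "set \<tau> \<subseteq> f ` set \<sigma> \<union> g ` set \<sigma>"
  using assms by (induction \<sigma> arbitrary: \<tau>) fastforce+

text \<open>A change of height by d costs at most d in the scaled point and at most d in the pole
  coordinate, while the old distance is contracted. With heights 1/M apart, the mesh grows by 2/M
  per dimension, which gives the bound 2i/M in \<open>hemi_simplex\<close>.\<close>

lemma level_dist:
  assumes "\<bar>z j - z' j\<bar> \<le> \<epsilon>" "\<bar>z' j\<bar> \<le> 1" "0 \<le> t" "t \<le> 1" "\<bar>t - t'\<bar> \<le> d"
  shows "\<bar>level i t z j - level i t' z' j\<bar> \<le> \<epsilon> + 2 * d"
proof -
  have "level i t z j - level i t' z' j = (1 - t) * (z j - z' j) + (t' - t) * z' j + (if j = i then t - t' else 0)"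
    by (simp add: level_def algebra_simps)
  also have "\<bar>\<dots>\<bar> \<le> \<bar>(1 - t) * (z j - z' j)\<bar> + \<bar>(t' - t) * z' j\<bar> + d"
    using assms(5) by auto
  also have "\<bar>(1 - t) * (z j - z' j)\<bar> \<le> 1 * \<epsilon>"
    unfolding abs_mult using assms by (intro mult_mono) auto
  also have "\<bar>(t' - t) * z' j\<bar> \<le> d * 1"
    unfolding abs_mult using assms by (intro mult_mono) auto
  finally show ?thesis by simp
qed

lemma hemi_simplex:
  assumes "M > 0" "\<sigma> \<in> set (hemi M i)"
  shows "length \<sigma> = Suc i" "set \<sigma> \<subseteq> l1_sphere i"
    "v \<in> set \<sigma> \<Longrightarrow> w \<in> set \<sigma> \<Longrightarrow> \<bar>v j - w j\<bar> \<le> 2 * real i / real M"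
proof -
  have "length \<sigma> = Suc i \<and> set \<sigma> \<subseteq> l1_sphere i \<and> (\<forall>v\<in>set \<sigma>. \<forall>w\<in>set \<sigma>. \<bar>v j - w j\<bar> \<le> 2 * real i / real M)"
    using assms(2)
  proof (induction i arbitrary: \<sigma>)
    case 0
    then show ?case by (auto simp: l1_sphere_def)
  next
    case (Suc i)
    have "\<exists>k<M. \<exists>\<rho>\<in>set (hemi M i @ map (map uminus) (hemi M i)). 
        \<sigma> \<in> set (prism (level (Suc i) (real k / real M)) (level (Suc i) (real (Suc k) / real M)) \<rho>)"
      using Suc.prems unfolding hemi.simps set_concat set_map set_upt
      by (elim UN_E imageE) (simp only: set_concat set_map set_upt, elim UN_E imageE, simp only: set_map, fastforce)
    then obtain k \<rho> where k: "k < M" and \<rho>: "\<rho> \<in> set (hemi M i @ map (map uminus) (hemi M i))" 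
      and \<sigma>: "\<sigma> \<in> set (prism (level (Suc i) (real k / real M)) (level (Suc i) (real (Suc k) / real M)) \<rho>)"
      by blast
    have R: "length \<rho> = Suc i" "set \<rho> \<subseteq> l1_sphere i" "\<And>v w. v\<in>set \<rho> \<Longrightarrow> w\<in>set \<rho> \<Longrightarrow> \<bar>v j - w j\<bar> \<le> 2 * real i / real M"
      using \<rho> Suc.IH by (fastforce simp: abs_minus_commute)+
    have t: "0 \<le> real k / real M" "real k / real M \<le> 1" "0 \<le> real (Suc k) / real M" "real (Suc k) / real M \<le> 1"
      using k by (auto simp: divide_simps)
    have sub: "set \<sigma> \<subseteq> {level (Suc i) t z | t z. z \<in> set \<rho> \<and> t \<in> {real k / real M, real (Suc k) / real M}}"
      using prism_set(2)[OF \<sigma>] by blast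
    have "\<bar>v j - w j\<bar> \<le> 2 * real (Suc i) / real M" if v: "v \<in> set \<sigma>" and w: "w \<in> set \<sigma>" for v w
    proof -
      obtain t z where v: "v = level (Suc i) t z" "z \<in> set \<rho>" "t \<in> {real k / real M, real (Suc k) / real M}" using v sub by blast
      obtain t' z' where w: "w = level (Suc i) t' z'" "z' \<in> set \<rho>" "t' \<in> {real k / real M, real (Suc k) / real M}" using w sub by blast
      have "\<bar>real k / real M - real (Suc k) / real M\<bar> = 1 / real M"
        unfolding diff_divide_distrib[symmetric] by simp
      then have "\<bar>t - t'\<bar> \<le> 1 / real M" using v(3) w(3) by (auto simp: abs_minus_commute)
      then have "\<bar>v j - w j\<bar> \<le> 2 * real i / real M + 2 * (1 / real M)"
        unfolding v(1) w(1) using v w t R(3)[OF v(2) w(2)] l1_sphere_coord[of z' i j] R(2)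
        by (intro level_dist) auto
      then show ?thesis by (simp add: add_divide_distrib)
    qed
    moreover have "set \<sigma> \<subseteq> l1_sphere (Suc i)"
    proof
      fix v assume "v \<in> set \<sigma>"
      then obtain t z where "v = level (Suc i) t z" "z \<in> set \<rho>" "t \<in> {real k / real M, real (Suc k) / real M}" using sub by blast
      then show "v \<in> l1_sphere (Suc i)" using R(2) t level_in_l1_sphere by blast
    qed
    ultimately show ?case using prism_set(1)[OF \<sigma>] R(1) by (metis (no_types))
  qed
  then show "length \<sigma> = Suc i" "set \<sigma> \<subseteq> l1_sphere i"
    "v \<in> set \<sigma> \<Longrightarrow> w \<in> set \<sigma> \<Longrightarrow> \<bar>v j - w j\<bar> \<le> 2 * real i / real M" by auto
qed

text \<open>An odd cochain changes by 1 at both ends of an edge, so its coboundary is invariant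
  under the antipodal map.\<close>

lemma cup_uminus:
  assumes "set \<sigma> \<subseteq> A" "\<And>s v. s \<in> set ss \<Longrightarrow> v \<in> A \<Longrightarrow> s (- v) = s v + 1"
  shows "cup ss (map uminus \<sigma>) = cup ss \<sigma>"
  using assms
proof (induction ss \<sigma> rule: cup.induct)
  case (2 s ss v v' vs)
  have "(s v + 1) + (s v' + 1) = s v + s v'" by (cases "s v"; cases "s v'"; simp)
  with 2 show ?case by simp
qed auto

text \<open>Stokes' formula trades the leading cochain for one dimension. On a boundary simplex and
  its antipode the leading cochain takes complementary values at the first vertex, while the rest of
  the product agrees, so together they contribute \<open>cup ss' \<sigma>\<close>. In dimension 0
  the empty product is evaluated on a single vertex.\<close>

lemma cup_hemi:
  assumes M: "M > 0" and "length ss = i" "i \<le> n"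
    and odd: "\<And>s v. s \<in> set ss \<Longrightarrow> v \<in> l1_sphere n \<Longrightarrow> s (- v) = s v + (1::bit)"
  shows "csum (cup ss) (hemi M i) = 1"
  using assms(2-)
proof (induction i arbitrary: ss)
  case 0
  then show ?case by simp
next
  case (Suc i)
  then obtain s ss' where ss: "ss = s # ss'" and l: "length ss' = i" by (cases ss) auto
  define G where "G \<tau> = s (hd \<tau>) * cup ss' \<tau>" for \<tau>
  have "csum (cup ss) (hemi M (Suc i)) = csum G (bdry (hemi M (Suc i)))"
    unfolding csum_bdry using M l by (intro csum_cong) (simp add: ss cup_exact G_def[abs_def] hemi_simplex del: hemi.simps)
  also have "\<dots> = csum (\<lambda>\<sigma>. G \<sigma> + G (map uminus \<sigma>)) (hemi M i)"
    unfolding hemi_boundary(2)[OF M] csum_add ..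
  also have "\<dots> = csum (cup ss') (hemi M i)"
  proof (rule csum_cong)
    fix \<sigma> assume \<sigma>: "\<sigma> \<in> set (hemi M i)"
    note H = hemi_simplex[OF M \<sigma>]
    have sub: "set \<sigma> \<subseteq> l1_sphere n" using H(2) l1_sphere_mono[of i n] Suc.prems by auto
    have "hd \<sigma> \<in> set \<sigma>" using H(1) by (cases \<sigma>) auto
    moreover have "hd (map uminus \<sigma>) = - hd \<sigma>" using H(1) by (cases \<sigma>) auto
    ultimately have "s (hd (map uminus \<sigma>)) = s (hd \<sigma>) + 1" using Suc.prems(3)[of s "hd \<sigma>"] sub unfolding ss by (metis list.set_intros(1) subsetD)
    moreover have "cup ss' (map uminus \<sigma>) = cup ss' \<sigma>"
      using Suc.prems(3) sub unfolding ss by (intro cup_uminus[of _ "l1_sphere n"]) (blast intro: list.set_intros)+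
    ultimately show "G \<sigma> + G (map uminus \<sigma>) = cup ss' \<sigma>"
      by (simp add: G_def algebra_simps)
  qed
  also have "\<dots> = 1" using Suc.IH[OF l] Suc.prems by (auto simp: ss)
  finally show ?case .
qed

lemma cup_nonzero:
  assumes "cup ss \<sigma> \<noteq> 0" "i < length ss"
  shows "Suc i < length \<sigma> \<and> (ss ! i) (\<sigma> ! i) \<noteq> (ss ! i) (\<sigma> ! Suc i)"
  using assms
proof (induction ss \<sigma> arbitrary: i rule: cup.induct)
  case (2 s ss v v' vs)
  then show ?case by (cases i) auto
qed auto

text \<open>In the product topology the sphere is a closed subset of the cube [-1,1]^nat, which is
  compact by Tychonoff's theorem.\<close>

lemma compact_l1_sphere: "compact (l1_sphere n)"
proof -
  have "compactin (product_topology (\<lambda>i::nat. euclideanreal) UNIV) (PiE UNIV (\<lambda>i. {-1..1::real}))"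
    unfolding compactin_PiE by simp
  then have "compact (PiE UNIV (\<lambda>i::nat. {-1..1::real}))"
    by (simp add: euclidean_product_topology)
  moreover have "closed (l1_sphere n)"
  proof -
    have "l1_sphere n = (\<Inter>j\<in>{n<..}. {x. x j = 0}) \<inter> {x. (\<Sum>j\<le>n. \<bar>x j\<bar>) = 1}"
      by (auto simp: l1_sphere_def)
    also have "closed \<dots>"
      by (intro closed_Int closed_INT ballI closed_Collect_eq continuous_intros continuous_on_product_coordinates)
    finally show ?thesis .
  qed
  ultimately have "compact (PiE UNIV (\<lambda>i::nat. {-1..1::real}) \<inter> l1_sphere n)"
    by (rule compact_Int_closed)
  moreover have "PiE UNIV (\<lambda>i::nat. {-1..1::real}) \<inter> l1_sphere n = l1_sphere n"
  proof -
    have "x \<in> PiE UNIV (\<lambda>i. {-1..1::real})" if "x \<in> l1_sphere n" for x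
    proof (rule PiE_I)
      fix i show "x i \<in> {-1..1}" using l1_sphere_coord[OF that, of i] by auto
    qed simp
    then show ?thesis by blast
  qed
  ultimately show ?thesis by simp
qed

lemma tendsto_fun_iff:
  fixes x :: "'b \<Rightarrow> real"
  shows "(f \<longlongrightarrow> x) F \<longleftrightarrow> (\<forall>j. ((\<lambda>n. f n j) \<longlongrightarrow> x j) F)"
  using limitin_componentwise[of "\<lambda>_. euclideanreal" UNIV f x F] by (simp add: euclidean_product_topology)

theorem Borsuk_Ulam_l1_sphere:
  fixes f :: "nat \<Rightarrow> (nat \<Rightarrow> real) \<Rightarrow> real"
  assumes cont: "\<And>i. i < n \<Longrightarrow> continuous_on (l1_sphere n) (f i)"
    and odd: "\<And>i x. i < n \<Longrightarrow> x \<in> l1_sphere n \<Longrightarrow> f i (- x) = - f i x"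
  obtains x where "x \<in> l1_sphere n" "\<And>i. i < n \<Longrightarrow> f i x = 0"
proof -
  \<comment> \<open>The sign of the first nonzero coordinate is odd on the sphere. It decides the
    value of the cochain where f vanishes, so that the cochain is odd everywhere.\<close>
  define pos where "pos x \<longleftrightarrow> x (LEAST j. x j \<noteq> 0) > 0" for x :: "nat \<Rightarrow> real"
  have pos_uminus: "pos (- x) \<longleftrightarrow> \<not> pos x" if "x \<in> l1_sphere n" for x
  proof -
    have "\<exists>j. x j \<noteq> 0" using that by (auto simp: l1_sphere_def intro: ccontr)
    then have "x (LEAST j. x j \<noteq> 0) \<noteq> 0" by (rule LeastI_ex)
    then show ?thesis by (auto simp: pos_def)
  qed
  define s :: "nat \<Rightarrow> (nat \<Rightarrow> real) \<Rightarrow> bit" where "s i x = of_bool (f i x > 0 \<or> (f i x = 0 \<and> pos x))" for i x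
  have s_odd: "s i (- x) = s i x + 1" if "i < n" "x \<in> l1_sphere n" for i x
    using odd[OF that] pos_uminus[OF that(2)] by (auto simp: s_def)
  have "\<exists>\<sigma>. \<sigma> \<in> set (hemi (Suc M) n) \<and> (\<forall>i<n. s i (\<sigma> ! i) \<noteq> s i (\<sigma> ! Suc i))" for M
  proof -
    have "csum (cup (map s [0..<n])) (hemi (Suc M) n) = 1"
      by (rule cup_hemi[of _ _ n n]) (auto simp: s_odd)
    then have "\<exists>\<sigma>\<in>set (hemi (Suc M) n). cup (map s [0..<n]) \<sigma> \<noteq> 0"
      using csum_cong[of "hemi (Suc M) n" "cup (map s [0..<n])" "\<lambda>_. 0"] by fastforce
    then show ?thesis using cup_nonzero[of "map s [0..<n]"] by fastforce
  qed
  then obtain S where S: "S M \<in> set (hemi (Suc M) n)" "\<And>i. i < n \<Longrightarrow> s i (S M ! i) \<noteq> s i (S M ! Suc i)" for M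
    by metis
  have Smem: "S M ! i \<in> set (S M)" if "i \<le> n" for M i
    using that hemi_simplex(1)[OF _ S(1), of M] by (intro nth_mem) simp
  have Ssph: "S M ! i \<in> l1_sphere n" if "i \<le> n" for M i
    using Smem[OF that] hemi_simplex(2)[OF _ S(1), of M] by auto
  obtain x r where x: "x \<in> l1_sphere n" and r: "strict_mono r" and lim: "((\<lambda>M. S M ! 0) \<circ> r) \<longlonglongrightarrow> x"
    using seq_compactE[OF compact_imp_seq_compact[OF compact_l1_sphere], of "\<lambda>M. S M ! 0" n thesis] Ssph[of 0] that
    by simp
  have lim': "(\<lambda>M. S (r M) ! i) \<longlonglongrightarrow> x" if "i \<le> n" for i
  proof -
    have "(\<lambda>M. (S (r M) ! i) j) \<longlonglongrightarrow> x j" for j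
    proof -
      have "(\<lambda>M. (S (r M) ! 0) j) \<longlonglongrightarrow> x j"
        using lim unfolding tendsto_fun_iff by (simp add: o_def)
      moreover have "(\<lambda>M. (S (r M) ! i) j - (S (r M) ! 0) j) \<longlonglongrightarrow> 0"
      proof (rule Lim_null_comparison)
        show "\<forall>\<^sub>F M in sequentially. norm ((S (r M) ! i) j - (S (r M) ! 0) j) \<le> 2 * real n / real (Suc (r M))"
          using hemi_simplex(3)[OF _ S(1) Smem Smem] that by auto
        have "(\<lambda>M. 2 * real n / real (Suc M)) \<longlonglongrightarrow> 0"
          by (rule LIMSEQ_Suc[OF lim_const_over_n])
        from LIMSEQ_subseq_LIMSEQ[OF this r] show "(\<lambda>M. 2 * real n / real (Suc (r M))) \<longlonglongrightarrow> 0"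
          by (simp add: o_def)
      qed
      ultimately show ?thesis using tendsto_add by fastforce
    qed
    then show ?thesis unfolding tendsto_fun_iff by simp
  qed
  have "f i x = 0" if i: "i < n" for i
  proof -
    have L: "(\<lambda>M. f i (S (r M) ! j)) \<longlonglongrightarrow> f i x" if "j \<le> n" for j
      using cont[OF i] x Ssph[OF that] lim'[OF that] unfolding continuous_on_sequentially
      by (auto simp: o_def)
    have "(\<lambda>M. f i (S (r M) ! i) * f i (S (r M) ! Suc i)) \<longlonglongrightarrow> f i x * f i x"
      using i by (intro tendsto_mult L) auto
    \<comment> \<open>Different bits mean opposite signs or a zero, since ties were broken
      arbitrarily; the product is at most 0 in each case. In the limit both factors become
      \<open>f i x\<close>.\<close>
    moreover have "f i (S M ! i) * f i (S M ! Suc i) \<le> 0" for M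
      using S(2)[OF i, of M] by (auto simp: s_def mult_le_0_iff split: if_splits)
    ultimately have "f i x * f i x \<le> 0"
      by (intro LIMSEQ_le_const2) auto
    then show ?thesis by (auto simp: mult_le_0_iff)
  qed
  with x that show thesis by blast
qed

section \<open>Smooth bump functions\<close>

lemma has_derivative_imp_grad:
  assumes "(f has_derivative (\<lambda>v. g \<bullet> v)) (at x)"
  shows "grad f x = g"
proof -
  have "frechet_derivative f (at x) = (\<lambda>v. g \<bullet> v)"
    using frechet_derivative_at[OF assms] by simp
  then show ?thesis
    by (simp add: grad_def partial_deriv_def vec_eq_iff cart_eq_inner_axis[of g])
qed

lemma grad_has_derivative:
  fixes f :: "real^'n \<Rightarrow> real"
  assumes "f differentiable (at x)"
  shows "(f has_derivative (\<lambda>v. grad f x \<bullet> v)) (at x)"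
proof -
  let ?F = "frechet_derivative f (at x)"
  have F: "(f has_derivative ?F) (at x)" using assms by (simp add: frechet_derivative_works)
  then interpret linear ?F by (rule has_derivative_linear)
  have "?F v = grad f x \<bullet> v" for v
  proof -
    have "v = (\<Sum>i\<in>UNIV. v $ i *\<^sub>R axis i 1)"
      using basis_expansion[of v] by (simp add: scalar_mult_eq_scaleR)
    then have "?F v = ?F (\<Sum>i\<in>UNIV. v $ i *\<^sub>R axis i 1)" by (rule arg_cong)
    also have "\<dots> = (\<Sum>i\<in>UNIV. v $ i * ?F (axis i 1))" by (simp add: sum scaleR)
    also have "\<dots> = grad f x \<bullet> v"
      by (simp add: grad_def partial_deriv_def inner_vec_def mult.commute)
    finally show ?thesis .
  qed
  then show ?thesis using F by (metis (no_types, lifting) ext)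
qed

text \<open>The derivative of \<open>expinv m\<close> is a combination of \<open>expinv (m + 1)\<close> and \<open>expinv (m + 2)\<close>, so
  this family generates, under sums and products, a class of functions closed under partial derivatives.\<close>

definition expinv :: "nat \<Rightarrow> real \<Rightarrow> real" where
  "expinv m t = (if t > 0 then (1 / t) ^ m * exp (- (1 / t)) else 0)"

lemma expinv_tendsto_0: "(expinv m \<longlongrightarrow> 0) (at 0)"
proof -
  have "((\<lambda>y. y ^ m / exp y) \<longlongrightarrow> (0::real)) at_top" by (rule tendsto_power_div_exp_0)
  moreover have "filterlim (\<lambda>t::real. 1 / t) at_top (at_right 0)"
    using filterlim_inverse_at_top_right by (simp add: inverse_eq_divide)
  ultimately have "((\<lambda>t. (1 / t) ^ m / exp (1 / t)) \<longlongrightarrow> (0::real)) (at_right 0)"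
    by (rule filterlim_compose)
  then have r: "(expinv m \<longlongrightarrow> 0) (at_right 0)"
    by (rule Lim_transform_eventually)
      (auto simp: expinv_def eventually_at_filter exp_minus field_simps)
  have "(expinv m \<longlongrightarrow> 0) (at_left 0)"
    by (rule tendsto_eventually) (auto simp: expinv_def eventually_at_filter)
  with r show ?thesis by (simp add: filterlim_split_at)
qed

lemma expinv_has_derivative:
  "(expinv m has_real_derivative (expinv (m + 2) t - real m * expinv (m + 1) t)) (at t)"
proof -
  consider "t < 0" | "t = 0" | "t > 0" by linarith
  then show ?thesis
  proof cases
    case 1
    have "((\<lambda>_. 0) has_real_derivative 0) (at t)" by simp
    then have "(expinv m has_real_derivative 0) (at t)"
      by (rule has_field_derivative_transform_within_open[of _ _ _ "{..<0}"])
        (use 1 in \<open>auto simp: expinv_def\<close>)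
    then show ?thesis using 1 by (simp add: expinv_def)
  next
    case 2
    \<comment> \<open>The difference quotient of \<open>expinv m\<close> at 0 is
      \<open>expinv (m + 1)\<close>, which tends to 0.\<close>
    have "((\<lambda>h. (expinv m (0 + h) - expinv m 0) / h) \<longlongrightarrow> 0) (at 0)"
      using expinv_tendsto_0[of "m + 1"]
      by (rule Lim_transform_eventually) (auto simp: expinv_def eventually_at_filter)
    then show ?thesis unfolding DERIV_def 2 by (simp add: expinv_def)
  next
    case 3
    have D: "((\<lambda>t. 1 / t) has_real_derivative - ((1 / t)\<^sup>2)) (at t)"
      using 3 by (auto intro!: derivative_eq_intros simp: power2_eq_square)
    have "((\<lambda>t. (1 / t) ^ m * exp (- (1 / t))) has_real_derivative
        (expinv (m + 2) t - real m * expinv (m + 1) t)) (at t)"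
      by (rule DERIV_cong[OF DERIV_mult[OF DERIV_power[OF D] DERIV_chain2[OF DERIV_exp DERIV_minus[OF D]]]])
        (use 3 in \<open>cases m; simp add: expinv_def field_simps power2_eq_square\<close>)
    then show ?thesis
      by (rule has_field_derivative_transform_within_open[of _ _ _ "{0<..}"])
        (use 3 in \<open>auto simp: expinv_def\<close>)
  qed
qed

lemma expinv_bounds: "0 \<le> expinv m t" "expinv 0 t \<le> 1" "0 < t \<Longrightarrow> 0 < expinv m t"
  "expinv m t \<noteq> 0 \<Longrightarrow> 0 < t"
  by (auto simp: expinv_def split: if_splits)

lemma expinv_mono: assumes "s \<le> t" shows "expinv 0 s \<le> expinv 0 t"
  using assms by (auto simp: expinv_def frac_le)

inductive expinv_alg :: "(real^'n \<Rightarrow> real) \<Rightarrow> bool" where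
  const: "expinv_alg (\<lambda>x. c)"
| base: "expinv_alg (\<lambda>x. expinv m (a * x $ i + b))"
| add: "expinv_alg f \<Longrightarrow> expinv_alg g \<Longrightarrow> expinv_alg (\<lambda>x. f x + g x)"
| mult: "expinv_alg f \<Longrightarrow> expinv_alg g \<Longrightarrow> expinv_alg (\<lambda>x. f x * g x)"

lemma expinv_alg_partial:
  fixes f :: "real^'n \<Rightarrow> real"
  assumes "expinv_alg f"
  shows "(\<forall>x. f differentiable (at x)) \<and> (\<forall>j. expinv_alg (partial_deriv f j))"
  using assms
proof induction
  case (const c)
  have "partial_deriv (\<lambda>x. c) j = (\<lambda>x. 0)" for j :: 'n
    by (auto simp: partial_deriv_def fun_eq_iff)
  then show ?case using expinv_alg.const[of 0] by simp
next
  case (base m a i b)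
  let ?f = "\<lambda>x::real^'n. expinv m (a * x $ i + b)"
  define D where "D x = expinv (m + 2) (a * x $ i + b) + (- real m) * expinv (m + 1) (a * x $ i + b)" for x :: "real^'n"
  have d: "(?f has_derivative (\<lambda>v. D x * (a * v $ i))) (at x)" for x
  proof -
    have "((\<lambda>x::real^'n. a * x $ i + b) has_derivative (\<lambda>v. a * v $ i)) (at x)"
      by (auto intro!: derivative_eq_intros bounded_linear_imp_has_derivative)
    from has_derivative_compose[OF this, of "expinv m"] show ?thesis
      using expinv_has_derivative[of m "a * x $ i + b"] unfolding D_def has_field_derivative_def by simp
  qed
  have "partial_deriv ?f j = (\<lambda>x. (if j = i then a else 0) * D x)" for j
    unfolding partial_deriv_def fun_eq_iff frechet_derivative_at[OF d, symmetric] by (simp add: axis_def)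
  moreover have "expinv_alg (\<lambda>x. k * D x)" for k
    unfolding D_def by (intro expinv_alg.intros)
  ultimately show ?case using d by (auto simp: differentiable_def)
next
  case (add f g)
  have "partial_deriv (\<lambda>x. f x + g x) j = (\<lambda>x. partial_deriv f j x + partial_deriv g j x)" for j
  proof
    fix x
    have "((\<lambda>x. f x + g x) has_derivative (\<lambda>h. frechet_derivative f (at x) h + frechet_derivative g (at x) h)) (at x)"
      using add by (intro has_derivative_add) (auto simp: frechet_derivative_works)
    from frechet_derivative_at[OF this, symmetric]
    show "partial_deriv (\<lambda>x. f x + g x) j x = partial_deriv f j x + partial_deriv g j x"
      by (simp add: partial_deriv_def)
  qed
  then show ?case using add by (auto intro: expinv_alg.intros)
next
  case (mult f g)
  have "partial_deriv (\<lambda>x. f x * g x) j = (\<lambda>x. f x * partial_deriv g j x + partial_deriv f j x * g x)" for j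
  proof
    fix x
    have "((\<lambda>x. f x * g x) has_derivative (\<lambda>h. f x * frechet_derivative g (at x) h + frechet_derivative f (at x) h * g x)) (at x)"
      using mult by (intro has_derivative_mult) (auto simp: frechet_derivative_works)
    from frechet_derivative_at[OF this, symmetric]
    show "partial_deriv (\<lambda>x. f x * g x) j x = f x * partial_deriv g j x + partial_deriv f j x * g x"
      by (simp add: partial_deriv_def)
  qed
  then show ?case using mult by (auto intro!: expinv_alg.intros)
qed

text \<open>Induction on the order of differentiability needs a whole class closed under
  \<open>partial_deriv\<close>; it could not be run for a single function.\<close>

lemma expinv_alg_smooth:
  assumes "expinv_alg f"
  shows "smooth_on f UNIV"
proof -
  have "Ck_on k f UNIV" for k
    using assms
  proof (induction k arbitrary: f)
    case (Suc k)
    have "f differentiable_on UNIV"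
      using expinv_alg_partial[OF Suc.prems] by (simp add: differentiable_on_def)
    then show ?case
      using Suc expinv_alg_partial[OF Suc.prems] differentiable_imp_continuous_on by auto
  next
    case 0
    have "f differentiable_on UNIV"
      using expinv_alg_partial[OF 0] by (simp add: differentiable_on_def)
    then show ?case using differentiable_imp_continuous_on by auto
  qed
  then show ?thesis by (simp add: smooth_on_def)
qed

lemma expinv_alg_sum:
  assumes "\<And>i. i \<in> A \<Longrightarrow> expinv_alg (f i)"
  shows "expinv_alg (\<lambda>x. \<Sum>i\<in>A. f i x)"
  using assms by (induction A rule: infinite_finite_induct) (auto intro: expinv_alg.intros)

lemma expinv_alg_prod:
  assumes "\<And>i. i \<in> A \<Longrightarrow> expinv_alg (f i)"
  shows "expinv_alg (\<lambda>x. \<Prod>i\<in>A. f i x)"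
  using assms by (induction A rule: infinite_finite_induct) (auto intro: expinv_alg.intros)

section \<open>Cells and their bump functions\<close>

text \<open>Half-open cells make the grid an exact partition of space, so no overlaps on faces have
  to be discussed.\<close>

definition cell :: "real^'n \<Rightarrow> real \<Rightarrow> (real^'n) set" where
  "cell c h = {x. \<forall>i. c $ i \<le> x $ i \<and> x $ i < c $ i + h}"

definition bump :: "real^'n \<Rightarrow> real \<Rightarrow> real^'n \<Rightarrow> real" where
  "bump c h x = (\<Prod>i\<in>UNIV. expinv 0 ((x $ i - c $ i) / h) * expinv 0 (1 - (x $ i - c $ i) / h))"

lemma bump_alg: "expinv_alg (bump c h)"
proof -
  have "bump c h = (\<lambda>x. \<Prod>i\<in>UNIV. expinv 0 ((1 / h) * x $ i + (- c $ i / h)) * expinv 0 ((- (1 / h)) * x $ i + (1 + c $ i / h)))"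
    by (simp add: bump_def fun_eq_iff diff_divide_distrib algebra_simps)
  then show ?thesis by (simp only:) (intro expinv_alg_prod expinv_alg.intros)
qed

lemma bump_bounds: "0 \<le> bump c h x" "bump c h x \<le> 1"
  unfolding bump_def by (auto intro!: prod_nonneg prod_le_1 mult_le_one expinv_bounds mult_nonneg_nonneg)

lemma bump_support:
  assumes "h > 0" "bump c h x \<noteq> 0"
  shows "x \<in> cell c h"
proof -
  have "expinv 0 ((x $ i - c $ i) / h) \<noteq> 0 \<and> expinv 0 (1 - (x $ i - c $ i) / h) \<noteq> 0" for i
    using assms(2) by (auto simp: bump_def)
  then have "0 < (x $ i - c $ i) / h \<and> 0 < 1 - (x $ i - c $ i) / h" for i
    using expinv_bounds(4) by blast
  then have "c $ i \<le> x $ i \<and> x $ i < c $ i + h" for i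
    using assms(1) by (simp add: zero_less_divide_iff divide_less_eq) (smt (verit))
  then show ?thesis by (simp add: cell_def)
qed

lemma bump_differentiable: "bump c h differentiable (at x)"
  using expinv_alg_partial[OF bump_alg] by blast

text \<open>Outside the cell the bump takes its minimum 0, so its derivative vanishes there; this
  also covers the points on the faces that the half-open cell omits.\<close>

lemma grad_bump_support:
  assumes "h > 0" "grad (bump c h) x \<noteq> 0"
  shows "x \<in> cell c h"
proof (rule ccontr)
  assume "x \<notin> cell c h"
  then have "bump c h x = 0" using bump_support[OF assms(1)] by blast
  then have "(\<lambda>v. grad (bump c h) x \<bullet> v) = (\<lambda>v. 0)"
    by (intro differential_zero_maxmin[OF _ open_UNIV grad_has_derivative[OF bump_differentiable]])
      (auto simp: bump_bounds)
  then have "grad (bump c h) x \<bullet> grad (bump c h) x = 0" by metis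
  with assms(2) show False by simp
qed

lemma smooth_continuous_grad:
  assumes "smooth_on f UNIV"
  shows "continuous_on UNIV (grad f)" "continuous_on UNIV f" "f differentiable (at x)"
proof -
  have C: "Ck_on 1 f UNIV" using assms by (auto simp: smooth_on_def)
  then have "continuous_on UNIV (partial_deriv f i)" for i by simp
  then show "continuous_on UNIV (grad f)"
    unfolding grad_def by (intro continuous_on_vec_lambda) auto
  show "continuous_on UNIV f" "f differentiable (at x)"
    using C by (auto simp: differentiable_on_def)
qed

text \<open>All bumps are rescalings of the one on the unit cell, whose gradient is continuous and
  vanishes off a compact cube. Thus L depends neither on the corner nor on h.\<close>

lemma grad_bump_bound:
  "\<exists>L>0. \<forall>c h x. h > 0 \<longrightarrow> norm (grad (bump c h) (x::real^'n)) \<le> L / h"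
proof -
  define K where "K = cbox (0::real^'n) (\<chi> i. 1)"
  have "compact (grad (bump 0 1) ` K)"
    by (intro compact_continuous_image continuous_on_subset[OF smooth_continuous_grad(1)[OF expinv_alg_smooth[OF bump_alg]]])
       (auto simp: K_def)
  then obtain L0 where L0: "\<And>x. x \<in> K \<Longrightarrow> norm (grad (bump 0 1) x) \<le> L0"
    using compact_imp_bounded bounded_iff by (metis imageI)
  have b: "norm (grad (bump 0 1) x) \<le> max L0 1" for x :: "real^'n"
  proof (cases "x \<in> K")
    case False
    have "cell 0 1 \<subseteq> K" by (auto simp: K_def cell_def mem_box_cart less_imp_le)
    with False have "x \<notin> cell 0 1" by blast
    then show ?thesis using grad_bump_support[of 1 0 x] by force
  qed (use L0 in force)
  have "norm (grad (bump c h) x) \<le> max L0 1 / h" if h: "h > 0" for c x :: "real^'n" and h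
  proof -
    let ?y = "(1 / h) *\<^sub>R (x - c)"
    have eq: "bump c h = (\<lambda>x. bump 0 1 ((1 / h) *\<^sub>R (x - c)))"
      by (simp add: bump_def fun_eq_iff)
    have "((\<lambda>x. (1 / h) *\<^sub>R (x - c)) has_derivative (\<lambda>v. (1 / h) *\<^sub>R v)) (at x)"
      by (auto intro!: derivative_eq_intros)
    from has_derivative_compose[OF this grad_has_derivative[OF bump_differentiable]]
    have "(bump c h has_derivative (\<lambda>v. ((1 / h) *\<^sub>R grad (bump 0 1) ?y) \<bullet> v)) (at x)"
      unfolding eq by simp
    then have "grad (bump c h) x = (1 / h) *\<^sub>R grad (bump 0 1) ?y"
      by (rule has_derivative_imp_grad)
    then have "norm (grad (bump c h) x) = norm (grad (bump 0 1) ?y) / h"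
      using h by simp
    also have "\<dots> \<le> max L0 1 / h"
      using h b[of ?y] by (intro divide_right_mono) auto
    finally show ?thesis .
  qed
  then show ?thesis by (intro exI[of _ "max L0 1"]) auto
qed

text \<open>On the concentric cell of half the side each relative coordinate lies between 1/4 and
  3/4, so both exponential factors are at least their value at 1/4.\<close>

lemma bump_lower_bound:
  "\<exists>d>0. \<forall>c h x. h > 0 \<longrightarrow> x \<in> cell (c + (\<chi> i. h / 4)) (h / 2) \<longrightarrow> d \<le> bump c h (x::real^'n)"
proof -
  define d where "d = (\<Prod>i\<in>(UNIV::'n set). expinv 0 (1/4) * expinv 0 (1/4))"
  have "d > 0" unfolding d_def by (intro prod_pos mult_pos_pos expinv_bounds(3) ballI) auto
  moreover have "d \<le> bump c h x" if "h > 0" "x \<in> cell (c + (\<chi> i. h / 4)) (h / 2)" for c x :: "real^'n" and h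
    unfolding d_def bump_def
  proof (rule prod_mono)
    fix i
    have "c $ i + h / 4 \<le> x $ i" "x $ i < c $ i + h / 4 + h / 2"
      using that(2) by (auto simp: cell_def)
    then have "1/4 \<le> (x $ i - c $ i) / h" "1/4 \<le> 1 - (x $ i - c $ i) / h"
      using that(1) by (auto simp: field_simps)
    then show "0 \<le> expinv 0 (1/4) * expinv 0 (1/4) \<and> 
        expinv 0 (1/4) * expinv 0 (1/4) \<le> expinv 0 ((x $ i - c $ i) / h) * expinv 0 (1 - (x $ i - c $ i) / h)"
      by (intro conjI mult_mono expinv_mono mult_nonneg_nonneg expinv_bounds)
  qed
  ultimately show ?thesis by blast
qed

section \<open>Grids and Jordan measurability\<close>

lemma cell_borel [measurable]: "cell c h \<in> sets borel"
proof -
  have "cell c h = (\<Inter>i\<in>UNIV. {x. c $ i \<le> x $ i} \<inter> {x. x $ i < c $ i + h})"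
    by (auto simp: cell_def)
  also have "\<dots> \<in> sets borel"
    by (intro sets.finite_INT sets.Int borel_closed borel_open closed_Collect_le open_Collect_less continuous_intros) auto
  finally show ?thesis .
qed

lemma cell_subset_cbox: "cell c h \<subseteq> cbox c (\<chi> i. c $ i + h)"
  by (auto simp: cell_def mem_box_cart less_imp_le)

lemma cell_lmeasurable [simp]: "cell c h \<in> lmeasurable"
  using bounded_subset[OF bounded_cbox cell_subset_cbox]
  by (intro bounded_set_imp_lmeasurable) auto

lemma cell_measure:
  assumes "h \<ge> 0"
  shows "measure lebesgue (cell (c::real^'n) h) = h ^ CARD('n)"
proof -
  let ?d = "\<chi> i. c $ i + h"
  have "negligible (cbox c ?d - box c ?d)" by (rule negligible_frontier_interval)
  then have "negligible (cbox c ?d - cell c h \<union> (cell c h - cbox c ?d))"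
    by (rule negligible_subset) (use cell_subset_cbox in \<open>auto simp: cell_def mem_box_cart less_imp_le\<close>)
  then have "measure lebesgue (cell c h) = measure lebesgue (cbox c ?d)"
    by (rule measure_negligible_symdiff[rotated]) simp
  also have "\<dots> = h ^ CARD('n)"
  proof -
    have "cbox c ?d \<noteq> {}" using assms by (auto simp: interval_eq_empty_cart not_less)
    then show ?thesis by (simp add: content_cbox_cart)
  qed
  finally show ?thesis .
qed

lemma cell_convex: "convex (cell c h)"
proof -
  have "cell c h = (\<Inter>i\<in>UNIV. {x. axis i 1 \<bullet> x \<ge> c $ i} \<inter> {x. axis i 1 \<bullet> x < c $ i + h})"
    by (auto simp: cell_def inner_axis' )
  also have "convex \<dots>"
    by (intro convex_INT convex_Int convex_halfspace_ge convex_halfspace_lt)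
  finally show ?thesis .
qed

lemma cell_dist:
  assumes "x \<in> cell c h" "y \<in> cell (c::real^'n) h"
  shows "norm (x - y) \<le> real CARD('n) * h"
proof -
  have "norm (x - y) \<le> (\<Sum>i\<in>UNIV. \<bar>(x - y) $ i\<bar>)" by (rule norm_le_l1_cart)
  also have "\<dots> \<le> (\<Sum>i\<in>(UNIV::'n set). h)"
  proof (rule sum_mono)
    fix i :: 'n
    have "c $ i \<le> x $ i" "x $ i < c $ i + h" "c $ i \<le> y $ i" "y $ i < c $ i + h"
      using assms by (auto simp: cell_def)
    then show "\<bar>(x - y) $ i\<bar> \<le> h" by auto
  qed
  finally show ?thesis by simp
qed

definition grid_cell :: "real \<Rightarrow> int^'n \<Rightarrow> (real^'n) set" where
  "grid_cell h m = cell (\<chi> i. h * real_of_int (m $ i)) h"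

definition grid_index :: "real \<Rightarrow> real^'n \<Rightarrow> int^'n" where
  "grid_index h x = (\<chi> i. \<lfloor>x $ i / h\<rfloor>)"

lemma grid_cell_iff:
  assumes "h > 0"
  shows "x \<in> grid_cell h m \<longleftrightarrow> m = grid_index h x"
proof -
  have "h * real_of_int (m $ i) \<le> x $ i \<and> x $ i < h * real_of_int (m $ i) + h \<longleftrightarrow> m $ i = \<lfloor>x $ i / h\<rfloor>" for i
  proof -
    have "h * real_of_int (m $ i) \<le> x $ i \<and> x $ i < h * real_of_int (m $ i) + h
      \<longleftrightarrow> real_of_int (m $ i) \<le> x $ i / h \<and> x $ i / h < real_of_int (m $ i) + 1"
      using assms by (simp add: field_simps)
    also have "\<dots> \<longleftrightarrow> m $ i = \<lfloor>x $ i / h\<rfloor>" by linarith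
    finally show ?thesis .
  qed
  then show ?thesis by (simp add: grid_cell_def cell_def grid_index_def vec_eq_iff)
qed

lemma disjoint_grid: "h > 0 \<Longrightarrow> disjoint_family_on (grid_cell h) I"
  by (auto simp: disjoint_family_on_def grid_cell_iff)

lemma finite_grid_index:
  fixes S :: "(real^'n) set"
  assumes "bounded S" "h > 0"
  shows "finite (grid_index h ` S)"
proof -
  obtain B where B: "\<And>x. x \<in> S \<Longrightarrow> norm x \<le> B" using assms(1) bounded_iff by blast
  have "grid_index h ` S \<subseteq> vec_lambda ` (PiE UNIV (\<lambda>_::'n. {\<lfloor>- B / h\<rfloor>..\<lfloor>B / h\<rfloor>}))"
  proof clarify
    fix x assume "x \<in> S"
    then have "\<bar>x $ i\<bar> \<le> B" for i using B component_le_norm_cart order_trans by blast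
    then have "- B \<le> x $ i \<and> x $ i \<le> B" for i by (simp add: abs_le_iff minus_le_iff)
    then have "\<lfloor>x $ i / h\<rfloor> \<in> {\<lfloor>- B / h\<rfloor>..\<lfloor>B / h\<rfloor>}" for i
      using assms(2) unfolding atLeastAtMost_iff by (intro conjI floor_mono divide_right_mono) auto
    then show "grid_index h x \<in> vec_lambda ` (PiE UNIV (\<lambda>_::'n. {\<lfloor>- B / h\<rfloor>..\<lfloor>B / h\<rfloor>}))"
      unfolding grid_index_def by (intro imageI) auto
  qed
  then show ?thesis by (rule finite_subset) (intro finite_imageI finite_PiE; simp)
qed

lemma grid_measure:
  assumes "finite I" "h > 0"
  shows "measure lebesgue (\<Union>m\<in>I. grid_cell h (m::int^'n)) = real (card I) * h ^ CARD('n)"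
proof -
  have "measure lebesgue (\<Union>m\<in>I. grid_cell h m) = (\<Sum>m\<in>I. measure lebesgue (grid_cell h m))"
    using assms fmeasurableD2[OF cell_lmeasurable] unfolding grid_cell_def[symmetric]
    by (intro measure_finite_Union disjoint_grid) (auto simp: grid_cell_def fmeasurableD)
  also have "\<dots> = (\<Sum>m\<in>I. h ^ CARD('n))"
    unfolding grid_cell_def using assms(2) by (intro sum.cong refl cell_measure) auto
  finally show ?thesis by simp
qed

lemma grid_lmeasurable:
  "finite I \<Longrightarrow> (\<Union>m\<in>I. grid_cell h m) \<in> lmeasurable"
  by (intro fmeasurable.finite_UN) (auto simp: grid_cell_def)

lemma grid_near:
  assumes "h > 0" "y \<in> grid_cell h (grid_index h (x::real^'n))"
  shows "norm (x - y) \<le> real CARD('n) * h"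
  using assms cell_dist[of x _ h y] grid_cell_iff[OF assms(1), of x] unfolding grid_cell_def by blast

section \<open>Null boundaries and the number of grid cells\<close>

text \<open>By the mean value theorem, equal values at both ends of the segment would force a zero
  of the i-th partial derivative in between.\<close>

lemma directional_injective:
  fixes \<rho> :: "real^'n \<Rightarrow> real"
  assumes "convex B" "\<And>y. y \<in> B \<Longrightarrow> \<rho> differentiable (at y)" "\<And>y. y \<in> B \<Longrightarrow> partial_deriv \<rho> i y \<noteq> 0"
    and "a \<in> B" "a + t *\<^sub>R axis i 1 \<in> B" "\<rho> a = \<rho> (a + t *\<^sub>R axis i 1)" "t > 0"
  shows False
proof -
  have seg: "a + \<tau> *\<^sub>R axis i 1 \<in> B" if "0 \<le> \<tau>" "\<tau> \<le> t" for \<tau>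
  proof -
    have "(1 - \<tau> / t) *\<^sub>R a + (\<tau> / t) *\<^sub>R (a + t *\<^sub>R axis i 1) \<in> B"
      using assms that by (intro convexD) auto
    moreover have "(1 - \<tau> / t) *\<^sub>R a + (\<tau> / t) *\<^sub>R (a + t *\<^sub>R axis i 1) = a + \<tau> *\<^sub>R axis i 1"
      using assms(7) by (simp add: algebra_simps)
    ultimately show ?thesis by simp
  qed
  have "\<exists>\<tau>\<in>{0<..<t}. \<rho> (a + t *\<^sub>R axis i 1) - \<rho> (a + 0 *\<^sub>R axis i 1) = frechet_derivative \<rho> (at (a + \<tau> *\<^sub>R axis i 1)) ((t - 0) *\<^sub>R axis i 1)"
  proof (rule mvt_simple[OF assms(7)])
    fix \<tau> assume "0 \<le> \<tau>" "\<tau> \<le> t"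
    then have "(\<rho> has_derivative frechet_derivative \<rho> (at (a + \<tau> *\<^sub>R axis i 1))) (at (a + \<tau> *\<^sub>R axis i 1))"
      using assms(2) seg frechet_derivative_works by blast
    moreover have "((\<lambda>\<tau>. a + \<tau> *\<^sub>R axis i 1) has_derivative (\<lambda>x. x *\<^sub>R axis i 1)) (at \<tau> within {0..t})"
      by (auto intro!: derivative_eq_intros)
    ultimately show "((\<lambda>\<tau>. \<rho> (a + \<tau> *\<^sub>R axis i 1)) has_derivative (\<lambda>x. frechet_derivative \<rho> (at (a + \<tau> *\<^sub>R axis i 1)) (x *\<^sub>R axis i 1))) (at \<tau> within {0..t})"
      by (rule has_derivative_compose[rotated])
  qed
  then obtain \<tau> where \<tau>: "0 < \<tau>" "\<tau> < t" and e: "0 = frechet_derivative \<rho> (at (a + \<tau> *\<^sub>R axis i 1)) (t *\<^sub>R axis i 1)"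
    using assms(6) by auto
  let ?y = "a + \<tau> *\<^sub>R axis i 1"
  have "linear (frechet_derivative \<rho> (at ?y))"
    using assms(2)[OF seg] \<tau> by (intro linear_frechet_derivative) auto
  then have "0 = t * partial_deriv \<rho> i ?y"
    unfolding partial_deriv_def using e by (simp add: linear_cmul)
  then show False using assms(3)[OF seg] assms(7) \<tau> by auto
qed

text \<open>Along a direction in which \<open>\<rho>\<close> has nonzero derivative, infinitely many small translates of the
  zero set of \<open>\<rho>\<close> are disjoint and fit in a bounded set, so they are null.\<close>

lemma frontier_negligible:
  fixes \<Omega> :: "(real^'n) set"
  assumes "smooth_bounded_domain \<Omega>"
  shows "negligible (frontier \<Omega>)"
  unfolding locally_negligible_alt[of "frontier \<Omega>"]
proof
  fix x assume x: "x \<in> frontier \<Omega>"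
  have op: "open \<Omega>" using assms by (simp add: smooth_bounded_domain_def)
  obtain r \<rho> where r: "r > 0" and sm: "smooth_on \<rho> (ball x r)" and g: "grad \<rho> x \<noteq> 0"
    and eq: "\<Omega> \<inter> ball x r = {y\<in>ball x r. \<rho> y < 0}"
    using assms x unfolding smooth_bounded_domain_def by blast
  have C: "Ck_on 1 \<rho> (ball x r)" using sm by (simp add: smooth_on_def)
  obtain i where i: "partial_deriv \<rho> i x \<noteq> 0"
    using g by (auto simp: grad_def vec_eq_iff)
  have cont: "continuous_on (ball x r) (partial_deriv \<rho> i)" using C by simp
  then have "isCont (partial_deriv \<rho> i) x"
    using r by (simp add: continuous_on_eq_continuous_at)
  then obtain d where d: "d > 0" "\<And>y. dist y x < d \<Longrightarrow> partial_deriv \<rho> i y \<noteq> 0"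
    using i continuous_at_avoid by (metis dist_commute)
  define s where "s = min d r"
  have s: "s > 0" using d r by (simp add: s_def)
  have nz: "partial_deriv \<rho> i y \<noteq> 0" and df: "\<rho> differentiable (at y)" if "y \<in> ball x s" for y
  proof -
    show "partial_deriv \<rho> i y \<noteq> 0" using that d(2)[of y] by (simp add: s_def dist_commute)
    have "\<rho> differentiable_on ball x r" using C by simp
    then show "\<rho> differentiable (at y)" using that by (simp add: differentiable_on_eq_differentiable_at s_def)
  qed
  define E where "E = frontier \<Omega> \<inter> cball x (s / 2)"
  \<comment> \<open>A boundary point is outside the open set, so \<rho> is at least 0 there; were it
    positive, it would be positive nearby, although points with \<rho> < 0 accumulate at it.\<close>
  have zero: "\<rho> y = 0" if "y \<in> E" for y
  proof -
    have y: "y \<in> ball x r" "y \<in> frontier \<Omega>" using that s by (auto simp: E_def s_def)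
    then have "y \<notin> \<Omega>" using op by (simp add: frontier_def interior_open)
    then have "\<rho> y \<ge> 0" using eq y(1) by fastforce
    moreover have "\<rho> y \<le> 0"
    proof (rule ccontr)
      assume "\<not> \<rho> y \<le> 0"
      have "continuous_on (ball x r) \<rho>" using C by simp
      then have "isCont \<rho> y" using y(1) by (simp add: continuous_on_eq_continuous_at)
      then have "\<forall>\<^sub>F z in at y. \<rho> z > 0"
        using \<open>\<not> \<rho> y \<le> 0\<close> by (auto simp: isCont_def intro: order_tendstoD)
      then obtain U where U: "open U" "y \<in> U" "\<And>z. z \<in> U \<Longrightarrow> z \<noteq> y \<Longrightarrow> \<rho> z > 0"
        unfolding eventually_at_topological by blast
      have "open (U \<inter> ball x r)" "y \<in> U \<inter> ball x r" using U y by auto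
      moreover have "y \<in> closure \<Omega>" using y(2) by (simp add: frontier_def)
      ultimately have "(U \<inter> ball x r) \<inter> \<Omega> \<noteq> {}"
        using open_Int_closure_eq_empty by blast
      then obtain z where "z \<in> \<Omega>" "z \<in> U \<inter> ball x r" by blast
      moreover have "z \<noteq> y" using \<open>z \<in> \<Omega>\<close> \<open>y \<notin> \<Omega>\<close> by blast
      ultimately have "\<rho> z > 0" "z \<in> \<Omega> \<inter> ball x r" using U(3)[of z] by auto
      then show False unfolding eq by auto
    qed
    ultimately show ?thesis by simp
  qed
  have "compact E" unfolding E_def
    using closed_Int_compact[OF frontier_closed compact_cball] by blast
  then have E_meas: "E \<in> lmeasurable" by (rule lmeasurable_compact)
  \<comment> \<open>The shifts have pairwise distinct lengths, each at most s/4, so the translates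
    of E, which lies within s/2 of x, remain in the ball of radius s where the partial derivative is
    nonzero.\<close>
  define e where "e n = (s / 4 / real (Suc n)) *\<^sub>R (axis i 1 :: real^'n)" for n
  have en: "norm (e n) \<le> s / 4" for n
    using s by (simp add: e_def norm_axis_1 field_simps)
  have inB: "a + e n \<in> ball x s" if "a \<in> E" for a n
  proof -
    have "dist x (a + e n) \<le> dist x a + norm (e n)"
      by (metis add_diff_cancel_left' dist_commute dist_norm dist_triangle)
    then show ?thesis using that en[of n] s by (auto simp: E_def)
  qed
  have disj1: "a + e n \<noteq> b + e m" if "a \<in> E" "b \<in> E" "n < m" for a b n m
  proof
    assume h: "a + e n = b + e m"
    define t where "t = s / 4 / real (Suc n) - s / 4 / real (Suc m)"
    have t: "t > 0" using \<open>n < m\<close> s by (simp add: t_def frac_less2)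
    have b: "b = a + t *\<^sub>R axis i 1" using h by (simp add: e_def t_def algebra_simps)
    have "E \<subseteq> ball x s" using s by (auto simp: E_def)
    then have "a \<in> ball x s" "a + t *\<^sub>R axis i 1 \<in> ball x s" "\<rho> a = \<rho> (a + t *\<^sub>R axis i 1)"
      using that zero b by auto
    then show False
      using directional_injective[of "ball x s" \<rho> i a t] df nz t by (metis convex_ball)
  qed
  define T where "T n = (+) (e n) ` E" for n
  have disj: "disjoint_family_on T I" for I
    unfolding disjoint_family_on_def T_def
  proof (intro ballI impI)
    fix m n :: nat assume "m \<noteq> n"
    have False if "a \<in> E" "b \<in> E" "e m + a = e n + b" for a b
      using \<open>m \<noteq> n\<close> disj1[OF that(1,2), of m n] disj1[OF that(2,1), of n m] that(3)
      by (metis add.commute nat_neq_iff)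
    then show "(+) (e m) ` E \<inter> (+) (e n) ` E = {}" by blast
  qed
  have Tm: "T n \<in> lmeasurable" for n
    unfolding T_def using E_meas by (simp add: measurable_translation)
  have le: "real N * measure lebesgue E \<le> measure lebesgue (ball x s)" for N
  proof -
    have "real N * measure lebesgue E = (\<Sum>n<N. measure lebesgue (T n))"
      by (simp add: T_def measure_translation)
    also have "\<dots> = measure lebesgue (\<Union>n<N. T n)"
      using Tm fmeasurableD2[OF Tm] by (intro measure_finite_Union[symmetric] disj) (auto simp: fmeasurableD)
    also have "\<dots> \<le> measure lebesgue (ball x s)"
    proof (rule measure_mono_fmeasurable)
      show "(\<Union>n<N. T n) \<subseteq> ball x s" using inB unfolding T_def by (auto simp: add.commute simp del: mem_ball)
      show "(\<Union>n<N. T n) \<in> sets lebesgue" using Tm by (auto simp: fmeasurableD)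
    qed simp
    finally show ?thesis .
  qed
  have "measure lebesgue E = 0"
  proof (rule ccontr)
    assume "measure lebesgue E \<noteq> 0"
    then have "measure lebesgue E > 0" by (simp add: zero_less_measure_iff)
    then obtain N where "measure lebesgue (ball x s) < real N * measure lebesgue E"
      using reals_Archimedean3 by blast
    then show False using le[of N] by simp
  qed
  then have "negligible E" using E_meas by (simp add: negligible_iff_measure)
  then have "negligible (frontier \<Omega> \<inter> ball x (s / 2))"
    by (rule negligible_subset) (auto simp: E_def)
  then show "\<exists>U. openin (top_of_set (frontier \<Omega>)) U \<and> x \<in> U \<and> negligible U"
    using x s by (intro exI[of _ "frontier \<Omega> \<inter> ball x (s / 2)"]) (auto simp: openin_open)
qed

text \<open>The null boundary enters here: the closure has the same measure as the domain, so some
  open T containing the closure has measure at most twice that of the domain. By compactness T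
  contains an \<epsilon>-neighbourhood of the closure, hence every cell of diameter below \<epsilon>
  that meets the domain.\<close>

lemma grid_cover_count:
  fixes \<Omega> :: "(real^'n) set"
  assumes "smooth_bounded_domain \<Omega>"
  obtains h0 where "h0 > 0" "\<And>h. 0 < h \<Longrightarrow> h < h0 \<Longrightarrow> real (card (grid_index h ` \<Omega>)) * h ^ CARD('n) \<le> 2 * measure lebesgue \<Omega>"
proof -
  have op: "open \<Omega>" and bd: "bounded \<Omega>" and ne: "\<Omega> \<noteq> {}" using assms by (auto simp: smooth_bounded_domain_def)
  have lm: "\<Omega> \<in> lmeasurable" using op bd by (simp add: lmeasurable_open)
  have pos: "measure lebesgue \<Omega> > 0"
    using open_not_negligible[OF op ne] lm by (simp add: negligible_iff_measure zero_less_measure_iff)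
  have cl: "closure \<Omega> \<in> lmeasurable" using bd by (simp add: lmeasurable_closure)
  have "closure \<Omega> - \<Omega> \<subseteq> frontier \<Omega>" using op by (simp add: frontier_def interior_open)
  then have "negligible (\<Omega> - closure \<Omega> \<union> (closure \<Omega> - \<Omega>))"
    using frontier_negligible[OF assms] closure_subset[of \<Omega>] by (metis Diff_eq_empty_iff Un_empty_left negligible_subset)
  then have mcl: "measure lebesgue (closure \<Omega>) = measure lebesgue \<Omega>"
    by (rule measure_negligible_symdiff[OF lm])
  obtain T where T: "open T" "closure \<Omega> \<subseteq> T" "T - closure \<Omega> \<in> lmeasurable" "emeasure lebesgue (T - closure \<Omega>) < ennreal (measure lebesgue \<Omega>)"
    using sets_lebesgue_outer_open[OF fmeasurableD[OF cl] pos] by blast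
  have Tm: "T \<in> lmeasurable" "measure lebesgue T \<le> 2 * measure lebesgue \<Omega>"
  proof -
    have TT: "T = closure \<Omega> \<union> (T - closure \<Omega>)" using T by blast
    show "T \<in> lmeasurable" by (subst TT) (intro fmeasurable.Un cl T)
    have "measure lebesgue (T - closure \<Omega>) < measure lebesgue \<Omega>"
      using T(3,4) pos by (simp add: emeasure_eq_measure2 ennreal_less_iff)
    moreover have "measure lebesgue T \<le> measure lebesgue (closure \<Omega>) + measure lebesgue (T - closure \<Omega>)"
      by (subst TT) (intro measure_Un_le fmeasurableD cl T)
    ultimately show "measure lebesgue T \<le> 2 * measure lebesgue \<Omega>" using mcl by simp
  qed
  obtain \<epsilon> where \<epsilon>: "\<epsilon> > 0" "(\<Union>x\<in>closure \<Omega>. ball x \<epsilon>) \<subseteq> T"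
    using compact_subset_open_imp_ball_epsilon_subset[of "closure \<Omega>" T] bd T by (auto simp: compact_closure)
  show thesis
  proof (rule that)
    show "\<epsilon> / real CARD('n) > 0" using \<epsilon> by simp
    fix h assume h: "0 < h" "h < \<epsilon> / real CARD('n)"
    have fin: "finite (grid_index h ` \<Omega>)" using bd h by (intro finite_grid_index)
    have sub: "(\<Union>m\<in>grid_index h ` \<Omega>. grid_cell h m) \<subseteq> T"
    proof clarify
      fix x y assume "x \<in> \<Omega>" "y \<in> grid_cell h (grid_index h x)"
      then have "norm (x - y) \<le> real CARD('n) * h" using grid_near h by blast
      also have "\<dots> < \<epsilon>" using h by (simp add: field_simps)
      finally have "y \<in> ball x \<epsilon>" by (simp add: dist_norm)
      moreover have "x \<in> closure \<Omega>" using \<open>x \<in> \<Omega>\<close> closure_subset by blast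
      ultimately show "y \<in> T" using \<epsilon>(2) by blast
    qed
    have "real (card (grid_index h ` \<Omega>)) * h ^ CARD('n) = measure lebesgue (\<Union>m\<in>grid_index h ` \<Omega>. grid_cell h m)"
      using grid_measure[OF fin h(1)] by simp
    also have "\<dots> \<le> measure lebesgue T"
      using sub grid_lmeasurable[OF fin] Tm(1) by (intro measure_mono_fmeasurable) (auto simp: fmeasurableD)
    finally show "real (card (grid_index h ` \<Omega>)) * h ^ CARD('n) \<le> 2 * measure lebesgue \<Omega>"
      using Tm(2) by simp
  qed
qed

text \<open>A compact K inside the domain carries at least half of its measure and has positive
  distance from the complement. The small cells that meet K cover K, and their closures stay
  inside.\<close>

lemma grid_inner_count:
  fixes \<Omega> :: "(real^'n) set"
  assumes op: "open \<Omega>" and bd: "bounded \<Omega>" and ne: "\<Omega> \<noteq> {}"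
  obtains h0 where "h0 > 0" "\<And>h. 0 < h \<Longrightarrow> h < h0 \<Longrightarrow> \<exists>I. finite I \<and> (\<forall>m\<in>I. closure (grid_cell h m) \<subseteq> \<Omega>)
      \<and> measure lebesgue \<Omega> \<le> 2 * (real (card I) * h ^ CARD('n))"
proof -
  have lm: "\<Omega> \<in> lmeasurable" using op bd by (simp add: lmeasurable_open)
  have pos: "measure lebesgue \<Omega> > 0"
    using open_not_negligible[OF op ne] lm by (simp add: negligible_iff_measure zero_less_measure_iff)
  obtain K where K: "closed K" "K \<subseteq> \<Omega>" "\<Omega> - K \<in> lmeasurable" "emeasure lebesgue (\<Omega> - K) < ennreal (measure lebesgue \<Omega> / 2)"
    using sets_lebesgue_inner_closed[OF fmeasurableD[OF lm], of "measure lebesgue \<Omega> / 2"] pos by auto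
  have cK: "compact K" using K bd bounded_subset compact_eq_bounded_closed by blast
  have Km: "K \<in> lmeasurable" by (rule lmeasurable_compact[OF cK])
  have mK: "measure lebesgue \<Omega> \<le> 2 * measure lebesgue K"
  proof -
    have TT: "\<Omega> = K \<union> (\<Omega> - K)" using K by blast
    have "measure lebesgue (\<Omega> - K) < measure lebesgue \<Omega> / 2"
      using K(3,4) pos by (simp add: emeasure_eq_measure2 ennreal_less_iff)
    moreover have "measure lebesgue (K \<union> (\<Omega> - K)) \<le> measure lebesgue K + measure lebesgue (\<Omega> - K)"
      by (intro measure_Un_le fmeasurableD Km K)
    ultimately show ?thesis using TT by simp
  qed
  obtain \<epsilon> where \<epsilon>: "\<epsilon> > 0" "(\<Union>x\<in>K. ball x \<epsilon>) \<subseteq> \<Omega>"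
    using compact_subset_open_imp_ball_epsilon_subset[OF cK op K(2)] by blast
  show thesis
  proof (rule that)
    show "\<epsilon> / real CARD('n) > 0" using \<epsilon> by simp
    fix h assume h: "0 < h" "h < \<epsilon> / real CARD('n)"
    let ?I = "grid_index h ` K"
    have fin: "finite ?I" using cK h by (intro finite_grid_index compact_imp_bounded)
    have sub: "closure (grid_cell h m) \<subseteq> \<Omega>" if mI: "m \<in> ?I" for m
    proof -
      obtain x where x: "x \<in> K" "m = grid_index h x" using mI by blast
      have "grid_cell h m \<subseteq> cball x (real CARD('n) * h)"
        using grid_near[OF h(1)] x by (auto simp: dist_norm)
      then have "closure (grid_cell h m) \<subseteq> cball x (real CARD('n) * h)" by (rule closure_minimal) simp
      also have "\<dots> \<subseteq> ball x \<epsilon>" using h by (auto simp: field_simps)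
      finally show ?thesis using \<epsilon>(2) x by blast
    qed
    have "K \<subseteq> (\<Union>m\<in>?I. grid_cell h m)" using grid_cell_iff[OF h(1)] by auto
    then have "measure lebesgue K \<le> measure lebesgue (\<Union>m\<in>?I. grid_cell h m)"
      using grid_lmeasurable[OF fin] Km by (intro measure_mono_fmeasurable) (auto simp: fmeasurableD)
    also have "\<dots> = real (card ?I) * h ^ CARD('n)" by (rule grid_measure[OF fin h(1)])
    finally have "measure lebesgue \<Omega> \<le> 2 * (real (card ?I) * h ^ CARD('n))" using mK by linarith
    then show "\<exists>I. finite I \<and> (\<forall>m\<in>I. closure (grid_cell h m) \<subseteq> \<Omega>)
      \<and> measure lebesgue \<Omega> \<le> 2 * (real (card I) * h ^ CARD('n))"
      using fin sub by blast
  qed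
qed

section \<open>The Poincare inequality\<close>

text \<open>Convexity of the power in the form of Young's inequality with weights 1/p and 1 - 1/p.
  That inequality is for positive numbers, hence the separate case b = 0.\<close>

lemma powr_tangent:
  assumes "1 < p" "0 < a" "0 \<le> (b::real)"
  shows "a powr p + p * a powr (p - 1) * (b - a) \<le> b powr p"
proof (cases "b = 0")
  case True
  have "a powr p = a * a powr (p - 1)" using assms(2) by (simp add: powr_mult_base)
  moreover have "1 * (a * a powr (p - 1)) \<le> p * (a * a powr (p - 1))"
    using assms by (intro mult_right_mono) auto
  ultimately show ?thesis using True by (simp add: algebra_simps)
next
  case False
  have "(b powr p) powr (1 / p) * (a powr p) powr (1 - 1 / p) \<le> (1 / p) * b powr p + (1 - 1 / p) * a powr p"
    using assms False by (intro Youngs_inequality_0) (auto simp: field_simps)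
  moreover have "(b powr p) powr (1 / p) = b" using assms by (simp add: powr_powr)
  moreover have "(a powr p) powr (1 - 1 / p) = a powr (p - 1)"
  proof -
    have "p * (1 - 1 / p) = p - 1" using assms by (simp add: field_simps)
    then show ?thesis by (simp add: powr_powr)
  qed
  ultimately have "p * (b * a powr (p - 1)) \<le> b powr p + (p - 1) * a powr p"
    using assms(1) by (simp add: field_simps)
  moreover have "a powr p = a * a powr (p - 1)" using assms(2) by (simp add: powr_mult_base)
  ultimately show ?thesis by (simp add: algebra_simps)
qed

text \<open>The tangent inequality at the mean a of |f| is integrated; its linear part integrates to
  zero. Where a = 0 there is no tangent to take, but the left side is then 0.\<close>

lemma jensen_powr:
  fixes f :: "'a \<Rightarrow> real"
  assumes p: "1 < p" and A: "A \<in> sets M" "emeasure M A \<noteq> \<infinity>" "0 < measure M A"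
    and f: "set_integrable M A f" "set_integrable M A (\<lambda>x. \<bar>f x\<bar> powr p)"
  shows "\<bar>(LINT x:A|M. f x) / measure M A\<bar> powr p \<le> (LINT x:A|M. \<bar>f x\<bar> powr p) / measure M A"
proof -
  define m where "m = measure M A"
  have m: "m > 0" using A by (simp add: m_def)
  define a where "a = (LINT x:A|M. \<bar>f x\<bar>) / m"
  have fa: "set_integrable M A (\<lambda>x. \<bar>f x\<bar>)" using f(1) by (rule set_integrable_abs)
  have a0: "a \<ge> 0" unfolding a_def set_lebesgue_integral_def using m by (intro divide_nonneg_nonneg integral_nonneg_AE) auto
  have "\<bar>LINT x:A|M. f x\<bar> \<le> (LINT x:A|M. \<bar>f x\<bar>)"
    unfolding set_lebesgue_integral_def using integral_abs_bound[of M "\<lambda>x. indicator A x *\<^sub>R f x"]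
    by (simp add: abs_mult)
  then have le: "\<bar>(LINT x:A|M. f x) / m\<bar> \<le> a"
    using m by (simp add: a_def divide_right_mono)
  have int1: "set_integrable M A (\<lambda>x. k::real)" for k
    using A by (auto simp: set_integrable_def top.not_eq_extremum)
  have "a powr p \<le> (LINT x:A|M. \<bar>f x\<bar> powr p) / m"
  proof (cases "a = 0")
    case True
    have "0 \<le> (LINT x:A|M. \<bar>f x\<bar> powr p)"
      unfolding set_lebesgue_integral_def by (intro integral_nonneg_AE) auto
    then show ?thesis using True m by simp
  next
    case False
    then have a: "a > 0" using a0 by simp
    let ?k = "a powr p - p * a powr (p - 1) * a" and ?l = "p * a powr (p - 1)"
    have "(LINT x:A|M. ?k + ?l * \<bar>f x\<bar>) \<le> (LINT x:A|M. \<bar>f x\<bar> powr p)"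
    proof (rule set_integral_mono)
      show "set_integrable M A (\<lambda>x. ?k + ?l * \<bar>f x\<bar>)"
        by (intro set_integral_add int1 set_integrable_mult_right fa)
      show "?k + ?l * \<bar>f x\<bar> \<le> \<bar>f x\<bar> powr p" for x
        using powr_tangent[OF p a, of "\<bar>f x\<bar>"] by (simp add: algebra_simps)
    qed (rule f(2))
    moreover have "(LINT x:A|M. ?k + ?l * \<bar>f x\<bar>) = ?k * m + ?l * (LINT x:A|M. \<bar>f x\<bar>)"
      using A by (subst set_integral_add(2)) (auto intro: int1 set_integrable_mult_right fa simp: m_def set_lebesgue_integral_def)
    moreover have "(LINT x:A|M. \<bar>f x\<bar>) = a * m" using m by (simp add: a_def)
    ultimately have "a powr p * m \<le> (LINT x:A|M. \<bar>f x\<bar> powr p)" by (simp add: algebra_simps)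
    then show ?thesis using m by (simp add: field_simps)
  qed
  moreover have "\<bar>(LINT x:A|M. f x) / m\<bar> powr p \<le> a powr p"
    using le p by (intro powr_mono2) auto
  ultimately show ?thesis unfolding m_def by linarith
qed

section \<open>Poincare's inequality on convex sets and on the grid\<close>

lemma nn_integral_affine:
  fixes f :: "'a::euclidean_space \<Rightarrow> ennreal" and c :: real
  assumes [measurable]: "f \<in> borel_measurable borel" and c: "c \<noteq> 0"
  shows "(\<integral>\<^sup>+x. f x \<partial>lborel) = \<bar>c\<bar> ^ DIM('a) * (\<integral>\<^sup>+x. f (t + c *\<^sub>R x) \<partial>lborel)"
  by (subst lborel_affine[OF c, of t])
     (simp add: nn_integral_density nn_integral_distr nn_integral_cmult)

text \<open>The fundamental theorem of calculus along the segment, then Jensen on [0,1] and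
  Cauchy-Schwarz. The result is stated for nonnegative extended integrals so that the order of
  integration can later be exchanged without integrability conditions.\<close>

lemma segment_powr_bound:
  fixes \<phi> :: "real^'n \<Rightarrow> real"
  assumes p: "1 < p" and d: "\<And>x. \<phi> differentiable (at x)" and c: "continuous_on UNIV (grad \<phi>)"
  shows "ennreal (\<bar>\<phi> y - \<phi> x\<bar> powr p) \<le> 
     ennreal (norm (y - x) powr p) * (\<integral>\<^sup>+t\<in>{0..1}. ennreal (norm (grad \<phi> (x + t *\<^sub>R (y - x))) powr p) \<partial>lborel)"
proof -
  define \<gamma> where "\<gamma> t = x + t *\<^sub>R (y - x)" for t :: real
  define g where "g t = grad \<phi> (\<gamma> t) \<bullet> (y - x)" for t
  have \<gamma>c: "continuous_on S \<gamma>" for S unfolding \<gamma>_def by (intro continuous_intros)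
  have gr: "continuous_on S (\<lambda>t. grad \<phi> (\<gamma> t))" for S
    by (rule continuous_on_compose2[OF c \<gamma>c]) auto
  have gc: "continuous_on S g" for S
    unfolding g_def by (intro continuous_intros gr)
  have der: "((\<lambda>t. \<phi> (\<gamma> t)) has_real_derivative g t) (at t)" for t
  proof -
    have "(\<gamma> has_derivative (\<lambda>s. s *\<^sub>R (y - x))) (at t)"
      unfolding \<gamma>_def by (auto intro!: derivative_eq_intros)
    from has_derivative_compose[OF this grad_has_derivative[OF d]]
    show ?thesis unfolding has_field_derivative_def g_def
      by (rule has_derivative_eq_rhs) (simp add: fun_eq_iff)
  qed
  have "has_bochner_integral lborel (\<lambda>t. g t * indicator {0..1} t) (\<phi> (\<gamma> 1) - \<phi> (\<gamma> 0))"
    using has_bochner_integral_FTC_Icc_real[where a=0 and b=1 and F="\<lambda>t. \<phi> (\<gamma> t)" and f=g] der gc[of UNIV]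
    by (simp add: continuous_on_eq_continuous_at)
  then have I: "(LINT t:{0..1}|lborel. g t) = \<phi> y - \<phi> x"
    using has_bochner_integral_integral_eq by (fastforce simp: set_lebesgue_integral_def \<gamma>_def mult.commute)
  have iG: "set_integrable lborel {0..1} f" if "continuous_on {0..1} f" for f :: "real \<Rightarrow> real"
    using that by (intro borel_integrable_atLeastAtMost'[unfolded set_integrable_def[symmetric]])
  have pc: "continuous_on S (\<lambda>t. f t powr p)" if "continuous_on S f" "\<And>t. f t \<ge> 0" for S and f :: "real \<Rightarrow> real"
    using that p by (intro continuous_on_powr') (auto intro: continuous_intros)
  have J: "\<bar>\<phi> y - \<phi> x\<bar> powr p \<le> (LINT t:{0..1}|lborel. \<bar>g t\<bar> powr p)"
    using jensen_powr[OF p, of "{0..1}" lborel g] I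
    by (simp add: iG gc pc continuous_on_rabs)
  also have "\<dots> \<le> (LINT t:{0..1}|lborel. norm (y - x) powr p * norm (grad \<phi> (\<gamma> t)) powr p)"
  proof (rule set_integral_mono)
    show "set_integrable lborel {0..1} (\<lambda>t. \<bar>g t\<bar> powr p)"
      by (intro iG pc continuous_on_rabs gc) auto
    show "set_integrable lborel {0..1} (\<lambda>t. norm (y - x) powr p * norm (grad \<phi> (\<gamma> t)) powr p)"
      by (intro iG continuous_intros pc gr) auto
    show "\<bar>g t\<bar> powr p \<le> norm (y - x) powr p * norm (grad \<phi> (\<gamma> t)) powr p" for t
      using Cauchy_Schwarz_ineq2[of "grad \<phi> (\<gamma> t)" "y - x"] p
      by (simp add: g_def powr_mult[symmetric] powr_mono2 mult.commute)
  qed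
  finally have "ennreal (\<bar>\<phi> y - \<phi> x\<bar> powr p) \<le> ennreal (LINT t:{0..1}|lborel. norm (y - x) powr p * norm (grad \<phi> (\<gamma> t)) powr p)"
    by (rule ennreal_leI)
  also have "\<dots> = (\<integral>\<^sup>+t\<in>{0..1}. ennreal (norm (y - x) powr p * norm (grad \<phi> (\<gamma> t)) powr p) \<partial>lborel)"
  proof -
    have "set_integrable lborel {0..1} (\<lambda>t. norm (y - x) powr p * norm (grad \<phi> (\<gamma> t)) powr p)"
      by (intro iG continuous_intros pc gr) auto
    then show ?thesis unfolding set_lebesgue_integral_def set_integrable_def
      by (subst nn_integral_eq_integral[symmetric]) (auto intro!: nn_integral_cong split: split_indicator)
  qed
  also have "\<dots> = ennreal (norm (y - x) powr p) * (\<integral>\<^sup>+t\<in>{0..1}. ennreal (norm (grad \<phi> (\<gamma> t)) powr p) \<partial>lborel)"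
  proof -
    have [measurable]: "(\<lambda>t. grad \<phi> (\<gamma> t)) \<in> borel_measurable borel"
      by (rule borel_measurable_continuous_onI[OF gr])
    show ?thesis
      by (subst nn_integral_cmult[symmetric]) (auto simp: ennreal_mult' mult.assoc)
  qed
  finally show ?thesis unfolding \<gamma>_def .
qed

text \<open>For fixed x the substitution y to x + t(y - x) has Jacobian t^N, harmless when t is at
  least 1/2. For smaller t the roles of x and y are exchanged, since x + t(y - x) = y + (1 - t)(x -
  y). This bounds the factor by 2^N for all t.\<close>

lemma segment_average:
  fixes G :: "real^'n \<Rightarrow> ennreal"
  assumes [measurable]: "G \<in> borel_measurable borel" "Q \<in> sets borel"
    and t: "0 \<le> t" "t \<le> 1"
  shows "(\<integral>\<^sup>+x\<in>Q. (\<integral>\<^sup>+y\<in>Q. G (x + t *\<^sub>R (y - x)) \<partial>lborel) \<partial>lborel) \<le> 2 ^ CARD('n) * emeasure lborel Q * (\<integral>\<^sup>+x. G x \<partial>lborel)"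
proof -
  have main: "(\<integral>\<^sup>+x\<in>Q. (\<integral>\<^sup>+y\<in>Q. G (x + t *\<^sub>R (y - x)) \<partial>lborel) \<partial>lborel) \<le> 2 ^ CARD('n) * emeasure lborel Q * (\<integral>\<^sup>+x. G x \<partial>lborel)"
    if t: "1 / 2 \<le> t" "t \<le> 1" for t :: real
  proof -
    have in1: "(\<integral>\<^sup>+y\<in>Q. G (x + t *\<^sub>R (y - x)) \<partial>lborel) \<le> 2 ^ CARD('n) * (\<integral>\<^sup>+x. G x \<partial>lborel)" for x
    proof -
      have "(\<integral>\<^sup>+y\<in>Q. G (x + t *\<^sub>R (y - x)) \<partial>lborel) \<le> (\<integral>\<^sup>+y. G ((x - t *\<^sub>R x) + t *\<^sub>R y) \<partial>lborel)"
        by (intro nn_integral_mono) (auto simp: algebra_simps split: split_indicator)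
      also have "\<dots> = ennreal (1 / t ^ CARD('n)) * (ennreal (t ^ CARD('n)) * (\<integral>\<^sup>+y. G ((x - t *\<^sub>R x) + t *\<^sub>R y) \<partial>lborel))"
        using t by (simp add: mult.assoc[symmetric] ennreal_mult'[symmetric] del: ennreal_1) simp
      also have "ennreal (t ^ CARD('n)) * (\<integral>\<^sup>+y. G ((x - t *\<^sub>R x) + t *\<^sub>R y) \<partial>lborel) = (\<integral>\<^sup>+x. G x \<partial>lborel)"
        using nn_integral_affine[of G t "x - t *\<^sub>R x"] t by simp
      also have "ennreal (1 / t ^ CARD('n)) * (\<integral>\<^sup>+x. G x \<partial>lborel) \<le> ennreal (2 ^ CARD('n)) * (\<integral>\<^sup>+x. G x \<partial>lborel)"
      proof (intro mult_right_mono ennreal_leI)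
        have "(1 / t) ^ CARD('n) \<le> 2 ^ CARD('n)" using t by (intro power_mono) (auto simp: field_simps)
        then show "1 / t ^ CARD('n) \<le> 2 ^ CARD('n)" by (simp add: power_one_over)
      qed simp
      finally show ?thesis by (simp add: ennreal_power[symmetric])
    qed
    have "(\<integral>\<^sup>+x\<in>Q. (\<integral>\<^sup>+y\<in>Q. G (x + t *\<^sub>R (y - x)) \<partial>lborel) \<partial>lborel) \<le> (\<integral>\<^sup>+x\<in>Q. 2 ^ CARD('n) * (\<integral>\<^sup>+x. G x \<partial>lborel) \<partial>lborel)"
      by (intro nn_integral_mono mult_right_mono in1) simp
    also have "\<dots> = 2 ^ CARD('n) * emeasure lborel Q * (\<integral>\<^sup>+x. G x \<partial>lborel)"
      by (subst nn_integral_cmult_indicator) (simp_all add: ac_simps)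
    finally show ?thesis .
  qed
  show ?thesis
  proof (cases "1 / 2 \<le> t")
    case True
    then show ?thesis using main t by blast
  next
    case False
    have "(\<integral>\<^sup>+x\<in>Q. (\<integral>\<^sup>+y\<in>Q. G (x + t *\<^sub>R (y - x)) \<partial>lborel) \<partial>lborel)
      = (\<integral>\<^sup>+x. (\<integral>\<^sup>+y. G (x + t *\<^sub>R (y - x)) * indicator Q y * indicator Q x \<partial>lborel) \<partial>lborel)"
      by (simp add: nn_integral_multc)
    also have "\<dots> = (\<integral>\<^sup>+y. (\<integral>\<^sup>+x. G (x + t *\<^sub>R (y - x)) * indicator Q y * indicator Q x \<partial>lborel) \<partial>lborel)"
      by (rule lborel_pair.Fubini') measurable
    also have "\<dots> = (\<integral>\<^sup>+y. (\<integral>\<^sup>+x. (G (y + (1 - t) *\<^sub>R (x - y)) * indicator Q x) * indicator Q y \<partial>lborel) \<partial>lborel)"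
      by (intro nn_integral_cong) (simp add: algebra_simps)
    also have "\<dots> = (\<integral>\<^sup>+y\<in>Q. (\<integral>\<^sup>+x\<in>Q. G (y + (1 - t) *\<^sub>R (x - y)) \<partial>lborel) \<partial>lborel)"
      by (simp add: nn_integral_multc)
    also have "\<dots> \<le> 2 ^ CARD('n) * emeasure lborel Q * (\<integral>\<^sup>+x. G x \<partial>lborel)"
      using False t by (intro main) auto
    finally show ?thesis .
  qed
qed

text \<open>Convexity keeps every segment inside Q, so the gradient may be cut off by Q before
  integrating over x, y and t. Integrating over t last leaves an inner double integral to which
  \<open>segment_average\<close> applies with a bound free of t.\<close>

lemma poincare_double:
  fixes \<phi> :: "real^'n \<Rightarrow> real"
  assumes p: "1 < p" and d: "\<And>x. \<phi> differentiable (at x)" and c: "continuous_on UNIV (grad \<phi>)"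
    and [measurable]: "Q \<in> sets borel" and Q: "convex Q" "\<And>x y. x \<in> Q \<Longrightarrow> y \<in> Q \<Longrightarrow> norm (y - x) \<le> D"
  shows "(\<integral>\<^sup>+x\<in>Q. (\<integral>\<^sup>+y\<in>Q. ennreal (\<bar>\<phi> y - \<phi> x\<bar> powr p) \<partial>lborel) \<partial>lborel)
    \<le> ennreal (D powr p) * (2 ^ CARD('n) * emeasure lborel Q * (\<integral>\<^sup>+x\<in>Q. ennreal (norm (grad \<phi> x) powr p) \<partial>lborel))"
proof -
  define G where "G x = ennreal (norm (grad \<phi> x) powr p) * indicator Q x" for x
  have [measurable]: "grad \<phi> \<in> borel_measurable borel" by (rule borel_measurable_continuous_onI[OF c])
  have [measurable]: "G \<in> borel_measurable borel" unfolding G_def[abs_def] by measurable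
  have pt: "ennreal (\<bar>\<phi> y - \<phi> x\<bar> powr p) \<le> ennreal (D powr p) * (\<integral>\<^sup>+t\<in>{0..1}. G (x + t *\<^sub>R (y - x)) \<partial>lborel)"
    if "x \<in> Q" "y \<in> Q" for x y
  proof -
    have "x + t *\<^sub>R (y - x) \<in> Q" if t: "t \<in> {0..1}" for t
      using convexD_alt[OF Q(1) \<open>x \<in> Q\<close> \<open>y \<in> Q\<close>, of t] t by (simp add: algebra_simps)
    then have "(\<integral>\<^sup>+t\<in>{0..1}. ennreal (norm (grad \<phi> (x + t *\<^sub>R (y - x))) powr p) \<partial>lborel) = (\<integral>\<^sup>+t\<in>{0..1}. G (x + t *\<^sub>R (y - x)) \<partial>lborel)"
      by (intro nn_integral_cong) (auto simp: G_def split: split_indicator)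
    moreover have "ennreal (norm (y - x) powr p) \<le> ennreal (D powr p)"
      using Q(2)[OF that] p by (intro ennreal_leI powr_mono2) auto
    ultimately show ?thesis
      using segment_powr_bound[OF p d c, of y x] by (metis (no_types, lifting) mult_right_mono order_trans zero_le)
  qed
  have "(\<integral>\<^sup>+x\<in>Q. (\<integral>\<^sup>+y\<in>Q. ennreal (\<bar>\<phi> y - \<phi> x\<bar> powr p) \<partial>lborel) \<partial>lborel)
    \<le> (\<integral>\<^sup>+x\<in>Q. (\<integral>\<^sup>+y\<in>Q. ennreal (D powr p) * (\<integral>\<^sup>+t\<in>{0..1}. G (x + t *\<^sub>R (y - x)) \<partial>lborel) \<partial>lborel) \<partial>lborel)"
    using pt by (intro nn_integral_mono) (auto split: split_indicator intro!: nn_integral_mono)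
  also have "\<dots> = ennreal (D powr p) * (\<integral>\<^sup>+x. (\<integral>\<^sup>+y. (\<integral>\<^sup>+t. G (x + t *\<^sub>R (y - x)) * indicator {0..1} t * indicator Q y * indicator Q x \<partial>lborel) \<partial>lborel) \<partial>lborel)"
    by (simp add: nn_integral_multc nn_integral_cmult mult.assoc[of "ennreal (D powr p)"])
  also have "(\<integral>\<^sup>+x. (\<integral>\<^sup>+y. (\<integral>\<^sup>+t. G (x + t *\<^sub>R (y - x)) * indicator {0..1} t * indicator Q y * indicator Q x \<partial>lborel) \<partial>lborel) \<partial>lborel)
    = (\<integral>\<^sup>+x. (\<integral>\<^sup>+t. (\<integral>\<^sup>+y. G (x + t *\<^sub>R (y - x)) * indicator {0..1::real} t * indicator Q y * indicator Q x \<partial>lborel) \<partial>lborel) \<partial>lborel)"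
    by (intro nn_integral_cong lborel_pair.Fubini') measurable
  also have "\<dots> = (\<integral>\<^sup>+t. (\<integral>\<^sup>+x. (\<integral>\<^sup>+y. G (x + t *\<^sub>R (y - x)) * indicator {0..1::real} t * indicator Q y * indicator Q x \<partial>lborel) \<partial>lborel) \<partial>lborel)"
    by (intro lborel_pair.Fubini') measurable
  also have "\<dots> = (\<integral>\<^sup>+t\<in>{0..1::real}. (\<integral>\<^sup>+x\<in>Q. (\<integral>\<^sup>+y\<in>Q. G (x + t *\<^sub>R (y - x)) \<partial>lborel) \<partial>lborel) \<partial>lborel)"
    by (intro nn_integral_cong) (auto simp: nn_integral_multc split: split_indicator)
  also have "\<dots> \<le> (\<integral>\<^sup>+t\<in>{0..1::real}. 2 ^ CARD('n) * emeasure lborel Q * (\<integral>\<^sup>+x. G x \<partial>lborel) \<partial>lborel)"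
    by (intro nn_integral_mono) (auto split: split_indicator intro: segment_average)
  also have "\<dots> = 2 ^ CARD('n) * emeasure lborel Q * (\<integral>\<^sup>+x. G x \<partial>lborel)"
    by (simp add: nn_integral_cmult_indicator)
  finally show ?thesis unfolding G_def by (simp add: mult_left_mono)
qed

lemma norm_add_powr_le:
  fixes a b :: "'a::real_normed_vector"
  assumes "0 < p"
  shows "norm (a + b) powr p \<le> 2 powr p * (norm a powr p + norm b powr p)"
proof -
  have "norm (a + b) \<le> 2 * max (norm a) (norm b)" using norm_triangle_ineq[of a b] by linarith
  then have "norm (a + b) powr p \<le> (2 * max (norm a) (norm b)) powr p"
    using assms by (intro powr_mono2) auto
  also have "\<dots> = 2 powr p * max (norm a) (norm b) powr p" by (simp add: powr_mult)
  also have "max (norm a) (norm b) powr p \<le> norm a powr p + norm b powr p"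
    by (auto simp: max_def)
  finally show ?thesis by simp
qed

lemma continuous_norm_powr:
  assumes "continuous_on S f" "0 < p"
  shows "continuous_on S (\<lambda>x. norm (f x) powr p)"
  using assms by (intro continuous_on_powr' continuous_intros) auto

lemma continuous_set_integrable:
  fixes f :: "'a::euclidean_space \<Rightarrow> 'b::euclidean_space"
  assumes "continuous_on UNIV f" "bounded Q" "Q \<in> sets borel"
  shows "set_integrable lborel Q f"
proof (rule set_integrable_subset)
  show "set_integrable lborel (closure Q) f"
    unfolding set_integrable_def using assms
    by (intro borel_integrable_compact) (auto intro: continuous_on_subset)
  show "Q \<subseteq> closure Q" by (rule closure_subset)
qed (use assms in auto)

lemma set_nn_integral_eq_set_integral:
  fixes f :: "'a \<Rightarrow> real"
  assumes "set_integrable M A f" "\<And>x. 0 \<le> f x"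
  shows "(\<integral>\<^sup>+x\<in>A. ennreal (f x) \<partial>M) = ennreal (LINT x:A|M. f x)"
proof -
  have "(\<integral>\<^sup>+x\<in>A. ennreal (f x) \<partial>M) = (\<integral>\<^sup>+x. ennreal (indicator A x *\<^sub>R f x) \<partial>M)"
    by (intro nn_integral_cong) (auto split: split_indicator)
  also have "\<dots> = ennreal (LINT x:A|M. f x)"
    unfolding set_lebesgue_integral_def
    using assms by (intro nn_integral_eq_integral) (auto simp: set_integrable_def)
  finally show ?thesis .
qed

lemma set_integral_nonneg':
  fixes f :: "'a \<Rightarrow> real"
  assumes "\<And>x. 0 \<le> f x"
  shows "0 \<le> (LINT x:A|M. f x)"
  unfolding set_lebesgue_integral_def using assms by (intro integral_nonneg_AE) auto

text \<open>By Jensen, the p-th power of the distance of \<phi> x to the mean c is at most the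
  average over y of |\<phi> y - \<phi> x|^p; integrated over x, this is the double integral above,
  and the measure of Q cancels. The mean is kept as an extra term because the inequality will be
  used for approximating test functions, whose means vanish only in the limit.\<close>

lemma poincare_convex:
  fixes \<phi> :: "real^'n \<Rightarrow> real"
  assumes p: "1 < p" and sm: "smooth_on \<phi> UNIV" 
    and Qb [measurable]: "Q \<in> sets borel" and Q: "convex Q" "bounded Q" "\<And>x y. x \<in> Q \<Longrightarrow> y \<in> Q \<Longrightarrow> norm (y - x) \<le> D"
    and m: "0 < measure lborel Q"
  shows "(LINT x:Q|lborel. \<bar>\<phi> x\<bar> powr p) \<le> 2 powr p * (D powr p * 2 ^ CARD('n) * (LINT x:Q|lborel. norm (grad \<phi> x) powr p)
     + measure lborel Q powr (1 - p) * \<bar>LINT x:Q|lborel. \<phi> x\<bar> powr p)"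
proof -
  note S = smooth_continuous_grad[OF sm]
  have p0: "p > 0" using p by simp
  define m where "m = measure lborel Q"
  have m0: "m > 0" using m by (simp add: m_def)
  have fin: "emeasure lborel Q \<noteq> \<infinity>" using emeasure_bounded_finite[OF Q(2)] by simp
  then have em: "emeasure lborel Q = ennreal m" by (simp add: m_def emeasure_eq_ennreal_measure)
  define c where "c = (LINT x:Q|lborel. \<phi> x) / m"
  define G where "G = (LINT x:Q|lborel. norm (grad \<phi> x) powr p)"
  have iC: "set_integrable lborel Q f" if "continuous_on UNIV f" for f :: "real^'n \<Rightarrow> real"
    using continuous_set_integrable[OF that Q(2) Qb] .
  have i1: "set_integrable lborel Q (\<lambda>y. \<bar>\<phi> y - a\<bar> powr p)" for a
    using continuous_norm_powr[OF continuous_on_diff[OF S(2) continuous_on_const] p0]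
    by (intro iC) simp
  have i2: "set_integrable lborel Q (\<lambda>y. norm (grad \<phi> y) powr p)"
    by (intro iC continuous_norm_powr S p0)
  have ic: "set_integrable lborel Q (\<lambda>y. a)" for a :: real by (intro iC) auto
  have cint: "(LINT x:Q|lborel. a) = a * m" for a :: real
    using fin by (simp add: set_lebesgue_integral_def m_def)
  have J: "ennreal (\<bar>\<phi> x - c\<bar> powr p) \<le> ennreal (1 / m) * (\<integral>\<^sup>+y\<in>Q. ennreal (\<bar>\<phi> y - \<phi> x\<bar> powr p) \<partial>lborel)" for x
  proof -
    have "(LINT y:Q|lborel. \<phi> y - \<phi> x) / m = c - \<phi> x"
      using m0 by (simp add: set_integral_diff(2) iC S(2) ic cint c_def field_simps)
    moreover have "\<bar>(LINT y:Q|lborel. \<phi> y - \<phi> x) / m\<bar> powr p \<le> (LINT y:Q|lborel. \<bar>\<phi> y - \<phi> x\<bar> powr p) / m"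
      unfolding m_def using fin m
      by (intro jensen_powr p i1 set_integral_diff iC S(2) ic) auto
    ultimately have "\<bar>\<phi> x - c\<bar> powr p \<le> (1 / m) * (LINT y:Q|lborel. \<bar>\<phi> y - \<phi> x\<bar> powr p)"
      by (simp add: abs_minus_commute)
    then have "ennreal (\<bar>\<phi> x - c\<bar> powr p) \<le> ennreal ((1 / m) * (LINT y:Q|lborel. \<bar>\<phi> y - \<phi> x\<bar> powr p))"
      by (rule ennreal_leI)
    also have "\<dots> = ennreal (1 / m) * ennreal (LINT y:Q|lborel. \<bar>\<phi> y - \<phi> x\<bar> powr p)"
      using m0 by (intro ennreal_mult set_integral_nonneg') auto
    finally show ?thesis by (simp add: set_nn_integral_eq_set_integral[OF i1])
  qed
  have [measurable]: "\<phi> \<in> borel_measurable borel" by (rule borel_measurable_continuous_onI[OF S(2)])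
  have "ennreal (LINT x:Q|lborel. \<bar>\<phi> x - c\<bar> powr p) = (\<integral>\<^sup>+x\<in>Q. ennreal (\<bar>\<phi> x - c\<bar> powr p) \<partial>lborel)"
    by (rule set_nn_integral_eq_set_integral[OF i1, symmetric]) simp
  also have "\<dots> \<le> (\<integral>\<^sup>+x\<in>Q. ennreal (1 / m) * (\<integral>\<^sup>+y\<in>Q. ennreal (\<bar>\<phi> y - \<phi> x\<bar> powr p) \<partial>lborel) \<partial>lborel)"
    by (intro nn_integral_mono mult_right_mono J) auto
  also have "\<dots> = ennreal (1 / m) * (\<integral>\<^sup>+x\<in>Q. (\<integral>\<^sup>+y\<in>Q. ennreal (\<bar>\<phi> y - \<phi> x\<bar> powr p) \<partial>lborel) \<partial>lborel)"
    by (simp add: mult.assoc nn_integral_cmult)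
  also have "\<dots> \<le> ennreal (1 / m) * (ennreal (D powr p) * (2 ^ CARD('n) * emeasure lborel Q * (\<integral>\<^sup>+x\<in>Q. ennreal (norm (grad \<phi> x) powr p) \<partial>lborel)))"
    by (intro mult_left_mono poincare_double p S Q Qb) auto
  also have "(\<integral>\<^sup>+x\<in>Q. ennreal (norm (grad \<phi> x) powr p) \<partial>lborel) = ennreal G"
    unfolding G_def by (rule set_nn_integral_eq_set_integral[OF i2]) simp
  also have "ennreal (1 / m) * (ennreal (D powr p) * (2 ^ CARD('n) * emeasure lborel Q * ennreal G)) = ennreal (D powr p * 2 ^ CARD('n) * G)"
  proof -
    have G0: "G \<ge> 0" unfolding G_def by (intro set_integral_nonneg') auto
    have "ennreal (1 / m) * (ennreal (D powr p) * (2 ^ CARD('n) * emeasure lborel Q * ennreal G)) 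
      = ennreal (1 / m) * (ennreal (D powr p) * (ennreal (2 ^ CARD('n)) * ennreal m * ennreal G))"
      by (simp add: em ennreal_power[symmetric])
    also have "\<dots> = ennreal ((1 / m) * (D powr p * (2 ^ CARD('n) * m * G)))"
    proof -
      have n: "0 \<le> 1 / m" "0 \<le> m" "0 \<le> D powr p" "0 \<le> (2::real) ^ CARD('n)" using m0 by auto
      show ?thesis
        by (simp only: ennreal_mult n G0 mult_nonneg_nonneg)
    qed
    also have "(1 / m) * (D powr p * (2 ^ CARD('n) * m * G)) = D powr p * 2 ^ CARD('n) * G"
      using m0 by simp
    finally show ?thesis .
  qed
  finally have main: "(LINT x:Q|lborel. \<bar>\<phi> x - c\<bar> powr p) \<le> D powr p * 2 ^ CARD('n) * G"
    by (subst (asm) ennreal_le_iff) (auto simp: G_def intro!: mult_nonneg_nonneg set_integral_nonneg')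
  have "(LINT x:Q|lborel. \<bar>\<phi> x\<bar> powr p) \<le> (LINT x:Q|lborel. 2 powr p * (\<bar>\<phi> x - c\<bar> powr p + \<bar>c\<bar> powr p))"
  proof (rule set_integral_mono)
    show "set_integrable lborel Q (\<lambda>x. \<bar>\<phi> x\<bar> powr p)" using i1[of 0] by simp
    show "set_integrable lborel Q (\<lambda>x. 2 powr p * (\<bar>\<phi> x - c\<bar> powr p + \<bar>c\<bar> powr p))"
      by (intro set_integrable_mult_right set_integral_add i1 ic)
    show "\<bar>\<phi> x\<bar> powr p \<le> 2 powr p * (\<bar>\<phi> x - c\<bar> powr p + \<bar>c\<bar> powr p)" for x
      using norm_add_powr_le[OF p0, of "\<phi> x - c" c] by simp
  qed
  also have "\<dots> = 2 powr p * ((LINT x:Q|lborel. \<bar>\<phi> x - c\<bar> powr p) + \<bar>c\<bar> powr p * m)"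
    by (simp add: set_integral_add(2) i1 ic cint)
  also have "\<bar>c\<bar> powr p * m = m powr (1 - p) * \<bar>LINT x:Q|lborel. \<phi> x\<bar> powr p"
    using m0 by (simp add: c_def powr_divide powr_diff)
  finally show ?thesis using main unfolding G_def m_def
    by (smt (verit, best) mult_left_mono powr_ge_zero)
qed

section \<open>Estimates in L^s and passage to L^1\<close>

lemma Lp_fun_diff:
  assumes "Lp_fun s \<Omega> f" "Lp_fun s \<Omega> g" "0 < s" and \<Omega>: "\<Omega> \<in> sets lebesgue"
  shows "Lp_fun s \<Omega> (\<lambda>x. f x - g x)"
proof -
  have [measurable]: "f \<in> borel_measurable lebesgue" "g \<in> borel_measurable lebesgue"
    using assms by (auto simp: Lp_fun_def)
  have "set_integrable lebesgue \<Omega> (\<lambda>x. 2 powr s * (norm (f x) powr s + norm (g x) powr s))"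
    using assms by (intro set_integrable_mult_right set_integral_add) (auto simp: Lp_fun_def)
  then have "set_integrable lebesgue \<Omega> (\<lambda>x. norm (f x - g x) powr s)"
    by (rule set_integrable_bound)
      (use \<Omega> norm_add_powr_le[OF assms(3), of "f _" "- g _"] in \<open>auto simp: set_borel_measurable_def intro!: borel_measurable_scaleR\<close>)
  then show ?thesis by (simp add: Lp_fun_def)
qed

lemma Lp_norm_split:
  assumes "Lp_fun s \<Omega> f" "Lp_fun s \<Omega> g" "0 < s" and \<Omega>: "\<Omega> \<in> sets lebesgue"
  shows "(LINT x:\<Omega>|lebesgue. norm (f x) powr s) \<le> 2 powr s * ((LINT x:\<Omega>|lebesgue. norm (g x) powr s)
    + (LINT x:\<Omega>|lebesgue. norm (f x - g x) powr s))"
proof -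
  have i: "set_integrable lebesgue \<Omega> (\<lambda>x. norm (f x - g x) powr s)"
    using Lp_fun_diff[OF assms] by (simp add: Lp_fun_def)
  have ig: "set_integrable lebesgue \<Omega> (\<lambda>x. norm (g x) powr s)" using assms by (simp add: Lp_fun_def)
  have "(LINT x:\<Omega>|lebesgue. norm (f x) powr s) \<le> (LINT x:\<Omega>|lebesgue. 2 powr s * (norm (g x) powr s + norm (f x - g x) powr s))"
  proof (rule set_integral_mono)
    show "norm (f x) powr s \<le> 2 powr s * (norm (g x) powr s + norm (f x - g x) powr s)" for x
      using norm_add_powr_le[OF assms(3), of "g x" "f x - g x"] by simp
  qed (use assms i ig in \<open>auto simp: Lp_fun_def intro!: set_integral_add\<close>)
  also have "\<dots> = 2 powr s * ((LINT x:\<Omega>|lebesgue. norm (g x) powr s)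
    + (LINT x:\<Omega>|lebesgue. norm (f x - g x) powr s))"
    by (simp add: set_integral_add(2)[OF ig i])
  finally show ?thesis .
qed

text \<open>Takes the place of Hoelder's inequality: on a set of finite measure, the first term is
  made small by \<delta>, and the second by the L^s norm once \<delta> is fixed.\<close>

lemma abs_le_delta_powr:
  assumes "1 \<le> s" "0 < \<delta>"
  shows "\<bar>a::real\<bar> \<le> \<delta> + \<delta> powr (1 - s) * \<bar>a\<bar> powr s"
proof (cases "\<bar>a\<bar> \<le> \<delta>")
  case False
  then have "\<bar>a\<bar> powr (1 - s) \<le> \<delta> powr (1 - s)"
    using assms by (intro powr_mono2') auto
  then have "\<bar>a\<bar> powr (1 - s) * \<bar>a\<bar> powr s \<le> \<delta> powr (1 - s) * \<bar>a\<bar> powr s"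
    by (intro mult_right_mono) auto
  moreover have "\<bar>a\<bar> powr (1 - s) * \<bar>a\<bar> powr s = \<bar>a\<bar>"
    using False assms by (simp add: powr_add[symmetric])
  ultimately show ?thesis using assms by linarith
next
  case True
  have "0 \<le> \<delta> powr (1 - s) * \<bar>a\<bar> powr s" by simp
  with True show ?thesis by linarith
qed

lemma Lp_fun_integrable:
  fixes f :: "real^'n \<Rightarrow> real"
  assumes "Lp_fun s \<Omega> f" "1 \<le> s" and \<Omega>: "\<Omega> \<in> lmeasurable"
  shows "set_integrable lebesgue \<Omega> f"
proof -
  have [measurable]: "f \<in> borel_measurable lebesgue" "\<Omega> \<in> sets lebesgue"
    using assms by (auto simp: Lp_fun_def fmeasurableD)
  have "set_integrable lebesgue \<Omega> (\<lambda>x. 1 + 1 * \<bar>f x\<bar> powr s)"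
    using assms fmeasurableD2[OF \<Omega>]
    by (intro set_integral_add set_integrable_mult_right) 
      (auto simp: Lp_fun_def set_integrable_def top.not_eq_extremum intro!: integrable_real_indicator)
  then show ?thesis
    by (rule set_integrable_bound)
      (use abs_le_delta_powr[OF assms(2), of 1] in \<open>auto simp: set_borel_measurable_def intro!: borel_measurable_scaleR\<close>)
qed

lemma Lp_imp_L1_small:
  fixes \<Omega> :: "(real^'n) set"
  assumes s: "1 \<le> s" and \<Omega>: "\<Omega> \<in> lmeasurable" and "0 < e"
  obtains \<delta> where "\<delta> > 0" "\<And>f g :: real^'n \<Rightarrow> real. Lp_fun s \<Omega> f \<Longrightarrow> Lp_fun s \<Omega> g \<Longrightarrow> Lp_dist s \<Omega> f g < \<delta> \<Longrightarrow>
      (LINT x:\<Omega>|lebesgue. \<bar>f x - g x\<bar>) < e"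
proof -
  define M where "M = measure lebesgue \<Omega>"
  have M: "M \<ge> 0" by (simp add: M_def)
  \<comment> \<open>The summand 1 makes the bound below e/2 strict also for a null set; \<delta>
    below is the solution of \<open>\<eta> powr (1 - s) * \<delta> powr s = e / 2\<close>.\<close>
  define \<eta> where "\<eta> = e / (2 * (M + 1))"
  have \<eta>: "\<eta> > 0" "\<eta> * M < e / 2"
    using M \<open>0 < e\<close> by (auto simp: \<eta>_def field_simps)
  define \<delta> where "\<delta> = (e / 2 / \<eta> powr (1 - s)) powr (1 / s)"
  show thesis
  proof (rule that)
    show "\<delta> > 0" using \<eta> \<open>0 < e\<close> by (simp add: \<delta>_def)
    fix f g :: "real^'n \<Rightarrow> real"
    assume fg: "Lp_fun s \<Omega> f" "Lp_fun s \<Omega> g" and d: "Lp_dist s \<Omega> f g < \<delta>"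
    define A where "A = (LINT x:\<Omega>|lebesgue. \<bar>f x - g x\<bar> powr s)"
    have A0: "A \<ge> 0" unfolding A_def by (intro set_integral_nonneg') auto
    have "A powr (1 / s) < \<delta>" using d by (simp add: Lp_dist_def A_def)
    then have "A < e / 2 / \<eta> powr (1 - s)"
      unfolding \<delta>_def using s A0 \<eta> \<open>0 < e\<close> powr_mono2[of "1 / s" "e / 2 / \<eta> powr (1 - s)" A]
      by (meson divide_nonneg_nonneg less_imp_le not_le order_trans powr_ge_zero zero_le_numeral zero_le_one)
    then have A: "\<eta> powr (1 - s) * A < e / 2" using \<eta> by (simp add: field_simps)
    have diff: "Lp_fun s \<Omega> (\<lambda>x. f x - g x)" using fg s \<Omega> by (intro Lp_fun_diff) (auto simp: fmeasurableD)
    have i: "set_integrable lebesgue \<Omega> (\<lambda>x. \<bar>f x - g x\<bar> powr s)" using diff by (simp add: Lp_fun_def)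
    have ic: "set_integrable lebesgue \<Omega> (\<lambda>x. \<eta>)"
      using \<Omega> by (auto simp: set_integrable_def fmeasurable_def intro!: integrable_scaleR_left integrable_real_indicator)
    have "(LINT x:\<Omega>|lebesgue. \<bar>f x - g x\<bar>) \<le> (LINT x:\<Omega>|lebesgue. \<eta> + \<eta> powr (1 - s) * \<bar>f x - g x\<bar> powr s)"
      using abs_le_delta_powr[OF s \<eta>(1)]
      by (intro set_integral_mono set_integrable_abs Lp_fun_integrable[OF diff s \<Omega>] set_integral_add set_integrable_mult_right i ic) auto
    also have "\<dots> = \<eta> * M + \<eta> powr (1 - s) * A"
      using \<Omega> i ic by (subst set_integral_add(2)) (auto simp: A_def M_def set_lebesgue_integral_def fmeasurable_def)
    finally show "(LINT x:\<Omega>|lebesgue. \<bar>f x - g x\<bar>) < e" using A \<eta> by linarith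
  qed
qed

lemma test_fun_Lp:
  fixes \<Omega> :: "(real^'n) set"
  assumes "test_fun \<Omega> \<phi>" "bounded \<Omega>" "open \<Omega>" "0 < s"
  shows "Lp_fun s \<Omega> \<phi>" "Lp_fun s \<Omega> (grad \<phi>)"
proof -
  have S: "continuous_on UNIV (grad \<phi>)" "continuous_on UNIV \<phi>"
    using assms(1) by (auto simp: test_fun_def intro: smooth_continuous_grad)
  have *: "Lp_fun s \<Omega> f" if c: "continuous_on UNIV f" for f :: "real^'n \<Rightarrow> 'b::euclidean_space"
  proof -
    have [measurable]: "f \<in> borel_measurable borel" by (rule borel_measurable_continuous_onI[OF c])
    have "set_integrable lborel \<Omega> (\<lambda>x. norm (f x) powr s)"
      using assms by (intro continuous_set_integrable continuous_norm_powr c) auto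
    then have "set_integrable lebesgue \<Omega> (\<lambda>x. norm (f x) powr s)"
      unfolding set_integrable_def by (simp add: integrable_completion)
    moreover have "f \<in> borel_measurable lebesgue" by (simp add: measurable_completion)
    ultimately show ?thesis by (simp add: Lp_fun_def)
  qed
  show "Lp_fun s \<Omega> \<phi>" "Lp_fun s \<Omega> (grad \<phi>)" using S by (auto intro: *)
qed

section \<open>The lower bound for the Rayleigh quotient\<close>

lemma test_fun_zero:
  assumes "test_fun \<Omega> \<phi>" "x \<notin> \<Omega>"
  shows "\<phi> x = 0" "grad \<phi> x = 0"
proof -
  have x: "x \<in> - closure {x. \<phi> x \<noteq> 0}" using assms by (auto simp: test_fun_def)
  then show "\<phi> x = 0" using closure_subset[of "{x. \<phi> x \<noteq> 0}"] by auto
  have "((\<lambda>_. 0) has_derivative (\<lambda>v. 0 \<bullet> v)) (at x)" by simp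
  then have "(\<phi> has_derivative (\<lambda>v. 0 \<bullet> v)) (at x)"
    by (rule has_derivative_transform_within_open[OF _ _ x])
      (use closure_subset[of "{x. \<phi> x \<noteq> 0}"] in auto)
  then show "grad \<phi> x = 0" by (rule has_derivative_imp_grad)
qed

lemma set_integral_grid:
  fixes f :: "real^'n \<Rightarrow> real"
  assumes f: "continuous_on UNIV f" "\<And>x. x \<notin> \<Omega> \<Longrightarrow> f x = 0" and bd: "bounded \<Omega>" and h: "h > 0"
  shows "(LINT x:\<Omega>|lborel. f x) = (\<Sum>m\<in>grid_index h ` \<Omega>. LINT x:grid_cell h m|lborel. f x)"
proof -
  let ?I = "grid_index h ` \<Omega>"
  have fin: "finite ?I" by (rule finite_grid_index[OF bd h])
  have int: "integrable lborel (\<lambda>x. indicator (grid_cell h m) x *\<^sub>R f x)" for m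
    using continuous_set_integrable[OF f(1), of "grid_cell h m"]
    by (simp add: grid_cell_def set_integrable_def bounded_subset[OF bounded_cbox cell_subset_cbox])
  have "indicator \<Omega> x *\<^sub>R f x = (\<Sum>m\<in>?I. indicator (grid_cell h m) x *\<^sub>R f x)" for x
  proof -
    have "(\<Sum>m\<in>?I. indicator (grid_cell h m) x *\<^sub>R f x) = indicator (\<Union>m\<in>?I. grid_cell h m) x *\<^sub>R f x"
      by (subst indicator_UN_disjoint[OF fin disjoint_grid[OF h]]) (simp add: scaleR_sum_left[symmetric] sum_distrib_right)
    also have "\<dots> = indicator \<Omega> x *\<^sub>R f x"
      using f(2)[of x] grid_cell_iff[OF h, of x] by (auto split: split_indicator)
    finally show ?thesis by simp
  qed
  then show ?thesis unfolding set_lebesgue_integral_def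
    using int by (simp add: Bochner_Integration.integral_sum del: real_scaleR_def)
qed

lemma set_integral_lebesgue_lborel:
  fixes f :: "real^'n \<Rightarrow> real"
  assumes "continuous_on UNIV f" "A \<in> sets borel"
  shows "(LINT x:A|lebesgue. f x) = (LINT x:A|lborel. f x)"
proof -
  have [measurable]: "f \<in> borel_measurable borel" by (rule borel_measurable_continuous_onI[OF assms(1)])
  show ?thesis unfolding set_lebesgue_integral_def
    by (rule integral_completion) (use assms(2) in measurable)
qed

text \<open>A test function is smooth on the whole space and vanishes outside the domain, so the
  inequality may be used on entire cells, including those crossing the boundary, where the domain
  itself need not be convex.\<close>

lemma poincare_grid:
  fixes \<phi> :: "real^'n \<Rightarrow> real"
  assumes p: "1 < p" and t: "test_fun \<Omega> \<phi>" and op: "open \<Omega>" and bd: "bounded \<Omega>" and h: "h > 0"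
  shows "(LINT x:\<Omega>|lebesgue. \<bar>\<phi> x\<bar> powr p) \<le> 2 powr p * ((real CARD('n) * h) powr p * 2 ^ CARD('n) * (LINT x:\<Omega>|lebesgue. norm (grad \<phi> x) powr p)
     + (h ^ CARD('n)) powr (1 - p) * (\<Sum>m\<in>grid_index h ` \<Omega>. \<bar>LINT x:grid_cell h m \<inter> \<Omega>|lebesgue. \<phi> x\<bar> powr p))"
proof -
  let ?I = "grid_index h ` \<Omega>"
  have sm: "smooth_on \<phi> UNIV" using t by (simp add: test_fun_def)
  note S = smooth_continuous_grad[OF sm]
  have p0: "p > 0" using p by simp
  have c1: "continuous_on UNIV (\<lambda>x. \<bar>\<phi> x\<bar> powr p)" using continuous_norm_powr[OF S(2) p0] by simp
  have c2: "continuous_on UNIV (\<lambda>x. norm (grad \<phi> x) powr p)" using continuous_norm_powr[OF S(1) p0] .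
  have "(LINT x:\<Omega>|lebesgue. \<bar>\<phi> x\<bar> powr p) = (\<Sum>m\<in>?I. LINT x:grid_cell h m|lborel. \<bar>\<phi> x\<bar> powr p)"
    using op test_fun_zero[OF t] p0 by (subst set_integral_lebesgue_lborel[OF c1]) (auto intro!: set_integral_grid c1 bd h)
  also have "\<dots> \<le> (\<Sum>m\<in>?I. 2 powr p * ((real CARD('n) * h) powr p * 2 ^ CARD('n) * (LINT x:grid_cell h m|lborel. norm (grad \<phi> x) powr p)
     + (h ^ CARD('n)) powr (1 - p) * \<bar>LINT x:grid_cell h m|lborel. \<phi> x\<bar> powr p))"
  proof (rule sum_mono)
    fix m assume "m \<in> ?I"
    let ?Q = "grid_cell h m :: (real^'n) set"
    have Qm: "measure lborel ?Q = h ^ CARD('n)"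
      using cell_measure[of h "\<chi> i. h * real_of_int (m $ i)"] h unfolding grid_cell_def by simp
    show "(LINT x:?Q|lborel. \<bar>\<phi> x\<bar> powr p) \<le> 2 powr p * ((real CARD('n) * h) powr p * 2 ^ CARD('n) * (LINT x:?Q|lborel. norm (grad \<phi> x) powr p)
     + (h ^ CARD('n)) powr (1 - p) * \<bar>LINT x:?Q|lborel. \<phi> x\<bar> powr p)"
      unfolding Qm[symmetric]
    proof (rule poincare_convex[OF p sm])
      show "?Q \<in> sets borel" "convex ?Q" "bounded ?Q"
        by (auto simp: grid_cell_def cell_convex bounded_subset[OF bounded_cbox cell_subset_cbox])
      show "norm (y - x) \<le> real CARD('n) * h" if "x \<in> ?Q" "y \<in> ?Q" for x y
        using that cell_dist unfolding grid_cell_def by blast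
      show "0 < measure lborel ?Q" unfolding Qm using h by simp
    qed
  qed
  also have "\<dots> = 2 powr p * ((real CARD('n) * h) powr p * 2 ^ CARD('n) * (\<Sum>m\<in>?I. LINT x:grid_cell h m|lborel. norm (grad \<phi> x) powr p)
     + (h ^ CARD('n)) powr (1 - p) * (\<Sum>m\<in>?I. \<bar>LINT x:grid_cell h m|lborel. \<phi> x\<bar> powr p))"
    by (simp only: sum.distrib flip: sum_distrib_left)
  also have "(\<Sum>m\<in>?I. LINT x:grid_cell h m|lborel. norm (grad \<phi> x) powr p) = (LINT x:\<Omega>|lebesgue. norm (grad \<phi> x) powr p)"
    using op test_fun_zero[OF t] p0 by (subst set_integral_lebesgue_lborel[OF c2]) (auto intro!: set_integral_grid[symmetric] c2 bd h)
  also have "(\<Sum>m\<in>?I. \<bar>LINT x:grid_cell h m|lborel. \<phi> x\<bar> powr p) = (\<Sum>m\<in>?I. \<bar>LINT x:grid_cell h m \<inter> \<Omega>|lebesgue. \<phi> x\<bar> powr p)"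
  proof (rule sum.cong[OF refl])
    fix m
    have "(LINT x:grid_cell h m|lborel. \<phi> x) = (LINT x:grid_cell h m \<inter> \<Omega>|lborel. \<phi> x)"
      unfolding set_lebesgue_integral_def using test_fun_zero(1)[OF t]
      by (intro Bochner_Integration.integral_cong) (auto split: split_indicator)
    also have "\<dots> = (LINT x:grid_cell h m \<inter> \<Omega>|lebesgue. \<phi> x)"
      by (rule set_integral_lebesgue_lborel[OF S(2), symmetric]) (use op in \<open>auto simp: grid_cell_def\<close>)
    finally show "\<bar>LINT x:grid_cell h m|lborel. \<phi> x\<bar> powr p = \<bar>LINT x:grid_cell h m \<inter> \<Omega>|lebesgue. \<phi> x\<bar> powr p"
      by simp
  qed
  finally show ?thesis .
qed

lemma Lp_dist_powr:
  assumes "0 < s"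
  shows "Lp_dist s \<Omega> f g powr s = (LINT x:\<Omega>|lebesgue. norm (f x - g x) powr s)"
proof -
  have "0 \<le> (LINT x:\<Omega>|lebesgue. norm (f x - g x) powr s)" by (rule set_integral_nonneg') simp
  then show ?thesis using assms by (simp add: Lp_dist_def powr_powr)
qed

lemma Lp_dist_tendsto_0:
  assumes "0 < s" "(\<lambda>n. Lp_dist s \<Omega> (f n) g) \<longlonglongrightarrow> 0"
  shows "(\<lambda>n. LINT x:\<Omega>|lebesgue. norm (f n x - g x) powr s) \<longlonglongrightarrow> 0"
proof -
  have "(\<lambda>n. Lp_dist s \<Omega> (f n) g powr s) \<longlonglongrightarrow> 0"
    by (rule tendsto_zero_powrI[OF assms(2) tendsto_const]) (use assms(1) in \<open>auto simp: Lp_dist_def\<close>)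
  then show ?thesis by (simp add: Lp_dist_powr[OF assms(1)])
qed

lemma set_integral_diff_bound:
  fixes f g :: "real^'n \<Rightarrow> real"
  assumes "Lp_fun s \<Omega> f" "Lp_fun s \<Omega> g" "1 \<le> s" and \<Omega>: "\<Omega> \<in> lmeasurable" and B: "B \<in> sets lebesgue" "B \<subseteq> \<Omega>"
  shows "\<bar>(LINT x:B|lebesgue. f x) - (LINT x:B|lebesgue. g x)\<bar> \<le> (LINT x:\<Omega>|lebesgue. \<bar>f x - g x\<bar>)"
proof -
  have i: "set_integrable lebesgue \<Omega> f" "set_integrable lebesgue \<Omega> g"
    using assms by (auto intro: Lp_fun_integrable)
  then have iB: "set_integrable lebesgue B f" "set_integrable lebesgue B g"
    using B by (auto intro: set_integrable_subset)
  have d: "set_integrable lebesgue \<Omega> (\<lambda>x. f x - g x)" by (rule set_integral_diff(1)[OF i])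
  have "\<bar>(LINT x:B|lebesgue. f x) - (LINT x:B|lebesgue. g x)\<bar> = \<bar>LINT x:B|lebesgue. f x - g x\<bar>"
    by (simp add: set_integral_diff(2)[OF iB])
  also have "\<dots> \<le> (LINT x:B|lebesgue. \<bar>f x - g x\<bar>)"
    unfolding set_lebesgue_integral_def using integral_abs_bound[of lebesgue "\<lambda>x. indicator B x *\<^sub>R (f x - g x)"]
    by (simp add: abs_mult)
  also have "\<dots> \<le> (LINT x:\<Omega>|lebesgue. \<bar>f x - g x\<bar>)"
    unfolding set_lebesgue_integral_def using set_integrable_abs[OF d] B
    by (intro integral_mono') (auto simp: set_integrable_def split: split_indicator)
  finally show ?thesis .
qed

text \<open>Each factor \<open>2 powr p\<close> of the constant \<open>8 powr p\<close> pays for one use of \<open>norm_add_powr_le\<close>, which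
  replaces the triangle inequality in \<open>L\<^sup>p\<close>.\<close>

lemma W0_poincare:
  fixes u :: "real^'n \<Rightarrow> real" and g :: "real^'n \<Rightarrow> real^'n"
  assumes p: "1 < p" and W: "(u, g) \<in> W0 p \<Omega>" and op: "open \<Omega>" and bd: "bounded \<Omega>" and h: "h > 0"
    and avg: "\<And>m. m \<in> grid_index h ` \<Omega> \<Longrightarrow> (LINT x:grid_cell h m \<inter> \<Omega>|lebesgue. u x) = 0"
  shows "(LINT x:\<Omega>|lebesgue. \<bar>u x\<bar> powr p) \<le> 8 powr p * (real CARD('n) powr p * 2 ^ CARD('n)) * h powr p * (LINT x:\<Omega>|lebesgue. norm (g x) powr p)"
proof -
  let ?I = "grid_index h ` \<Omega>"
  have p0: "p > 0" "1 \<le> p" using p by auto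
  have \<Omega>: "\<Omega> \<in> lmeasurable" "\<Omega> \<in> sets lebesgue" using op bd by (auto simp: lmeasurable_open)
  obtain \<phi> where u: "Lp_fun p \<Omega> u" "Lp_fun p \<Omega> g" and t: "\<And>n. test_fun \<Omega> (\<phi> n)"
    and lim: "(\<lambda>n. Lp_dist p \<Omega> (\<phi> n) u) \<longlonglongrightarrow> 0" "(\<lambda>n. Lp_dist p \<Omega> (grad (\<phi> n)) g) \<longlonglongrightarrow> 0"
    using W unfolding W0_def by blast
  note tL = test_fun_Lp[OF t bd op p0(1)]
  define a where "a n = (LINT x:\<Omega>|lebesgue. norm (\<phi> n x - u x) powr p)" for n
  define b where "b n = (LINT x:\<Omega>|lebesgue. norm (grad (\<phi> n) x - g x) powr p)" for n
  define e where "e n m = (LINT x:grid_cell h m \<inter> \<Omega>|lebesgue. \<phi> n x)" for n m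
  have a: "a \<longlonglongrightarrow> 0" and b: "b \<longlonglongrightarrow> 0"
    unfolding a_def b_def by (intro Lp_dist_tendsto_0 lim p0)+
  \<comment> \<open>The cell averages of the approximating test functions tend to those of u, which
    are zero by hypothesis.\<close>
  have e: "(\<lambda>n. e n m) \<longlonglongrightarrow> 0" if m: "m \<in> ?I" for m
  proof (rule LIMSEQ_I)
    fix r :: real assume "r > 0"
    then obtain \<delta> where \<delta>: "\<delta> > 0" "\<And>f g :: real^'n \<Rightarrow> real. Lp_fun p \<Omega> f \<Longrightarrow> Lp_fun p \<Omega> g \<Longrightarrow> Lp_dist p \<Omega> f g < \<delta> \<Longrightarrow>
      (LINT x:\<Omega>|lebesgue. \<bar>f x - g x\<bar>) < r"
      using Lp_imp_L1_small[OF p0(2) \<Omega>(1)] by metis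
    obtain N where N: "\<And>n. n \<ge> N \<Longrightarrow> Lp_dist p \<Omega> (\<phi> n) u < \<delta>"
      using order_tendstoD(2)[OF lim(1) \<delta>(1)] by (auto simp: eventually_sequentially)
    have "norm (e n m - 0) < r" if "n \<ge> N" for n
    proof -
      have "grid_cell h m \<inter> \<Omega> \<in> sets lebesgue" using \<Omega>(2) by (auto simp: grid_cell_def)
      then have "\<bar>(LINT x:grid_cell h m \<inter> \<Omega>|lebesgue. \<phi> n x) - (LINT x:grid_cell h m \<inter> \<Omega>|lebesgue. u x)\<bar> \<le> (LINT x:\<Omega>|lebesgue. \<bar>\<phi> n x - u x\<bar>)"
        by (intro set_integral_diff_bound[where s=p] tL u p0 \<Omega>) auto
      also have "\<dots> < r" using \<delta>(2)[OF tL(1) u(1) N[OF that]] .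
      finally show ?thesis using avg[OF m] by (simp add: e_def)
    qed
    then show "\<exists>N. \<forall>n\<ge>N. norm (e n m - 0) < r" by blast
  qed
  define A where "A = (real CARD('n) * h) powr p * 2 ^ CARD('n)"
  define B where "B = (h ^ CARD('n)) powr (1 - p)"
  define G where "G = (LINT x:\<Omega>|lebesgue. norm (g x) powr p)"
  have A0: "A \<ge> 0" by (simp add: A_def)
  have bound: "(LINT x:\<Omega>|lebesgue. \<bar>u x\<bar> powr p) \<le> 2 powr p * (2 powr p * (A * (2 powr p * (G + b n)) + B * (\<Sum>m\<in>?I. \<bar>e n m\<bar> powr p)) + a n)" for n
  proof -
    have "(LINT x:\<Omega>|lebesgue. norm (grad (\<phi> n) x) powr p) \<le> 2 powr p * (G + b n)"
      unfolding G_def b_def by (intro Lp_norm_split u tL p0 \<Omega>)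
    then have 1: "A * (LINT x:\<Omega>|lebesgue. norm (grad (\<phi> n) x) powr p) \<le> A * (2 powr p * (G + b n))"
      using A0 by (rule mult_left_mono)
    have "(LINT x:\<Omega>|lebesgue. \<bar>\<phi> n x\<bar> powr p) \<le> 2 powr p * (A * (LINT x:\<Omega>|lebesgue. norm (grad (\<phi> n) x) powr p) + B * (\<Sum>m\<in>?I. \<bar>e n m\<bar> powr p))"
      using poincare_grid[OF p t op bd h] unfolding A_def B_def e_def .
    also have "\<dots> \<le> 2 powr p * (A * (2 powr p * (G + b n)) + B * (\<Sum>m\<in>?I. \<bar>e n m\<bar> powr p))"
      by (rule mult_left_mono[OF add_right_mono[OF 1]]) simp
    finally have 2: "(LINT x:\<Omega>|lebesgue. \<bar>\<phi> n x\<bar> powr p) + a n \<le> 2 powr p * (A * (2 powr p * (G + b n)) + B * (\<Sum>m\<in>?I. \<bar>e n m\<bar> powr p)) + a n"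
      by simp
    have "(LINT x:\<Omega>|lebesgue. norm (u x) powr p) \<le> 2 powr p * ((LINT x:\<Omega>|lebesgue. norm (\<phi> n x) powr p) + (LINT x:\<Omega>|lebesgue. norm (u x - \<phi> n x) powr p))"
      by (intro Lp_norm_split u tL p0 \<Omega>)
    also have "\<dots> = 2 powr p * ((LINT x:\<Omega>|lebesgue. \<bar>\<phi> n x\<bar> powr p) + a n)"
      by (simp add: a_def abs_minus_commute)
    also have "\<dots> \<le> 2 powr p * (2 powr p * (A * (2 powr p * (G + b n)) + B * (\<Sum>m\<in>?I. \<bar>e n m\<bar> powr p)) + a n)"
      using 2 by (rule mult_left_mono) simp
    finally show ?thesis by simp
  qed
  have "(\<lambda>n. 2 powr p * (2 powr p * (A * (2 powr p * (G + b n)) + B * (\<Sum>m\<in>?I. \<bar>e n m\<bar> powr p)) + a n))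
    \<longlonglongrightarrow> 2 powr p * (2 powr p * (A * (2 powr p * (G + 0)) + B * (\<Sum>m\<in>?I. 0)) + 0)"
  proof (intro tendsto_intros a b)
    fix m assume m: "m \<in> ?I"
    show "(\<lambda>n. \<bar>e n m\<bar> powr p) \<longlonglongrightarrow> 0"
      by (rule tendsto_zero_powrI[OF tendsto_rabs_zero[OF e[OF m]] tendsto_const]) (use p0 in auto)
  qed
  then have "(LINT x:\<Omega>|lebesgue. \<bar>u x\<bar> powr p) \<le> 2 powr p * (2 powr p * (A * (2 powr p * (G + 0)) + B * (\<Sum>m\<in>?I. 0)) + 0)"
    by (rule LIMSEQ_le_const) (use bound in auto)
  also have "\<dots> = (2 powr p * 2 powr p * 2 powr p) * A * G" by simp
  also have "2 powr p * 2 powr p * 2 powr p = 8 powr p"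
    by (simp add: powr_mult[symmetric])
  finally show ?thesis unfolding A_def G_def using h by (simp add: powr_mult ac_simps)
qed

lemma W0_Lp: "(u, g) \<in> W0 s \<Omega> \<Longrightarrow> Lp_fun s \<Omega> u \<and> Lp_fun s \<Omega> g"
  by (simp add: W0_def)

lemma Lp_dist_nonneg: "0 \<le> Lp_dist s \<Omega> f g"
  by (simp add: Lp_dist_def)

text \<open>With a = |u|^p / h^p and b = |v|^q / h^q, the left side divided by
  \<open>h powr (\<alpha> + \<beta>)\<close> is a^(\<alpha>/p) b^(\<beta>/q); the weights are then
  estimated by 1. Dividing by h^p and h^q cancels exactly the powers of h from Poincare's
  inequality.\<close>

lemma denom_young:
  assumes "0 < \<alpha>" "0 < \<beta>" "\<alpha> / p + \<beta> / q = 1" "0 < p" "0 < q" "0 < (h::real)"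
  shows "\<bar>u\<bar> powr \<alpha> * \<bar>v\<bar> powr \<beta> \<le> h powr (\<alpha> + \<beta>) * (\<bar>u\<bar> powr p / h powr p + \<bar>v\<bar> powr q / h powr q)"
proof -
  define a where "a = \<bar>u\<bar> powr p / h powr p"
  define b where "b = \<bar>v\<bar> powr q / h powr q"
  have ab: "a \<ge> 0" "b \<ge> 0" by (auto simp: a_def b_def)
  have le1: "\<alpha> / p \<le> 1" "\<beta> / q \<le> 1" using assms by (smt (verit) divide_pos_pos)+
  have a1: "a powr (\<alpha> / p) = \<bar>u\<bar> powr \<alpha> / h powr \<alpha>"
    using assms by (simp add: a_def powr_divide powr_powr)
  have b1: "b powr (\<beta> / q) = \<bar>v\<bar> powr \<beta> / h powr \<beta>"
    using assms by (simp add: b_def powr_divide powr_powr)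
  have "a powr (\<alpha> / p) * b powr (\<beta> / q) \<le> (\<alpha> / p) * a + (\<beta> / q) * b"
  proof (cases "a = 0 \<or> b = 0")
    case True
    then show ?thesis using ab assms by auto
  next
    case False
    then show ?thesis using Youngs_inequality_0[of "\<alpha> / p" "\<beta> / q" a b] assms ab by auto
  qed
  also have "\<dots> \<le> 1 * a + 1 * b"
    using ab le1 by (intro add_mono mult_right_mono)
  finally have "(\<bar>u\<bar> powr \<alpha> / h powr \<alpha>) * (\<bar>v\<bar> powr \<beta> / h powr \<beta>) \<le> a + b" unfolding a1 b1 by simp
  then have "h powr (\<alpha> + \<beta>) * ((\<bar>u\<bar> powr \<alpha> / h powr \<alpha>) * (\<bar>v\<bar> powr \<beta> / h powr \<beta>)) \<le> h powr (\<alpha> + \<beta>) * (a + b)"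
    by (intro mult_left_mono) auto
  then show ?thesis using assms(6) unfolding a_def b_def by (simp add: powr_add)
qed

lemma rayleigh_lower_bound:
  fixes \<Omega> :: "(real^'n) set"
  assumes p: "1 < p" "1 < q" and ab: "0 < \<alpha>" "0 < \<beta>" "\<alpha> / p + \<beta> / q = 1"
    and op: "open \<Omega>" and bd: "bounded \<Omega>" and h: "h > 0"
    and adm: "admissible p q \<alpha> \<beta> \<Omega> k C" and k: "2 * card (grid_index h ` \<Omega>) < k"
    and M: "M = p * (8 powr p * (real CARD('n) powr p * 2 ^ CARD('n))) + q * (8 powr q * (real CARD('n) powr q * 2 ^ CARD('n)))"
  shows "\<exists>X\<in>C. 1 / (M * h powr (\<alpha> + \<beta>)) \<le> rayleigh p q \<alpha> \<beta> \<Omega> X"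
proof -
  let ?I = "grid_index h ` \<Omega>"
  have p1: "1 \<le> p" "1 \<le> q" using p by auto
  define N where "N = card ?I"
  have fin: "finite ?I" by (rule finite_grid_index[OF bd h])
  have \<Omega>: "\<Omega> \<in> lmeasurable" "\<Omega> \<in> sets lebesgue" using op bd by (auto simp: lmeasurable_open)
  obtain c where c: "bij_betw c {0..<N} ?I" using ex_bij_betw_nat_finite[OF fin] unfolding N_def by blast
  have sub: "C \<subseteq> W0 p \<Omega> \<times> W0 q \<Omega>" and dpos: "\<And>X. X \<in> C \<Longrightarrow> denom \<alpha> \<beta> \<Omega> X > 0"
    and gen: "genus_ge (Wdist p q \<Omega>) neg_pt C k"
    using adm unfolding admissible_def by blast+
  define B where "B i = grid_cell h (c i) \<inter> \<Omega>" for i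
  have B: "B i \<in> sets lebesgue" "B i \<subseteq> \<Omega>" for i using \<Omega>(2) by (auto simp: B_def grid_cell_def)
  \<comment> \<open>The first N functionals integrate u over the cells, the next N integrate v;
    hence the requirement 2N < k.\<close>
  define H :: "nat \<Rightarrow> 'n sob \<times> 'n sob \<Rightarrow> real" where
    "H i X = (if i < N then (LINT x:B i|lebesgue. fst (fst X) x) else (LINT x:B (i - N)|lebesgue. fst (snd X) x))" for i X
  have cont: "d_continuous_on (Wdist p q \<Omega>) C (H i)" for i
    unfolding d_continuous_on_def
  proof (intro ballI allI impI)
    fix X e assume X: "X \<in> C" and e: "(0::real) < e"
    obtain \<delta>1 where d1: "\<delta>1 > 0" "\<And>f g :: real^'n \<Rightarrow> real. Lp_fun p \<Omega> f \<Longrightarrow> Lp_fun p \<Omega> g \<Longrightarrow> Lp_dist p \<Omega> f g < \<delta>1 \<Longrightarrow>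
      (LINT x:\<Omega>|lebesgue. \<bar>f x - g x\<bar>) < e"
      using Lp_imp_L1_small[OF p1(1) \<Omega>(1) e] by metis
    obtain \<delta>2 where d2: "\<delta>2 > 0" "\<And>f g :: real^'n \<Rightarrow> real. Lp_fun q \<Omega> f \<Longrightarrow> Lp_fun q \<Omega> g \<Longrightarrow> Lp_dist q \<Omega> f g < \<delta>2 \<Longrightarrow>
      (LINT x:\<Omega>|lebesgue. \<bar>f x - g x\<bar>) < e"
      using Lp_imp_L1_small[OF p1(2) \<Omega>(1) e] by metis
    have "\<bar>H i Y - H i X\<bar> < e" if Y: "Y \<in> C" and d: "Wdist p q \<Omega> X Y < min \<delta>1 \<delta>2" for Y
    proof -
      obtain u g v g2 where XX: "X = ((u, g), (v, g2))" by (metis prod.exhaust)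
      obtain u' g' v' g2' where YY: "Y = ((u', g'), (v', g2'))" by (metis prod.exhaust)
      have L: "Lp_fun p \<Omega> u" "Lp_fun q \<Omega> v" "Lp_fun p \<Omega> u'" "Lp_fun q \<Omega> v'"
        using sub X Y W0_Lp unfolding XX YY by blast+
      have "Lp_dist p \<Omega> u u' < \<delta>1" "Lp_dist q \<Omega> v v' < \<delta>2"
        using d Lp_dist_nonneg[of p \<Omega> u u'] Lp_dist_nonneg[of p \<Omega> g g'] Lp_dist_nonneg[of q \<Omega> v v'] Lp_dist_nonneg[of q \<Omega> g2 g2']
        unfolding XX YY Wdist_def by auto
      then have s: "(LINT x:\<Omega>|lebesgue. \<bar>u x - u' x\<bar>) < e" "(LINT x:\<Omega>|lebesgue. \<bar>v x - v' x\<bar>) < e"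
        using d1(2) d2(2) L by blast+
      show ?thesis
      proof (cases "i < N")
        case True
        have "\<bar>H i X - H i Y\<bar> \<le> (LINT x:\<Omega>|lebesgue. \<bar>u x - u' x\<bar>)"
          using True set_integral_diff_bound[OF L(1) L(3) _ \<Omega>(1) B] p by (simp add: H_def XX YY)
        then show ?thesis using s by (simp add: abs_minus_commute)
      next
        case False
        have "\<bar>H i X - H i Y\<bar> \<le> (LINT x:\<Omega>|lebesgue. \<bar>v x - v' x\<bar>)"
          using False set_integral_diff_bound[OF L(2) L(4) _ \<Omega>(1) B] p by (simp add: H_def XX YY)
        then show ?thesis using s by (simp add: abs_minus_commute)
      qed
    qed
    then show "\<exists>\<delta>>0. \<forall>Y\<in>C. Wdist p q \<Omega> X Y < \<delta> \<longrightarrow> \<bar>H i Y - H i X\<bar> < e"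
      using d1(1) d2(1) by (intro exI[of _ "min \<delta>1 \<delta>2"]) auto
  qed
  have odd: "H i (neg_pt X) = - H i X" for i X
    by (cases X rule: prod.exhaust) (auto simp: H_def neg_pt_def set_lebesgue_integral_def split: prod.splits)
  have "\<not> (\<forall>X\<in>C. \<exists>i<2 * N. H i X \<noteq> 0)"
    using gen k cont odd unfolding genus_ge_def N_def by blast
  then obtain X where X: "X \<in> C" and Z: "\<And>i. i < 2 * N \<Longrightarrow> H i X = 0" by blast
  obtain u g v g2 where XX: "X = ((u, g), (v, g2))" by (metis prod.exhaust)
  have W: "(u, g) \<in> W0 p \<Omega>" "(v, g2) \<in> W0 q \<Omega>" using X sub XX by auto
  have "(LINT x:grid_cell h m \<inter> \<Omega>|lebesgue. u x) = 0 \<and> (LINT x:grid_cell h m \<inter> \<Omega>|lebesgue. v x) = 0" if mI: "m \<in> ?I" for m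
  proof -
    have "m \<in> c ` {0..<N}" using c mI by (simp add: bij_betw_def)
    then obtain i where "i < N" "m = c i" by auto
    then show ?thesis using Z[of i] Z[of "N + i"] by (simp add: H_def B_def XX)
  qed
  note avg = this
  define P where "P = (LINT x:\<Omega>|lebesgue. norm (g x) powr p)"
  define Q where "Q = (LINT x:\<Omega>|lebesgue. norm (g2 x) powr q)"
  define Kp where "Kp s = 8 powr s * (real CARD('n) powr s * 2 ^ CARD('n))" for s
  have pu: "(LINT x:\<Omega>|lebesgue. \<bar>u x\<bar> powr p) \<le> Kp p * h powr p * P"
    unfolding P_def Kp_def by (rule W0_poincare[OF p(1) W(1) op bd h]) (use avg in auto)
  have pv: "(LINT x:\<Omega>|lebesgue. \<bar>v x\<bar> powr q) \<le> Kp q * h powr q * Q"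
    unfolding Q_def Kp_def by (rule W0_poincare[OF p(2) W(2) op bd h]) (use avg in auto)
  have PQ: "P \<ge> 0" "Q \<ge> 0" unfolding P_def Q_def by (auto intro: set_integral_nonneg')
  have Kp: "Kp s > 0" for s by (simp add: Kp_def)
  define D where "D = denom \<alpha> \<beta> \<Omega> X"
  have D0: "D > 0" using dpos X by (simp add: D_def)
  have iu: "set_integrable lebesgue \<Omega> (\<lambda>x. \<bar>u x\<bar> powr p)" "set_integrable lebesgue \<Omega> (\<lambda>x. \<bar>v x\<bar> powr q)"
    using W0_Lp[OF W(1)] W0_Lp[OF W(2)] by (auto simp: Lp_fun_def)
  have iY: "set_integrable lebesgue \<Omega> (\<lambda>x. h powr (\<alpha> + \<beta>) * (\<bar>u x\<bar> powr p / h powr p + \<bar>v x\<bar> powr q / h powr q))"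
    by (intro set_integrable_mult_right set_integral_add set_integrable_divide iu)
  have "D \<le> (LINT x:\<Omega>|lebesgue. h powr (\<alpha> + \<beta>) * (\<bar>u x\<bar> powr p / h powr p + \<bar>v x\<bar> powr q / h powr q))"
    unfolding D_def denom_def XX set_lebesgue_integral_def prod.case
    using iY denom_young[OF ab, of h] p h
    by (intro integral_mono') (auto simp: set_integrable_def split: split_indicator)
  also have "\<dots> = h powr (\<alpha> + \<beta>) * ((LINT x:\<Omega>|lebesgue. \<bar>u x\<bar> powr p) / h powr p + (LINT x:\<Omega>|lebesgue. \<bar>v x\<bar> powr q) / h powr q)"
    by (simp add: set_integral_add(2) set_integrable_divide iu)
  also have "\<dots> \<le> h powr (\<alpha> + \<beta>) * (Kp p * P + Kp q * Q)"
    using pu pv h by (intro mult_left_mono add_mono) (auto simp: field_simps)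
  \<comment> \<open>The factors p and q in M undo the weights 1/p and 1/q of the numerator; the
    cross terms in the product are nonnegative and dropped.\<close>
  also have "\<dots> \<le> h powr (\<alpha> + \<beta>) * (M * ((1/p) * P + (1/q) * Q))"
  proof (rule mult_left_mono)
    have "M * ((1/p) * P + (1/q) * Q) = Kp p * P + Kp q * Q + (q * Kp q * P / p + p * Kp p * Q / q)"
      using p unfolding M Kp_def[symmetric] by (simp add: field_simps)
    moreover have "q * Kp q * P / p + p * Kp p * Q / q \<ge> 0"
      using PQ p Kp[of p] Kp[of q] by (intro add_nonneg_nonneg divide_nonneg_nonneg mult_nonneg_nonneg) auto
    ultimately show "Kp p * P + Kp q * Q \<le> M * ((1/p) * P + (1/q) * Q)" by linarith
  qed simp
  finally have le: "D \<le> h powr (\<alpha> + \<beta>) * (M * ((1/p) * P + (1/q) * Q))" .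
  have M0: "M > 0" unfolding M Kp_def[symmetric] using Kp[of p] Kp[of q] p by (simp add: add_pos_pos)
  have hp: "h powr (\<alpha> + \<beta>) > 0" using h by simp
  have "rayleigh p q \<alpha> \<beta> \<Omega> X = ((1/p) * P + (1/q) * Q) / D"
    by (simp add: rayleigh_def D_def XX P_def Q_def)
  moreover have "1 / (M * h powr (\<alpha> + \<beta>)) \<le> ((1/p) * P + (1/q) * Q) / D"
    using le D0 M0 hp by (simp add: field_simps)
  ultimately show ?thesis using X by (intro bexI[of _ X]) simp_all
qed

section \<open>Boundedness of the Rayleigh quotient\<close>

lemma denom_integrable:
  assumes "Lp_fun p \<Omega> u" "Lp_fun q \<Omega> v" "0 < \<alpha>" "0 < \<beta>" "\<alpha> / p + \<beta> / q = 1" "0 < p" "0 < q"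
    and \<Omega>: "\<Omega> \<in> sets lebesgue"
  shows "set_integrable lebesgue \<Omega> (\<lambda>x. \<bar>u x\<bar> powr \<alpha> * \<bar>v x\<bar> powr \<beta> :: real)"
proof -
  have [measurable]: "u \<in> borel_measurable lebesgue" "v \<in> borel_measurable lebesgue"
    using assms by (auto simp: Lp_fun_def)
  have "set_integrable lebesgue \<Omega> (\<lambda>x. \<bar>u x\<bar> powr p + \<bar>v x\<bar> powr q)"
    using assms by (intro set_integral_add) (auto simp: Lp_fun_def)
  then show ?thesis
  proof (rule set_integrable_bound)
    show "set_borel_measurable lebesgue \<Omega> (\<lambda>x. \<bar>u x\<bar> powr \<alpha> * \<bar>v x\<bar> powr \<beta>)"
      using \<Omega> unfolding set_borel_measurable_def by (intro borel_measurable_scaleR) auto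
    show "AE x in lebesgue. x \<in> \<Omega> \<longrightarrow> norm (\<bar>u x\<bar> powr \<alpha> * \<bar>v x\<bar> powr \<beta>) \<le> norm (\<bar>u x\<bar> powr p + \<bar>v x\<bar> powr q)"
      using denom_young[OF assms(3-7), of 1] by (auto simp: abs_mult)
  qed
qed

lemma powr_tendsto_0_imp:
  fixes a :: "nat \<Rightarrow> real"
  assumes "(\<lambda>n. \<bar>a n - l\<bar> powr s) \<longlonglongrightarrow> 0" "0 < s"
  shows "a \<longlonglongrightarrow> l"
proof -
  have "(\<lambda>n. (\<bar>a n - l\<bar> powr s) powr (1 / s)) \<longlonglongrightarrow> 0"
    by (rule tendsto_zero_powrI[OF assms(1) tendsto_const]) (use assms in auto)
  then have "(\<lambda>n. \<bar>a n - l\<bar>) \<longlonglongrightarrow> 0" using assms by (simp add: powr_powr)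
  then have "(\<lambda>n. a n - l) \<longlonglongrightarrow> 0" by (simp add: tendsto_rabs_zero_iff)
  then show ?thesis by (simp add: LIM_zero_iff)
qed

text \<open>Serves to exclude denominators tending to 0 along a convergent sequence of an admissible
  set. A subsequence converges almost everywhere, where the limit integrand is both the limit of the
  integrands and 0.\<close>

lemma denom_vanishing_limit:
  fixes \<Omega> :: "(real^'n) set"
  assumes pq: "1 < p" "1 < q" and ab: "0 < \<alpha>" "0 < \<beta>" "\<alpha> / p + \<beta> / q = 1" and \<Omega>: "\<Omega> \<in> sets lebesgue"
    and Ln: "\<And>n. Lp_fun p \<Omega> (u n)" "\<And>n. Lp_fun q \<Omega> (v n)" and L: "Lp_fun p \<Omega> u0" "Lp_fun q \<Omega> v0"
    and lim: "(\<lambda>n. Lp_dist p \<Omega> (u n) u0) \<longlonglongrightarrow> 0" "(\<lambda>n. Lp_dist q \<Omega> (v n) v0) \<longlonglongrightarrow> 0"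
    and D: "(\<lambda>n. LINT x:\<Omega>|lebesgue. \<bar>u n x\<bar> powr \<alpha> * \<bar>v n x\<bar> powr \<beta>) \<longlonglongrightarrow> 0"
  shows "(LINT x:\<Omega>|lebesgue. \<bar>u0 x\<bar> powr \<alpha> * \<bar>v0 x\<bar> powr \<beta> :: real) = 0"
proof -
  have pq0: "0 < p" "0 < q" using pq by auto
  \<comment> \<open>The three integrands are added so that a single subsequence serves all of them;
    each is dominated by w because all are nonnegative.\<close>
  define w where "w n x = (\<bar>u n x - u0 x\<bar> powr p + \<bar>v n x - v0 x\<bar> powr q) + \<bar>u n x\<bar> powr \<alpha> * \<bar>v n x\<bar> powr \<beta>" for n x
  have i1: "set_integrable lebesgue \<Omega> (\<lambda>x. \<bar>u n x - u0 x\<bar> powr p)"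
    and i2: "set_integrable lebesgue \<Omega> (\<lambda>x. \<bar>v n x - v0 x\<bar> powr q)" for n
    using Lp_fun_diff[OF Ln(1)[of n] L(1) pq0(1) \<Omega>] Lp_fun_diff[OF Ln(2)[of n] L(2) pq0(2) \<Omega>] by (auto simp: Lp_fun_def)
  have i3: "set_integrable lebesgue \<Omega> (\<lambda>x. \<bar>u n x\<bar> powr \<alpha> * \<bar>v n x\<bar> powr \<beta>)" for n
    by (rule denom_integrable[OF Ln ab pq0 \<Omega>])
  have iw: "set_integrable lebesgue \<Omega> (w n)" for n
    unfolding w_def[abs_def] by (intro set_integral_add i1 i2 i3)
  have w0: "w n x \<ge> 0" for n x by (simp add: w_def)
  have "(LINT x:\<Omega>|lebesgue. w n x) = (LINT x:\<Omega>|lebesgue. norm (u n x - u0 x) powr p) + (LINT x:\<Omega>|lebesgue. norm (v n x - v0 x) powr q)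
     + (LINT x:\<Omega>|lebesgue. \<bar>u n x\<bar> powr \<alpha> * \<bar>v n x\<bar> powr \<beta>)" for n
    unfolding w_def using i1[of n] i2[of n] i3[of n] by (simp add: set_integral_add)
  moreover have "(\<lambda>n. (LINT x:\<Omega>|lebesgue. norm (u n x - u0 x) powr p) + (LINT x:\<Omega>|lebesgue. norm (v n x - v0 x) powr q)
     + (LINT x:\<Omega>|lebesgue. \<bar>u n x\<bar> powr \<alpha> * \<bar>v n x\<bar> powr \<beta>)) \<longlonglongrightarrow> 0 + 0 + 0"
    by (intro tendsto_add Lp_dist_tendsto_0 lim pq0 D)
  ultimately have "(\<lambda>n. LINT x:\<Omega>|lebesgue. w n x) \<longlonglongrightarrow> 0" by simp
  moreover have "(LINT x:\<Omega>|lebesgue. w n x) = (LINT x|lebesgue. norm (indicator \<Omega> x *\<^sub>R w n x))" for n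
    unfolding set_lebesgue_integral_def using w0 by (intro Bochner_Integration.integral_cong) auto
  ultimately have "(\<lambda>n. LINT x|lebesgue. norm (indicator \<Omega> x *\<^sub>R w n x)) \<longlonglongrightarrow> 0" by simp
  then obtain r where ae: "AE x in lebesgue. (\<lambda>n. indicator \<Omega> x *\<^sub>R w (r n) x) \<longlonglongrightarrow> 0"
    using tendsto_L1_AE_subseq[of lebesgue "\<lambda>n x. indicator \<Omega> x *\<^sub>R w n x"] iw unfolding set_integrable_def by blast
  have "AE x in lebesgue. indicator \<Omega> x *\<^sub>R (\<bar>u0 x\<bar> powr \<alpha> * \<bar>v0 x\<bar> powr \<beta>) = 0"
    using ae
  proof (rule AE_mp, intro AE_I2 impI)
    fix x assume lim: "(\<lambda>n. indicator \<Omega> x *\<^sub>R w (r n) x) \<longlonglongrightarrow> 0"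
    show "indicator \<Omega> x *\<^sub>R (\<bar>u0 x\<bar> powr \<alpha> * \<bar>v0 x\<bar> powr \<beta>) = 0"
    proof (cases "x \<in> \<Omega>")
      case True
      then have w: "(\<lambda>n. w (r n) x) \<longlonglongrightarrow> 0" using lim by simp
      have "(\<lambda>n. \<bar>u (r n) x - u0 x\<bar> powr p) \<longlonglongrightarrow> 0"
        by (rule tendsto_sandwich[OF _ _ tendsto_const w]) (auto simp: w_def)
      then have u: "(\<lambda>n. u (r n) x) \<longlonglongrightarrow> u0 x" by (rule powr_tendsto_0_imp[OF _ pq0(1)])
      have "(\<lambda>n. \<bar>v (r n) x - v0 x\<bar> powr q) \<longlonglongrightarrow> 0"
        by (rule tendsto_sandwich[OF _ _ tendsto_const w]) (auto simp: w_def)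
      then have v: "(\<lambda>n. v (r n) x) \<longlonglongrightarrow> v0 x" by (rule powr_tendsto_0_imp[OF _ pq0(2)])
      have "(\<lambda>n. \<bar>u (r n) x\<bar> powr \<alpha> * \<bar>v (r n) x\<bar> powr \<beta>) \<longlonglongrightarrow> 0"
        by (rule tendsto_sandwich[OF _ _ tendsto_const w]) (auto simp: w_def)
      moreover have "(\<lambda>n. \<bar>u (r n) x\<bar> powr \<alpha> * \<bar>v (r n) x\<bar> powr \<beta>) \<longlonglongrightarrow> \<bar>u0 x\<bar> powr \<alpha> * \<bar>v0 x\<bar> powr \<beta>"
        using ab by (intro tendsto_mult tendsto_powr' tendsto_rabs u v tendsto_const) auto
      ultimately have "\<bar>u0 x\<bar> powr \<alpha> * \<bar>v0 x\<bar> powr \<beta> = 0" using LIMSEQ_unique by blast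
      then show ?thesis by simp
    qed simp
  qed
  then show ?thesis unfolding set_lebesgue_integral_def by (rule integral_eq_zero_AE)
qed

text \<open>Without this bound \<open>Sup\<close> in \<open>var_eig\<close> would be an unspecified real number.\<close>

lemma rayleigh_bdd_above:
  fixes \<Omega> :: "(real^'n) set"
  assumes pq: "1 < p" "1 < q" and ab: "0 < \<alpha>" "0 < \<beta>" "\<alpha> / p + \<beta> / q = 1"
    and \<Omega>: "\<Omega> \<in> sets lebesgue" and adm: "admissible p q \<alpha> \<beta> \<Omega> k C"
  shows "bdd_above (rayleigh p q \<alpha> \<beta> \<Omega> ` C)"
proof (rule ccontr)
  assume nb: "\<not> bdd_above (rayleigh p q \<alpha> \<beta> \<Omega> ` C)"
  have pq0: "0 < p" "0 < q" using pq by auto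
  have sub: "C \<subseteq> W0 p \<Omega> \<times> W0 q \<Omega>" and dpos: "\<And>X. X \<in> C \<Longrightarrow> denom \<alpha> \<beta> \<Omega> X > 0"
    and comp: "d_compact (Wdist p q \<Omega>) C"
    using adm unfolding admissible_def by blast+
  \<comment> \<open>Unbounded quotients give a sequence with a limit in C along a subsequence. The
    numerators stay bounded by convergence, so the denominators tend to 0, and then the denominator
    of the limit is 0, although it is positive on C.\<close>
  have "\<exists>X\<in>C. real n < rayleigh p q \<alpha> \<beta> \<Omega> X" for n
    using nb bdd_aboveI2[of C "rayleigh p q \<alpha> \<beta> \<Omega>" "real n"] by (meson not_le)
  then obtain S where S: "\<And>n. S n \<in> C" "\<And>n. real n < rayleigh p q \<alpha> \<beta> \<Omega> (S n)" by metis
  obtain r X where r: "strict_mono r" and X: "X \<in> C" and lim: "(\<lambda>n. Wdist p q \<Omega> (S (r n)) X) \<longlonglongrightarrow> 0"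
    using comp S(1) unfolding d_compact_def by metis
  define u g v g2 where "u n = fst (fst (S (r n)))" "g n = snd (fst (S (r n)))" "v n = fst (snd (S (r n)))" "g2 n = snd (snd (S (r n)))" for n
  note defs = this
  obtain u0 g0 v0 g20 where XX: "X = ((u0, g0), (v0, g20))" by (metis prod.exhaust)
  have Sr: "S (r n) = ((u n, g n), (v n, g2 n))" for n by (simp add: defs)
  have L0: "Lp_fun p \<Omega> u0" "Lp_fun p \<Omega> g0" "Lp_fun q \<Omega> v0" "Lp_fun q \<Omega> g20"
    using sub X W0_Lp unfolding XX by blast+
  have Ln: "Lp_fun p \<Omega> (u n)" "Lp_fun p \<Omega> (g n)" "Lp_fun q \<Omega> (v n)" "Lp_fun q \<Omega> (g2 n)" for n
    using sub S(1)[of "r n"] W0_Lp unfolding Sr by blast+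
  have W: "Wdist p q \<Omega> (S (r n)) X = Lp_dist p \<Omega> (u n) u0 + Lp_dist p \<Omega> (g n) g0 + Lp_dist q \<Omega> (v n) v0 + Lp_dist q \<Omega> (g2 n) g20" for n
    by (simp add: Sr XX Wdist_def)
  have lims: "(\<lambda>n. Lp_dist p \<Omega> (u n) u0) \<longlonglongrightarrow> 0" "(\<lambda>n. Lp_dist p \<Omega> (g n) g0) \<longlonglongrightarrow> 0"
     "(\<lambda>n. Lp_dist q \<Omega> (v n) v0) \<longlonglongrightarrow> 0" "(\<lambda>n. Lp_dist q \<Omega> (g2 n) g20) \<longlonglongrightarrow> 0"
    by (rule tendsto_sandwich[OF _ _ tendsto_const lim]; simp add: W Lp_dist_nonneg)+
  define P where "P n = (LINT x:\<Omega>|lebesgue. norm (g n x) powr p)" for n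
  define Q where "Q n = (LINT x:\<Omega>|lebesgue. norm (g2 n x) powr q)" for n
  define D where "D n = denom \<alpha> \<beta> \<Omega> (S (r n))" for n
  have bounded: "\<exists>B. \<forall>n. (LINT x:\<Omega>|lebesgue. norm (f n x) powr s) \<le> B"
    if s: "0 < s" and f: "\<And>n. Lp_fun s \<Omega> (f n)" "Lp_fun s \<Omega> f0" "(\<lambda>n. Lp_dist s \<Omega> (f n) f0) \<longlonglongrightarrow> 0" 
    for s and f :: "nat \<Rightarrow> real^'n \<Rightarrow> real^'n" and f0
  proof -
    define a where "a n = (LINT x:\<Omega>|lebesgue. norm (f n x - f0 x) powr s)" for n
    have "a \<longlonglongrightarrow> 0" unfolding a_def by (rule Lp_dist_tendsto_0[OF s f(3)])
    then have "Bseq a" by (rule convergent_imp_Bseq[OF convergentI])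
    then obtain K where K: "\<And>n. norm (a n) \<le> K" unfolding Bseq_def by blast
    have "(LINT x:\<Omega>|lebesgue. norm (f n x) powr s) \<le> 2 powr s * ((LINT x:\<Omega>|lebesgue. norm (f0 x) powr s) + K)" for n
    proof -
      have "(LINT x:\<Omega>|lebesgue. norm (f n x) powr s) \<le> 2 powr s * ((LINT x:\<Omega>|lebesgue. norm (f0 x) powr s) + a n)"
        unfolding a_def by (rule Lp_norm_split[OF f(1) f(2) s \<Omega>])
      also have "\<dots> \<le> 2 powr s * ((LINT x:\<Omega>|lebesgue. norm (f0 x) powr s) + K)"
        using K[of n] by (intro mult_left_mono add_left_mono) auto
      finally show ?thesis .
    qed
    then show ?thesis by blast
  qed
  obtain BP where BP: "\<And>n. P n \<le> BP" using bounded[OF pq0(1) Ln(2) L0(2) lims(2)] unfolding P_def by blast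
  obtain BQ where BQ: "\<And>n. Q n \<le> BQ" using bounded[OF pq0(2) Ln(4) L0(4) lims(4)] unfolding Q_def by blast
  define B where "B = (1/p) * BP + (1/q) * BQ"
  have Dpos: "D n > 0" for n unfolding D_def by (rule dpos[OF S(1)])
  have DB: "real n * D n \<le> B" for n
  proof -
    have "real n \<le> real (r n)" using seq_suble[OF r, of n] by simp
    also have "\<dots> < ((1/p) * P n + (1/q) * Q n) / D n"
      using S(2)[of "r n"] by (simp add: rayleigh_def Sr P_def Q_def D_def)
    finally have "real n * D n \<le> (1/p) * P n + (1/q) * Q n"
      using Dpos[of n] by (simp add: pos_less_divide_eq)
    also have "\<dots> \<le> B" unfolding B_def using BP[of n] BQ[of n] pq0 by (intro add_mono mult_left_mono) auto
    finally show ?thesis .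
  qed
  have "D \<longlonglongrightarrow> 0"
  proof (rule tendsto_sandwich[OF _ _ tendsto_const])
    show "(\<lambda>n. B / real n) \<longlonglongrightarrow> 0" by (rule lim_const_over_n)
    show "\<forall>\<^sub>F n in sequentially. 0 \<le> D n" using Dpos less_imp_le by (intro always_eventually) blast
    show "\<forall>\<^sub>F n in sequentially. D n \<le> B / real n"
      using eventually_gt_at_top[of 0] by eventually_elim (use DB in \<open>simp add: field_simps\<close>)
  qed
  then have "(LINT x:\<Omega>|lebesgue. \<bar>u0 x\<bar> powr \<alpha> * \<bar>v0 x\<bar> powr \<beta>) = 0"
    by (intro denom_vanishing_limit[OF pq ab \<Omega> Ln(1) Ln(3) L0(1) L0(3) lims(1) lims(3)]) (simp add: D_def[abs_def] denom_def Sr)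
  then show False using dpos[OF X] by (simp add: XX denom_def)
qed

section \<open>Test sets of large genus\<close>

text \<open>This is sgn(t) |t|^a; written with positive and negative parts its continuity is
  visible.\<close>

definition sgn_powr :: "real \<Rightarrow> real \<Rightarrow> real" where
  "sgn_powr a t = max t 0 powr a - max (- t) 0 powr a"

lemma sgn_powr_minus [simp]: "sgn_powr a (- t) = - sgn_powr a t"
  by (simp add: sgn_powr_def)

lemma abs_sgn_powr: "0 < a \<Longrightarrow> \<bar>sgn_powr a t\<bar> = \<bar>t\<bar> powr a"
  by (cases "t \<ge> 0") (auto simp: sgn_powr_def max_def)

lemma continuous_sgn_powr: "0 < a \<Longrightarrow> continuous_on UNIV (sgn_powr a)"
  unfolding sgn_powr_def[abs_def] by (intro continuous_intros continuous_on_powr') auto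

lemma Lp_dist_le:
  assumes "0 < s" "\<Omega> \<in> lmeasurable" "\<And>x. norm (f x - g x) \<le> K"
  shows "Lp_dist s \<Omega> f g \<le> K * measure lebesgue \<Omega> powr (1 / s)"
proof -
  have K: "0 \<le> K" using assms(3) norm_ge_zero order_trans by blast
  have "(LINT x:\<Omega>|lebesgue. norm (f x - g x) powr s) \<le> (LINT x:\<Omega>|lebesgue. K powr s)"
    unfolding set_lebesgue_integral_def
  proof (rule integral_mono')
    show "integrable lebesgue (\<lambda>x. indicator \<Omega> x *\<^sub>R K powr s)"
      using assms(2) by (auto simp: fmeasurable_def intro!: integrable_scaleR_left integrable_real_indicator)
    show "indicator \<Omega> x *\<^sub>R norm (f x - g x) powr s \<le> indicator \<Omega> x *\<^sub>R K powr s" for x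
      using assms by (auto intro: powr_mono2 split: split_indicator)
  qed auto
  also have "\<dots> = K powr s * measure lebesgue \<Omega>"
    using assms(2) by (simp add: set_lebesgue_integral_def fmeasurable_def)
  finally have "Lp_dist s \<Omega> f g \<le> (K powr s * measure lebesgue \<Omega>) powr (1 / s)"
    unfolding Lp_dist_def using assms(1) by (intro powr_mono2 set_integral_nonneg') auto
  also have "\<dots> = K * measure lebesgue \<Omega> powr (1 / s)"
    using assms(1) K by (simp add: powr_mult powr_powr)
  finally show ?thesis .
qed

lemma Lp_dist_self [simp]: "0 < s \<Longrightarrow> Lp_dist s \<Omega> f f = 0"
  by (simp add: Lp_dist_def)

text \<open>The index n is the last one, so there are n + 1 cells, matching
  \<open>l1_sphere n\<close> in R^(n+1) and the genus \<open>Suc n\<close>. Closures of the cells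
  inside the domain make the supports compact in it.\<close>

locale bump_family =
  fixes \<Omega> :: "(real^'n) set" and h :: real and z :: "nat \<Rightarrow> int^'n" and n :: nat
  assumes op: "open \<Omega>" and bd: "bounded \<Omega>" and h: "0 < h" and inj: "inj_on z {..n}"
    and cl: "\<And>i. i \<le> n \<Longrightarrow> closure (grid_cell h (z i)) \<subseteq> \<Omega>"
begin

definition corner :: "nat \<Rightarrow> real^'n" where "corner i = (\<chi> j. h * real_of_int (z i $ j))"

definition \<phi> :: "nat \<Rightarrow> real^'n \<Rightarrow> real" where "\<phi> i = bump (corner i) h"

text \<open>The factor h compensates the gradient of a bump, of order 1/h, so \<open>V\<close> is
  bounded independently of h. The exponent 1/s turns |U|^s into a multiple of |w_i| on the i-th
  cell.\<close>

definition U :: "real \<Rightarrow> (nat \<Rightarrow> real) \<Rightarrow> real^'n \<Rightarrow> real" where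
  "U s w x = (\<Sum>i\<le>n. (h * sgn_powr (1 / s) (w i)) * \<phi> i x)"

definition V :: "real \<Rightarrow> (nat \<Rightarrow> real) \<Rightarrow> real^'n \<Rightarrow> real^'n" where
  "V s w x = (\<Sum>i\<le>n. (h * sgn_powr (1 / s) (w i)) *\<^sub>R grad (\<phi> i) x)"

text \<open>The same w is used in both components: in the denominator its powers then combine to
  |w_i|^(\<alpha>/p + \<beta>/q) = |w_i|.\<close>

definition \<Psi> :: "real \<Rightarrow> real \<Rightarrow> (nat \<Rightarrow> real) \<Rightarrow> 'n sob \<times> 'n sob" where
  "\<Psi> p q w = ((U p w, V p w), (U q w, V q w))"

lemma grid_cell_corner: "grid_cell h (z i) = cell (corner i) h"
  by (simp add: grid_cell_def corner_def)

lemma \<Omega>_meas: "\<Omega> \<in> lmeasurable" "\<Omega> \<in> sets lebesgue"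
  using op bd by (auto simp: lmeasurable_open)

lemma cell_unique: "i \<le> n \<Longrightarrow> j \<le> n \<Longrightarrow> x \<in> cell (corner i) h \<Longrightarrow> x \<in> cell (corner j) h \<Longrightarrow> i = j"
  using grid_cell_iff[OF h, of x] inj unfolding grid_cell_corner[symmetric] by (auto simp: inj_on_def)

lemma sum_single:
  fixes F :: "nat \<Rightarrow> 'b::comm_monoid_add"
  assumes "i \<le> n" "x \<in> cell (corner i) h" "\<And>j. x \<notin> cell (corner j) h \<Longrightarrow> F j = 0"
  shows "(\<Sum>j\<le>n. F j) = F i"
proof -
  have "(\<Sum>j\<le>n. F j) = (\<Sum>j\<in>{i}. F j)"
    using assms cell_unique by (intro sum.mono_neutral_right) auto
  then show ?thesis by simp
qed

lemma \<phi>_zero: "x \<notin> cell (corner j) h \<Longrightarrow> \<phi> j x = 0" "x \<notin> cell (corner j) h \<Longrightarrow> grad (\<phi> j) x = 0"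
  unfolding \<phi>_def using bump_support[OF h] grad_bump_support[OF h] by blast+

lemma U_single: "i \<le> n \<Longrightarrow> x \<in> cell (corner i) h \<Longrightarrow> U s w x = (h * sgn_powr (1 / s) (w i)) * \<phi> i x"
  unfolding U_def by (rule sum_single) (auto simp: \<phi>_zero)

lemma V_single: "i \<le> n \<Longrightarrow> x \<in> cell (corner i) h \<Longrightarrow> V s w x = (h * sgn_powr (1 / s) (w i)) *\<^sub>R grad (\<phi> i) x"
  unfolding V_def by (rule sum_single) (auto simp: \<phi>_zero)

lemma UV_outside: assumes "\<And>i. i \<le> n \<Longrightarrow> x \<notin> cell (corner i) h" shows "U s w x = 0" "V s w x = 0"
  unfolding U_def V_def using assms by (auto intro!: sum.neutral simp: \<phi>_zero)

lemma U_test: "test_fun \<Omega> (U s w)"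
proof -
  have "expinv_alg (U s w)"
    unfolding U_def[abs_def] \<phi>_def by (intro expinv_alg_sum expinv_alg.mult expinv_alg.const bump_alg)
  then have 1: "smooth_on (U s w) UNIV" by (rule expinv_alg_smooth)
  have "{x. U s w x \<noteq> 0} \<subseteq> (\<Union>i\<le>n. closure (grid_cell h (z i)))"
  proof
    fix x assume "x \<in> {x. U s w x \<noteq> 0}"
    then obtain i where "i \<le> n" "x \<in> grid_cell h (z i)"
      using UV_outside(1)[of x s w] unfolding grid_cell_corner by auto
    then show "x \<in> (\<Union>i\<le>n. closure (grid_cell h (z i)))"
      using closure_subset[of "grid_cell h (z i)"] by auto
  qed
  then have "closure {x. U s w x \<noteq> 0} \<subseteq> (\<Union>i\<le>n. closure (grid_cell h (z i)))"
    by (rule closure_minimal) auto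
  also have "\<dots> \<subseteq> \<Omega>" using cl by auto
  finally have 2: "closure {x. U s w x \<noteq> 0} \<subseteq> \<Omega>" .
  then have "bounded (closure {x. U s w x \<noteq> 0})" using bd bounded_subset by blast
  then show ?thesis using 1 2 by (simp add: test_fun_def compact_eq_bounded_closed)
qed

lemma grad_U: "grad (U s w) = V s w"
proof
  fix x
  have "(U s w has_derivative (\<lambda>v. \<Sum>i\<le>n. (h * sgn_powr (1 / s) (w i)) * (grad (\<phi> i) x \<bullet> v))) (at x)"
    unfolding U_def[abs_def] \<phi>_def
    by (intro has_derivative_sum has_derivative_mult_right grad_has_derivative bump_differentiable)
  also have "(\<lambda>v. \<Sum>i\<le>n. (h * sgn_powr (1 / s) (w i)) * (grad (\<phi> i) x \<bullet> v)) = (\<lambda>v. V s w x \<bullet> v)"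
    by (simp add: V_def inner_sum_left)
  finally show "grad (U s w) x = V s w x" by (rule has_derivative_imp_grad)
qed

lemma UV_Lp: assumes "0 < s" shows "Lp_fun s \<Omega> (U s w)" "Lp_fun s \<Omega> (V s w)"
  using test_fun_Lp[OF U_test bd op assms] by (auto simp: grad_U)

lemma UV_W0: assumes "0 < s" shows "(U s w, V s w) \<in> W0 s \<Omega>"
  unfolding W0_def using UV_Lp[OF assms, of w] U_test grad_U assms
  by (auto intro!: exI[of _ "\<lambda>_. U s w"])

lemma \<Psi>_minus: "\<Psi> p q (- w) = neg_pt (\<Psi> p q w)"
  by (simp add: \<Psi>_def neg_pt_def U_def[abs_def] V_def[abs_def] sum_negf fun_eq_iff)

text \<open>A crude Lipschitz bound in the coefficients, with K depending on h and the domain; it is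
  used only for the continuity of \<open>\<Psi>\<close>, so it does not affect the final
  constants.\<close>

lemma Wdist_bound:
  assumes pq: "0 < p" "0 < q"
  obtains K where "\<And>w w'. Wdist p q \<Omega> (\<Psi> p q w) (\<Psi> p q w') \<le>
     K * (\<Sum>i\<le>n. \<bar>sgn_powr (1 / p) (w i) - sgn_powr (1 / p) (w' i)\<bar> + \<bar>sgn_powr (1 / q) (w i) - sgn_powr (1 / q) (w' i)\<bar>)"
proof -
  obtain L where L: "L > 0" "\<And>c x. norm (grad (bump c h) (x::real^'n)) \<le> L / h"
    using grad_bump_bound h by blast
  define T where "T s w w' = (\<Sum>i\<le>n. \<bar>sgn_powr (1 / s) (w i) - sgn_powr (1 / s) (w' i)\<bar>)" for s w w'
  have T0: "T s w w' \<ge> 0" for s w w' unfolding T_def by (intro sum_nonneg) auto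
  define m where "m s = measure lebesgue \<Omega> powr (1 / s)" for s
  have m0: "m s \<ge> 0" for s by (simp add: m_def)
  have u: "norm (U s w x - U s w' x) \<le> h * T s w w'" for s w w' x
  proof -
    have "U s w x - U s w' x = (\<Sum>i\<le>n. (h * (sgn_powr (1 / s) (w i) - sgn_powr (1 / s) (w' i))) * \<phi> i x)"
      by (simp add: U_def sum_subtractf[symmetric] algebra_simps)
    also have "norm \<dots> \<le> (\<Sum>i\<le>n. h * \<bar>sgn_powr (1 / s) (w i) - sgn_powr (1 / s) (w' i)\<bar> * 1)"
    proof (rule sum_norm_le)
      fix i
      have "\<bar>\<phi> i x\<bar> \<le> 1" unfolding \<phi>_def using bump_bounds[of "corner i" h x] by simp
      then show "norm ((h * (sgn_powr (1 / s) (w i) - sgn_powr (1 / s) (w' i))) * \<phi> i x) \<le> h * \<bar>sgn_powr (1 / s) (w i) - sgn_powr (1 / s) (w' i)\<bar> * 1"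
        unfolding real_norm_def abs_mult using h by (intro mult_mono) auto
    qed
    finally show ?thesis by (simp add: T_def sum_distrib_left)
  qed
  have v: "norm (V s w x - V s w' x) \<le> L * T s w w'" for s w w' x
  proof -
    have "V s w x - V s w' x = (\<Sum>i\<le>n. (h * (sgn_powr (1 / s) (w i) - sgn_powr (1 / s) (w' i))) *\<^sub>R grad (\<phi> i) x)"
      by (simp add: V_def sum_subtractf[symmetric] algebra_simps)
    also have "norm \<dots> \<le> (\<Sum>i\<le>n. h * \<bar>sgn_powr (1 / s) (w i) - sgn_powr (1 / s) (w' i)\<bar> * (L / h))"
    proof (rule sum_norm_le)
      fix i
      show "norm ((h * (sgn_powr (1 / s) (w i) - sgn_powr (1 / s) (w' i))) *\<^sub>R grad (\<phi> i) x)
        \<le> h * \<bar>sgn_powr (1 / s) (w i) - sgn_powr (1 / s) (w' i)\<bar> * (L / h)"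
        unfolding norm_scaleR abs_mult \<phi>_def using h L(2)[of "corner i" x] by (intro mult_mono) auto
    qed
    finally show ?thesis using h by (simp add: T_def sum_distrib_left mult.commute)
  qed
  define K where "K = (h + L) * (m p + m q)"
  have "Wdist p q \<Omega> (\<Psi> p q w) (\<Psi> p q w') \<le> K * (T p w w' + T q w w')" for w w'
  proof -
    have "Wdist p q \<Omega> (\<Psi> p q w) (\<Psi> p q w') \<le> h * T p w w' * m p + L * T p w w' * m p + h * T q w w' * m q + L * T q w w' * m q"
      unfolding Wdist_def \<Psi>_def prod.case m_def using pq
      by (intro add_mono Lp_dist_le \<Omega>_meas u v)
    also have "\<dots> = (h + L) * (m p * T p w w' + m q * T q w w')" by (simp add: algebra_simps)
    also have "\<dots> \<le> (h + L) * ((m p + m q) * (T p w w' + T q w w'))"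
    proof (rule mult_left_mono)
      have "0 \<le> m q * T p w w' + m p * T q w w'" using T0 m0 by (intro add_nonneg_nonneg mult_nonneg_nonneg)
      then show "m p * T p w w' + m q * T q w w' \<le> (m p + m q) * (T p w w' + T q w w')" by (simp add: algebra_simps)
    qed (use h L in auto)
    finally show ?thesis by (simp add: K_def mult.assoc)
  qed
  then show thesis by (intro that[of K]) (simp add: T_def sum.distrib)
qed

text \<open>Both orders of the arguments are recorded because \<open>d_compact\<close> puts the
  limit second and \<open>d_continuous_on\<close> puts the base point first.\<close>

lemma \<Psi>_tendsto:
  assumes pq: "0 < p" "0 < q" and X: "X \<longlonglongrightarrow> x"
  shows "(\<lambda>j. Wdist p q \<Omega> (\<Psi> p q (X j)) (\<Psi> p q x)) \<longlonglongrightarrow> 0"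
    "(\<lambda>j. Wdist p q \<Omega> (\<Psi> p q x) (\<Psi> p q (X j))) \<longlonglongrightarrow> 0"
proof -
  obtain K where K: "\<And>w w'. Wdist p q \<Omega> (\<Psi> p q w) (\<Psi> p q w') \<le>
     K * (\<Sum>i\<le>n. \<bar>sgn_powr (1 / p) (w i) - sgn_powr (1 / p) (w' i)\<bar> + \<bar>sgn_powr (1 / q) (w i) - sgn_powr (1 / q) (w' i)\<bar>)"
    using Wdist_bound[OF pq] by blast
  define B where "B j = K * (\<Sum>i\<le>n. \<bar>sgn_powr (1 / p) (X j i) - sgn_powr (1 / p) (x i)\<bar> + \<bar>sgn_powr (1 / q) (X j i) - sgn_powr (1 / q) (x i)\<bar>)" for j
  have c: "(\<lambda>j. \<bar>sgn_powr (1 / s) (X j i) - sgn_powr (1 / s) (x i)\<bar>) \<longlonglongrightarrow> 0" if "0 < s" for s i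
  proof -
    have "(\<lambda>j. X j i) \<longlonglongrightarrow> x i" using X by (simp add: tendsto_fun_iff)
    moreover have "isCont (sgn_powr (1 / s)) (x i)"
      using continuous_sgn_powr[of "1 / s"] that by (simp add: continuous_on_eq_continuous_at)
    ultimately have "(\<lambda>j. sgn_powr (1 / s) (X j i)) \<longlonglongrightarrow> sgn_powr (1 / s) (x i)"
      by (rule isCont_tendsto_compose[rotated])
    then show ?thesis by (simp add: LIM_zero tendsto_rabs_zero)
  qed
  have "B \<longlonglongrightarrow> K * (\<Sum>i\<le>n. 0 + 0)"
    unfolding B_def by (intro tendsto_intros c pq)
  then have B: "B \<longlonglongrightarrow> 0" by simp
  have W0: "0 \<le> Wdist p q \<Omega> Y Z" for Y Z
    by (auto simp: Wdist_def Lp_dist_nonneg split: prod.splits)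
  show "(\<lambda>j. Wdist p q \<Omega> (\<Psi> p q (X j)) (\<Psi> p q x)) \<longlonglongrightarrow> 0"
    by (rule tendsto_sandwich[OF _ _ tendsto_const B]) (use K W0 in \<open>auto simp: B_def\<close>)
  show "(\<lambda>j. Wdist p q \<Omega> (\<Psi> p q x) (\<Psi> p q (X j))) \<longlonglongrightarrow> 0"
  proof (rule tendsto_sandwich[OF _ _ tendsto_const B])
    have "Wdist p q \<Omega> (\<Psi> p q x) (\<Psi> p q (X j)) \<le> B j" for j
      using K[of x "X j"] unfolding B_def by (simp add: abs_minus_commute)
    then show "\<forall>\<^sub>F j in sequentially. Wdist p q \<Omega> (\<Psi> p q x) (\<Psi> p q (X j)) \<le> B j" by simp
  qed (use W0 in auto)
qed

lemma genus_\<Psi>: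
  assumes pq: "0 < p" "0 < q"
  shows "genus_ge (Wdist p q \<Omega>) neg_pt (\<Psi> p q ` l1_sphere n) (Suc n)"
  unfolding genus_ge_def
proof (intro allI impI notI)
  fix m assume m: "m < Suc n"
  assume "\<exists>f. (\<forall>i<m. d_continuous_on (Wdist p q \<Omega>) (\<Psi> p q ` l1_sphere n) (f i) \<and> (\<forall>X\<in>\<Psi> p q ` l1_sphere n. f i (neg_pt X) = - f i X))
    \<and> (\<forall>X\<in>\<Psi> p q ` l1_sphere n. \<exists>i<m. f i X \<noteq> (0::real))"
  then obtain f where f1: "\<forall>i<m. d_continuous_on (Wdist p q \<Omega>) (\<Psi> p q ` l1_sphere n) (f i) \<and> (\<forall>X\<in>\<Psi> p q ` l1_sphere n. f i (neg_pt X) = - f i X)"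
    and f2: "\<forall>X\<in>\<Psi> p q ` l1_sphere n. \<exists>i<m. f i X \<noteq> (0::real)"
    by (elim exE conjE) (rule that)
  have fc: "d_continuous_on (Wdist p q \<Omega>) (\<Psi> p q ` l1_sphere n) (f i)" if "i < m" for i
    using f1 that by simp
  have fo: "f i (neg_pt (\<Psi> p q w)) = - f i (\<Psi> p q w)" if "i < m" "w \<in> l1_sphere n" for i w
    using f1 that by simp
  have fn: "\<exists>i<m. f i (\<Psi> p q w) \<noteq> 0" if "w \<in> l1_sphere n" for w
    using f2 that by simp
  \<comment> \<open>Borsuk-Ulam asks for exactly n odd functions, while m may be smaller; the
    missing ones are filled with the odd coordinate w 0.\<close>
  define F where "F i w = (if i < m then f i (\<Psi> p q w) else w 0)" for i w
  have "\<exists>w\<in>l1_sphere n. \<forall>i<n. F i w = 0"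
  proof (rule Borsuk_Ulam_l1_sphere[of n F])
    show "F i (- x) = - F i x" if "x \<in> l1_sphere n" for i x
      using that by (simp add: F_def \<Psi>_minus fo)
    show "continuous_on (l1_sphere n) (F i)" for i
    proof (cases "i < m")
      case True
      show ?thesis unfolding continuous_on_sequentially
      proof (intro allI ballI impI)
        fix X x assume x: "x \<in> l1_sphere n" and "(\<forall>j. X j \<in> l1_sphere n) \<and> X \<longlonglongrightarrow> x"
        then have X: "\<And>j. X j \<in> l1_sphere n" "X \<longlonglongrightarrow> x" by auto
        show "(F i \<circ> X) \<longlonglongrightarrow> F i x"
        proof (rule LIMSEQ_I)
          fix e :: real assume "e > 0"
          then obtain \<delta> where \<delta>: "\<delta> > 0" "\<And>w. w \<in> l1_sphere n \<Longrightarrow> Wdist p q \<Omega> (\<Psi> p q x) (\<Psi> p q w) < \<delta> \<Longrightarrow> \<bar>f i (\<Psi> p q w) - f i (\<Psi> p q x)\<bar> < e"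
            using fc[OF True] x unfolding d_continuous_on_def by (metis imageI)
          obtain N where "\<And>j. j \<ge> N \<Longrightarrow> Wdist p q \<Omega> (\<Psi> p q x) (\<Psi> p q (X j)) < \<delta>"
            using order_tendstoD(2)[OF \<Psi>_tendsto(2)[OF pq X(2)] \<delta>(1)] by (auto simp: eventually_sequentially)
          then show "\<exists>N. \<forall>j\<ge>N. norm ((F i \<circ> X) j - F i x) < e"
            using \<delta>(2) X(1) True by (intro exI[of _ N]) (simp add: F_def)
        qed
      qed
    next
      case False
      then have "F i = (\<lambda>w. w 0)" by (auto simp: F_def)
      then show ?thesis by (auto intro: continuous_on_subset[OF continuous_on_product_coordinates])
    qed
  qed (rule bexI; simp)
  then obtain w where w: "w \<in> l1_sphere n" "\<And>i. i < n \<Longrightarrow> F i w = 0" by blast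
  obtain i where "i < m" "f i (\<Psi> p q w) \<noteq> 0" using fn[OF w(1)] by blast
  then show False using w(2)[of i] m by (simp add: F_def)
qed

lemma compact_\<Psi>:
  assumes pq: "0 < p" "0 < q"
  shows "d_compact (Wdist p q \<Omega>) (\<Psi> p q ` l1_sphere n)"
  unfolding d_compact_def
proof (intro allI impI)
  fix S :: "nat \<Rightarrow> 'n sob \<times> 'n sob" assume "\<forall>j. S j \<in> \<Psi> p q ` l1_sphere n"
  then have "\<forall>j. \<exists>w. w \<in> l1_sphere n \<and> S j = \<Psi> p q w" by blast
  then obtain X where X: "\<And>j. X j \<in> l1_sphere n" "\<And>j. S j = \<Psi> p q (X j)" by metis
  have "seq_compact (l1_sphere n)" by (rule compact_imp_seq_compact[OF compact_l1_sphere])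
  then obtain x r where x: "x \<in> l1_sphere n" "strict_mono r" "(X \<circ> r) \<longlonglongrightarrow> x"
    using X(1) unfolding seq_compact_def by metis
  then show "\<exists>r x. strict_mono r \<and> x \<in> \<Psi> p q ` l1_sphere n \<and> (\<lambda>j. Wdist p q \<Omega> (S (r j)) x) \<longlonglongrightarrow> 0"
    using \<Psi>_tendsto(1)[OF pq x(3)] by (intro exI[of _ r] exI[of _ "\<Psi> p q x"]) (auto simp: X(2))
qed

lemma cell_integral:
  "integrable lebesgue (\<lambda>x. k * indicator (cell c t) (x::real^'n))"
  "0 \<le> t \<Longrightarrow> (LINT x|lebesgue. k * indicator (cell c t) (x::real^'n)) = k * t ^ CARD('n)"
proof -
  have i: "integrable lebesgue (indicator (cell c t) :: real^'n \<Rightarrow> real)"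
    using cell_lmeasurable[of c t] by (intro integrable_real_indicator) (auto simp: fmeasurable_def)
  then show "integrable lebesgue (\<lambda>x. k * indicator (cell c t) (x::real^'n))" by simp
  show "0 \<le> t \<Longrightarrow> (LINT x|lebesgue. k * indicator (cell c t) (x::real^'n)) = k * t ^ CARD('n)"
    using cell_measure[of t c] by simp
qed

text \<open>The cells are disjoint, so on the i-th one only one summand survives and contributes at
  most |w_i| L^s. Summing the |w_i| gives 1, so the number of cells does not enter.\<close>

lemma V_integral_le:
  assumes s: "0 < s" and w: "w \<in> l1_sphere n" and L: "\<And>c x. norm (grad (bump c h) (x::real^'n)) \<le> L / h"
  shows "(LINT x:\<Omega>|lebesgue. norm (V s w x) powr s) \<le> L powr s * h ^ CARD('n)"
proof -
  have L0: "L \<ge> 0" using order_trans[OF norm_ge_zero L] h by (simp add: zero_le_divide_iff)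
  have "(LINT x:\<Omega>|lebesgue. norm (V s w x) powr s) \<le> (LINT x|lebesgue. (\<Sum>i\<le>n. (\<bar>w i\<bar> * L powr s) * indicator (cell (corner i) h) x))"
    unfolding set_lebesgue_integral_def
  proof (rule integral_mono')
    show "integrable lebesgue (\<lambda>x. \<Sum>i\<le>n. (\<bar>w i\<bar> * L powr s) * indicator (cell (corner i) h) x)"
      by (intro Bochner_Integration.integrable_sum cell_integral)
    fix x
    show "0 \<le> (\<Sum>i\<le>n. (\<bar>w i\<bar> * L powr s) * indicator (cell (corner i) h) x)" by (intro sum_nonneg) auto
    show "indicator \<Omega> x *\<^sub>R norm (V s w x) powr s \<le> (\<Sum>i\<le>n. (\<bar>w i\<bar> * L powr s) * indicator (cell (corner i) h) x)"
    proof (cases "\<exists>i\<le>n. x \<in> cell (corner i) h")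
      case True
      then obtain i where i: "i \<le> n" "x \<in> cell (corner i) h" by blast
      have "norm (V s w x) = h * \<bar>w i\<bar> powr (1 / s) * norm (grad (\<phi> i) x)"
        using h s by (simp add: V_single[OF i] abs_mult abs_sgn_powr)
      also have "\<dots> \<le> h * \<bar>w i\<bar> powr (1 / s) * (L / h)"
        using h L unfolding \<phi>_def by (intro mult_left_mono) auto
      also have "\<dots> = \<bar>w i\<bar> powr (1 / s) * L" using h by simp
      finally have "norm (V s w x) powr s \<le> (\<bar>w i\<bar> powr (1 / s) * L) powr s"
        using s by (intro powr_mono2) auto
      also have "\<dots> = \<bar>w i\<bar> * L powr s" using s L0 by (simp add: powr_mult powr_powr)
      also have "\<dots> = (\<Sum>i\<le>n. (\<bar>w i\<bar> * L powr s) * indicator (cell (corner i) h) x)"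
        using sum_single[OF i, of "\<lambda>i. (\<bar>w i\<bar> * L powr s) * indicator (cell (corner i) h) x"] i by simp
      finally show ?thesis by (auto split: split_indicator intro: order_trans[rotated] sum_nonneg)
    next
      case False
      then show ?thesis using UV_outside(2)[of x s w] s by (auto intro!: sum_nonneg)
    qed
  qed
  also have "\<dots> = (\<Sum>i\<le>n. (\<bar>w i\<bar> * L powr s) * h ^ CARD('n))"
  proof -
    have "(LINT x|lebesgue. (\<bar>w i\<bar> * L powr s) * indicator (cell (corner i) h) x) = (\<bar>w i\<bar> * L powr s) * h ^ CARD('n)" for i
      using h by (intro cell_integral(2)) simp
    moreover have "integrable lebesgue (\<lambda>x. (\<bar>w i\<bar> * L powr s) * indicator (cell (corner i) h) x)" for i
      by (rule cell_integral(1))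
    ultimately show ?thesis by (simp only: Bochner_Integration.integral_sum)
  qed
  also have "\<dots> = L powr s * h ^ CARD('n)"
    using w by (simp add: sum_distrib_right[symmetric] l1_sphere_def)
  finally show ?thesis .
qed

text \<open>Only the middle part of each cell is kept, where the bump is at least d. There the
  integrand is at least |w_i| h^(\<alpha>+\<beta>) d^(\<alpha>+\<beta>), and the |w_i| again sum to
  1.\<close>

lemma denom_\<Psi>_ge:
  assumes pq: "0 < p" "0 < q" and ab: "0 < \<alpha>" "0 < \<beta>" "\<alpha> / p + \<beta> / q = 1" and w: "w \<in> l1_sphere n"
    and d: "0 < d" "\<And>c x. x \<in> cell (c + (\<chi> i. h / 4)) (h / 2) \<Longrightarrow> d \<le> bump c h (x::real^'n)"
  shows "h powr (\<alpha> + \<beta>) * d powr (\<alpha> + \<beta>) * (h / 2) ^ CARD('n) \<le> denom \<alpha> \<beta> \<Omega> (\<Psi> p q w)"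
proof -
  define mid where "mid i = cell (corner i + (\<chi> i. h / 4)) (h / 2)" for i
  have mid: "mid i \<subseteq> cell (corner i) h" for i
    unfolding mid_def cell_def using h by (auto simp: field_simps) (smt (verit) field_sum_of_halves)+
  define K where "K = h powr (\<alpha> + \<beta>) * d powr (\<alpha> + \<beta>)"
  have K: "K \<ge> 0" by (simp add: K_def)
  have "K * (h / 2) ^ CARD('n) = (\<Sum>i\<le>n. (\<bar>w i\<bar> * K) * (h / 2) ^ CARD('n))"
    using w by (simp add: sum_distrib_right[symmetric] l1_sphere_def)
  also have "\<dots> = (LINT x|lebesgue. (\<Sum>i\<le>n. (\<bar>w i\<bar> * K) * indicator (mid i) x))"
  proof -
    have "(LINT x|lebesgue. (\<bar>w i\<bar> * K) * indicator (mid i) x) = (\<bar>w i\<bar> * K) * (h / 2) ^ CARD('n)" for i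
      unfolding mid_def using h by (intro cell_integral(2)) simp
    moreover have "integrable lebesgue (\<lambda>x. (\<bar>w i\<bar> * K) * indicator (mid i) x)" for i
      unfolding mid_def by (rule cell_integral(1))
    ultimately show ?thesis by (simp only: Bochner_Integration.integral_sum)
  qed
  also have "\<dots> \<le> (LINT x|lebesgue. indicator \<Omega> x *\<^sub>R (\<bar>U p w x\<bar> powr \<alpha> * \<bar>U q w x\<bar> powr \<beta>))"
  proof (rule integral_mono')
    show "integrable lebesgue (\<lambda>x. indicator \<Omega> x *\<^sub>R (\<bar>U p w x\<bar> powr \<alpha> * \<bar>U q w x\<bar> powr \<beta>))"
      using denom_integrable[OF UV_Lp(1)[OF pq(1)] UV_Lp(1)[OF pq(2)] ab pq \<Omega>_meas(2)] by (simp add: set_integrable_def)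
    fix x
    show "0 \<le> indicator \<Omega> x *\<^sub>R (\<bar>U p w x\<bar> powr \<alpha> * \<bar>U q w x\<bar> powr \<beta>)" by simp
    show "(\<Sum>i\<le>n. (\<bar>w i\<bar> * K) * indicator (mid i) x) \<le> indicator \<Omega> x *\<^sub>R (\<bar>U p w x\<bar> powr \<alpha> * \<bar>U q w x\<bar> powr \<beta>)"
    proof (cases "\<exists>i\<le>n. x \<in> mid i")
      case True
      then obtain i where i: "i \<le> n" "x \<in> mid i" by blast
      then have x: "x \<in> cell (corner i) h" using mid by blast
      then have x\<Omega>: "x \<in> \<Omega>" using cl[OF i(1)] closure_subset unfolding grid_cell_corner by blast
      have b: "d \<le> \<phi> i x" using d(2) i unfolding \<phi>_def mid_def by blast
      have "(\<Sum>i\<le>n. (\<bar>w i\<bar> * K) * indicator (mid i) x) = (\<bar>w i\<bar> * K) * indicator (mid i) x"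
        by (rule sum_single[OF i(1) x]) (use mid in \<open>auto split: split_indicator\<close>)
      also have "\<dots> = \<bar>w i\<bar> * (h powr (\<alpha> + \<beta>) * d powr (\<alpha> + \<beta>))" using i by (simp add: K_def)
      also have "\<dots> \<le> \<bar>w i\<bar> * (h powr (\<alpha> + \<beta>) * \<phi> i x powr (\<alpha> + \<beta>))"
        using b d(1) ab by (intro mult_left_mono powr_mono2) auto
      also have "\<dots> = (\<bar>w i\<bar> powr (\<alpha> / p) * \<bar>w i\<bar> powr (\<beta> / q)) * ((h powr \<alpha> * h powr \<beta>) * (\<phi> i x powr \<alpha> * \<phi> i x powr \<beta>))"
        using ab by (simp add: powr_add[symmetric])
      also have "\<dots> = (h * \<bar>w i\<bar> powr (1 / p) * \<phi> i x) powr \<alpha> * (h * \<bar>w i\<bar> powr (1 / q) * \<phi> i x) powr \<beta>"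
        using h b d(1) by (simp add: powr_mult powr_powr)
      also have "\<dots> = \<bar>U p w x\<bar> powr \<alpha> * \<bar>U q w x\<bar> powr \<beta>"
        using h b d(1) pq by (simp add: U_single[OF i(1) x] abs_mult abs_sgn_powr)
      finally show ?thesis using x\<Omega> by simp
    next
      case False
      then have "(\<Sum>i\<le>n. (\<bar>w i\<bar> * K) * indicator (mid i) x) = 0" by (intro sum.neutral) auto
      then show ?thesis by simp
    qed
  qed
  finally show ?thesis by (simp add: K_def \<Psi>_def denom_def set_lebesgue_integral_def)
qed

text \<open>Numerator and denominator are both proportional to h^N, which cancels; the factor 2^N in
  R stems from the half-size cells of the lower bound for the denominator.\<close>

lemma admissible_\<Psi>:
  assumes pq: "1 < p" "1 < q" and ab: "0 < \<alpha>" "0 < \<beta>" "\<alpha> / p + \<beta> / q = 1"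
    and L: "\<And>c x. norm (grad (bump c h) (x::real^'n)) \<le> L / h"
    and d: "0 < d" "\<And>c x. x \<in> cell (c + (\<chi> i. h / 4)) (h / 2) \<Longrightarrow> d \<le> bump c h (x::real^'n)"
  defines "R \<equiv> ((1/p) * L powr p + (1/q) * L powr q) * 2 ^ CARD('n) / d powr (\<alpha> + \<beta>)"
  shows "\<exists>C. admissible p q \<alpha> \<beta> \<Omega> (Suc n) C \<and> Sup (rayleigh p q \<alpha> \<beta> \<Omega> ` C) \<le> R / h powr (\<alpha> + \<beta>)"
proof -
  have pq0: "0 < p" "0 < q" using pq by auto
  let ?C = "\<Psi> p q ` l1_sphere n"
  define E where "E = h powr (\<alpha> + \<beta>) * d powr (\<alpha> + \<beta>) * (h / 2) ^ CARD('n)"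
  have E: "E > 0" using h d(1) by (simp add: E_def)
  have dn: "E \<le> denom \<alpha> \<beta> \<Omega> (\<Psi> p q w)" if "w \<in> l1_sphere n" for w
    unfolding E_def by (rule denom_\<Psi>_ge[OF pq0 ab that d])
  have adm: "admissible p q \<alpha> \<beta> \<Omega> (Suc n) ?C"
    unfolding admissible_def
  proof (intro conjI)
    show "?C \<subseteq> W0 p \<Omega> \<times> W0 q \<Omega>" using UV_W0 pq0 by (auto simp: \<Psi>_def)
    show "\<forall>X\<in>?C. 0 < denom \<alpha> \<beta> \<Omega> X" using dn E by fastforce
    show "\<forall>X\<in>?C. neg_pt X \<in> ?C" by (auto simp flip: \<Psi>_minus)
  qed (intro compact_\<Psi> genus_\<Psi> pq0)+
  have ray: "rayleigh p q \<alpha> \<beta> \<Omega> (\<Psi> p q w) \<le> R / h powr (\<alpha> + \<beta>)" if w: "w \<in> l1_sphere n" for w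
  proof -
    define Nm where "Nm = (1/p) * (LINT x:\<Omega>|lebesgue. norm (V p w x) powr p) + (1/q) * (LINT x:\<Omega>|lebesgue. norm (V q w x) powr q)"
    have "Nm \<le> (1/p) * (L powr p * h ^ CARD('n)) + (1/q) * (L powr q * h ^ CARD('n))"
      unfolding Nm_def using pq0 by (intro add_mono mult_left_mono V_integral_le w L) auto
    also have "\<dots> = ((1/p) * L powr p + (1/q) * L powr q) * h ^ CARD('n)" by (simp add: algebra_simps)
    finally have Nm: "Nm \<le> ((1/p) * L powr p + (1/q) * L powr q) * h ^ CARD('n)" .
    have Nm0: "0 \<le> Nm" unfolding Nm_def using pq0 by (intro add_nonneg_nonneg mult_nonneg_nonneg set_integral_nonneg') auto
    have "rayleigh p q \<alpha> \<beta> \<Omega> (\<Psi> p q w) = Nm / denom \<alpha> \<beta> \<Omega> (\<Psi> p q w)"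
      by (simp add: rayleigh_def \<Psi>_def Nm_def)
    also have "\<dots> \<le> Nm / E" using dn[OF w] E Nm0 by (intro divide_left_mono) auto
    also have "\<dots> \<le> (((1/p) * L powr p + (1/q) * L powr q) * h ^ CARD('n)) / E"
      using Nm E by (intro divide_right_mono) auto
    also have "\<dots> = R / h powr (\<alpha> + \<beta>)"
      using h by (simp add: R_def E_def power_divide)
    finally show ?thesis .
  qed
  have "(\<lambda>j. if j = 0 then 1 else 0) \<in> l1_sphere n"
  proof -
    have "(\<Sum>j\<le>n. \<bar>if j = 0 then 1 else 0 :: real\<bar>) = (\<Sum>j\<le>n. if j = 0 then 1 else 0)"
      by (intro sum.cong) auto
    then show ?thesis by (simp add: l1_sphere_def)
  qed
  then have "l1_sphere n \<noteq> {}" by blast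
  then have "Sup (rayleigh p q \<alpha> \<beta> \<Omega> ` ?C) \<le> R / h powr (\<alpha> + \<beta>)"
    using ray by (intro cSup_least) auto
  with adm show ?thesis by blast
qed

end

section \<open>Two-sided bounds for the eigenvalues\<close>

text \<open>On the empty set the case m = 0 in the definition of the genus is satisfied vacuously,
  so its genus is not at least k for positive k.\<close>

lemma admissible_nonempty:
  assumes "admissible p q \<alpha> \<beta> \<Omega> k C" "0 < k"
  shows "C \<noteq> {}"
proof
  assume "C = {}"
  moreover have "genus_ge (Wdist p q \<Omega>) neg_pt C k" using assms(1) by (simp add: admissible_def)
  ultimately show False using assms(2) unfolding genus_ge_def by auto
qed

lemma rayleigh_nonneg:
  assumes "0 < p" "0 < q"
  shows "0 \<le> rayleigh p q \<alpha> \<beta> \<Omega> X"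
  using assms by (auto simp: rayleigh_def denom_def split: prod.splits
    intro!: divide_nonneg_nonneg add_nonneg_nonneg mult_nonneg_nonneg set_integral_nonneg')

text \<open>The infimum is bounded below by 0: each admissible set has a point, its quotient is
  nonnegative, and it lies below the supremum because the quotients are bounded.\<close>

lemma var_eig_le:
  assumes pq: "1 < p" "1 < q" and ab: "0 < \<alpha>" "0 < \<beta>" "\<alpha> / p + \<beta> / q = 1" and \<Omega>: "\<Omega> \<in> sets lebesgue"
    and k: "0 < k" and C: "admissible p q \<alpha> \<beta> \<Omega> k C" "Sup (rayleigh p q \<alpha> \<beta> \<Omega> ` C) \<le> b"
  shows "var_eig p q \<alpha> \<beta> \<Omega> k \<le> b"
proof -
  have "var_eig p q \<alpha> \<beta> \<Omega> k \<le> Sup (rayleigh p q \<alpha> \<beta> \<Omega> ` C)"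
    unfolding var_eig_def
  proof (rule cInf_lower)
    show "bdd_below ((\<lambda>C. Sup (rayleigh p q \<alpha> \<beta> \<Omega> ` C)) ` {C. admissible p q \<alpha> \<beta> \<Omega> k C})"
    proof (rule bdd_belowI2)
      fix D assume "D \<in> {C. admissible p q \<alpha> \<beta> \<Omega> k C}"
      then have D: "admissible p q \<alpha> \<beta> \<Omega> k D" by simp
      obtain X where X: "X \<in> D" using admissible_nonempty[OF D k] by blast
      have "0 \<le> rayleigh p q \<alpha> \<beta> \<Omega> X" using pq by (intro rayleigh_nonneg) auto
      also have "\<dots> \<le> Sup (rayleigh p q \<alpha> \<beta> \<Omega> ` D)"
        using X by (intro cSup_upper rayleigh_bdd_above[OF pq ab \<Omega> D]) auto
      finally show "0 \<le> Sup (rayleigh p q \<alpha> \<beta> \<Omega> ` D)" .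
    qed
  qed (use C in blast)
  with C(2) show ?thesis by simp
qed

text \<open>The set \<open>C0\<close> guards against an infimum over the empty set, which would be
  an unspecified real; a trial set from the upper bound will play this role.\<close>

lemma var_eig_ge:
  assumes pq: "1 < p" "1 < q" and ab: "0 < \<alpha>" "0 < \<beta>" "\<alpha> / p + \<beta> / q = 1" and \<Omega>: "\<Omega> \<in> sets lebesgue"
    and ne: "admissible p q \<alpha> \<beta> \<Omega> k C0"
    and lb: "\<And>C. admissible p q \<alpha> \<beta> \<Omega> k C \<Longrightarrow> \<exists>X\<in>C. b \<le> rayleigh p q \<alpha> \<beta> \<Omega> X"
  shows "b \<le> var_eig p q \<alpha> \<beta> \<Omega> k"
  unfolding var_eig_def
proof (rule cInf_greatest)
  show "(\<lambda>C. Sup (rayleigh p q \<alpha> \<beta> \<Omega> ` C)) ` {C. admissible p q \<alpha> \<beta> \<Omega> k C} \<noteq> {}" using ne by blast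
  fix y assume "y \<in> (\<lambda>C. Sup (rayleigh p q \<alpha> \<beta> \<Omega> ` C)) ` {C. admissible p q \<alpha> \<beta> \<Omega> k C}"
  then obtain C where C: "admissible p q \<alpha> \<beta> \<Omega> k C" and y: "y = Sup (rayleigh p q \<alpha> \<beta> \<Omega> ` C)" by blast
  obtain X where X: "X \<in> C" "b \<le> rayleigh p q \<alpha> \<beta> \<Omega> X" using lb[OF C] by blast
  note X(2)
  also have "rayleigh p q \<alpha> \<beta> \<Omega> X \<le> y"
    unfolding y using X(1) by (intro cSup_upper rayleigh_bdd_above[OF pq ab \<Omega> C]) auto
  finally show "b \<le> y" .
qed

lemma root_scale:
  assumes "0 < a" "0 < N" "0 < h0"
  shows "(a powr (1 / real N)) ^ N = a" and "a < h0 ^ N \<Longrightarrow> a powr (1 / real N) < h0"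
    and "(a powr (1 / real N)) powr s = a powr (s / real N)"
proof -
  show 1: "(a powr (1 / real N)) ^ N = a"
  proof -
    have "(a powr (1 / real N)) ^ N = (a powr (1 / real N)) powr real N"
      using assms by (subst powr_realpow) auto
    then show ?thesis using assms by (simp add: powr_powr)
  qed
  show "a powr (1 / real N) < h0" if "a < h0 ^ N"
  proof (rule power_less_imp_less_base)
    show "(a powr (1 / real N)) ^ N < h0 ^ N" unfolding 1 by (rule that)
  qed (use assms in simp)
  show "(a powr (1 / real N)) powr s = a powr (s / real N)"
    by (simp add: powr_powr)
qed

lemma eventually_div_less:
  assumes "0 < (b::real)"
  obtains K :: nat where "0 < K" "\<And>k. K \<le> k \<Longrightarrow> a / real k < b"
proof -
  obtain K :: nat where K: "a / b < real K" using reals_Archimedean2 by blast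
  show thesis
  proof (rule that[of "Suc K"])
    fix k assume "Suc K \<le> k"
    then have "a / b < real k" "0 < real k" using K by auto
    then show "a / real k < b" using assms by (simp add: field_simps)
  qed simp
qed

theorem theorem1p1:
  fixes p q \<alpha> \<beta> :: real
  assumes "1 < p" and "1 < q" and "0 < \<alpha>" and "0 < \<beta>" and "\<alpha> / p + \<beta> / q = 1"
  shows "\<exists>c C. 0 < c \<and> c < C \<and>
    (\<forall>\<Omega> :: (real^'n) set. smooth_bounded_domain \<Omega> \<longrightarrow>
       (\<exists>K. \<forall>k\<ge>K.
          c * (real k / measure lebesgue \<Omega>) powr ((\<alpha> + \<beta>) / real CARD('n)) \<le> var_eig p q \<alpha> \<beta> \<Omega> k \<and>
          var_eig p q \<alpha> \<beta> \<Omega> k \<le> C * (real k / measure lebesgue \<Omega>) powr ((\<alpha> + \<beta>) / real CARD('n))))"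
proof -
  note pq = assms(1,2) and ab = assms(3-5)
  define N where "N = CARD('n)"
  have N: "0 < N" by (simp add: N_def)
  define \<gamma> where "\<gamma> = (\<alpha> + \<beta>) / real N"
  obtain L where L: "0 < L" "\<And>c h x. 0 < h \<Longrightarrow> norm (grad (bump c h) (x::real^'n)) \<le> L / h"
    using grad_bump_bound by blast
  obtain d where d: "0 < d" "\<And>c h x. 0 < h \<Longrightarrow> x \<in> cell (c + (\<chi> i. h / 4)) (h / 2) \<Longrightarrow> d \<le> bump c h (x::real^'n)"
    using bump_lower_bound by blast
  define R where "R = ((1/p) * L powr p + (1/q) * L powr q) * 2 ^ CARD('n) / d powr (\<alpha> + \<beta>)"
  have R: "0 < R" unfolding R_def using L(1) d(1) pq by (intro divide_pos_pos mult_pos_pos add_pos_pos) auto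
  define M where "M = p * (8 powr p * (real CARD('n) powr p * 2 ^ CARD('n))) + q * (8 powr q * (real CARD('n) powr q * 2 ^ CARD('n)))"
  have M: "0 < M" unfolding M_def using pq by (intro add_pos_pos mult_pos_pos) auto
  define c where "c = 1 / (M * 5 powr \<gamma>)"
  \<comment> \<open>The bound obtained is R 2^\<gamma>; adding c secures c < C.\<close>
  define C where "C = R * 2 powr \<gamma> + c"
  have c: "0 < c" using M by (simp add: c_def)
  have cC: "c < C" using R by (simp add: C_def)
  have "\<exists>K. \<forall>k\<ge>K. c * (real k / measure lebesgue \<Omega>) powr \<gamma> \<le> var_eig p q \<alpha> \<beta> \<Omega> k \<and>
          var_eig p q \<alpha> \<beta> \<Omega> k \<le> C * (real k / measure lebesgue \<Omega>) powr \<gamma>"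
    if dom: "smooth_bounded_domain \<Omega>" for \<Omega> :: "(real^'n) set"
  proof -
    have op: "open \<Omega>" and bd: "bounded \<Omega>" and ne: "\<Omega> \<noteq> {}" using dom by (auto simp: smooth_bounded_domain_def)
    have \<Omega>: "\<Omega> \<in> lmeasurable" "\<Omega> \<in> sets lebesgue" using op bd by (auto simp: lmeasurable_open)
    define V where "V = measure lebesgue \<Omega>"
    have V: "0 < V"
      unfolding V_def using open_not_negligible[OF op ne] \<Omega>(1) by (simp add: negligible_iff_measure zero_less_measure_iff)
    obtain h1 where h1: "0 < h1" "\<And>h. 0 < h \<Longrightarrow> h < h1 \<Longrightarrow> real (card (grid_index h ` \<Omega>)) * h ^ CARD('n) \<le> 2 * measure lebesgue \<Omega>"
      using grid_cover_count[OF dom] by blast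
    obtain h2 where h2: "0 < h2" "\<And>h. 0 < h \<Longrightarrow> h < h2 \<Longrightarrow> \<exists>I. finite I \<and> (\<forall>m\<in>I. closure (grid_cell h m) \<subseteq> \<Omega>)
      \<and> measure lebesgue \<Omega> \<le> 2 * (real (card I) * h ^ CARD('n))"
      using grid_inner_count[OF op bd ne] by blast
    \<comment> \<open>The domain enters through h1, h2 and V, hence through these thresholds only; c
      and C are already fixed.\<close>
    obtain K1 where K1: "0 < K1" "\<And>k. K1 \<le> k \<Longrightarrow> 5 * V / real k < h1 ^ N"
      using eventually_div_less[of "h1 ^ N" "5 * V"] h1(1) by auto
    obtain K2 where K2: "0 < K2" "\<And>k. K2 \<le> k \<Longrightarrow> V / 2 / real k < h2 ^ N"
      using eventually_div_less[of "h2 ^ N" "V / 2"] h2(1) by auto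
    have "c * (real k / V) powr \<gamma> \<le> var_eig p q \<alpha> \<beta> \<Omega> k \<and> var_eig p q \<alpha> \<beta> \<Omega> k \<le> C * (real k / V) powr \<gamma>"
      if k: "max K1 K2 \<le> k" for k
    proof -
      have k0: "0 < k" using K1(1) k by simp
      define n where "n = k - 1"
      have kn: "k = Suc n" using k0 by (simp add: n_def)
      have upper: "\<exists>C0. admissible p q \<alpha> \<beta> \<Omega> k C0 \<and> Sup (rayleigh p q \<alpha> \<beta> \<Omega> ` C0) \<le> R * 2 powr \<gamma> * (real k / V) powr \<gamma>"
      proof -
        \<comment> \<open>With h^N = V/(2k), the bound V \<le> 2 (card I) h^N says that at least k
          cells are available.\<close>
        define a where "a = V / 2 / real k"
        have a: "0 < a" using V k0 by (simp add: a_def)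
        define h where "h = a powr (1 / real N)"
        have h: "0 < h" using a by (simp add: h_def)
        have hN: "h ^ N = a" unfolding h_def by (rule root_scale(1)[OF a N h2(1)])
        have "h < h2" unfolding h_def
          by (rule root_scale(2)[OF a N h2(1)]) (use K2(2)[of k] k in \<open>simp add: a_def\<close>)
        then obtain I where I: "finite I" "\<And>m. m \<in> I \<Longrightarrow> closure (grid_cell h m) \<subseteq> \<Omega>"
          and cnt: "V \<le> 2 * (real (card I) * h ^ N)"
          using h2(2)[OF h] unfolding V_def N_def by blast
        have "V \<le> real (card I) * V / real k" using cnt by (simp add: hN a_def)
        then have "V * real k \<le> V * real (card I)" using k0 by (simp add: pos_le_divide_eq mult.commute)
        then have "k \<le> card I" using V by simp
        then obtain J where J: "J \<subseteq> I" "card J = k" "finite J" by (rule obtain_subset_with_card_n)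
        obtain z where z: "bij_betw z {0..<k} J" using ex_bij_betw_nat_finite[OF J(3)] J(2) by blast
        have set: "{..n} = {0..<k}" by (auto simp: kn)
        interpret bump_family \<Omega> h z n
        proof
          show "inj_on z {..n}" using z by (simp add: set bij_betw_def)
          show "closure (grid_cell h (z i)) \<subseteq> \<Omega>" if "i \<le> n" for i
          proof -
            have "z i \<in> J" using z that unfolding bij_betw_def by (auto simp: set[symmetric])
            then show ?thesis using I(2) J(1) by blast
          qed
        qed (use op bd h in auto)
        have "\<exists>C0. admissible p q \<alpha> \<beta> \<Omega> (Suc n) C0 \<and> Sup (rayleigh p q \<alpha> \<beta> \<Omega> ` C0) \<le> R / h powr (\<alpha> + \<beta>)"
          unfolding R_def by (rule admissible_\<Psi>[OF pq ab]) (use L d h in auto)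
        moreover have "R / h powr (\<alpha> + \<beta>) = R * 2 powr \<gamma> * (real k / V) powr \<gamma>"
        proof -
          have "h powr (\<alpha> + \<beta>) = a powr \<gamma>" unfolding h_def \<gamma>_def by (rule root_scale(3)[OF a N h2(1)])
          also have "\<dots> = 1 / ((2 * (real k / V)) powr \<gamma>)"
          proof -
            have "a = 1 / (2 * (real k / V))" using V k0 by (simp add: a_def)
            moreover have "(1 / (2 * (real k / V))) powr \<gamma> = 1 powr \<gamma> / (2 * (real k / V)) powr \<gamma>"
              by (rule powr_divide)
            ultimately show ?thesis by (simp only: powr_one_eq_one)
          qed
          finally have "h powr (\<alpha> + \<beta>) = 1 / ((2 * (real k / V)) powr \<gamma>)" .
          moreover have "(2 * (real k / V)) powr \<gamma> = 2 powr \<gamma> * (real k / V) powr \<gamma>"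
            by (rule powr_mult)
          ultimately show ?thesis by (simp only:) simp
        qed
        ultimately show ?thesis unfolding kn by simp
      qed
      then obtain C0 where C0: "admissible p q \<alpha> \<beta> \<Omega> k C0" "Sup (rayleigh p q \<alpha> \<beta> \<Omega> ` C0) \<le> R * 2 powr \<gamma> * (real k / V) powr \<gamma>" by blast
      have "var_eig p q \<alpha> \<beta> \<Omega> k \<le> R * 2 powr \<gamma> * (real k / V) powr \<gamma>"
        by (rule var_eig_le[OF pq ab \<Omega>(2) k0 C0])
      also have "\<dots> \<le> C * (real k / V) powr \<gamma>" unfolding C_def using c by (intro mult_right_mono) auto
      finally have up: "var_eig p q \<alpha> \<beta> \<Omega> k \<le> C * (real k / V) powr \<gamma>" .
      have "c * (real k / V) powr \<gamma> \<le> var_eig p q \<alpha> \<beta> \<Omega> k"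
      proof (rule var_eig_ge[OF pq ab \<Omega>(2) C0(1)])
        fix D assume D: "admissible p q \<alpha> \<beta> \<Omega> k D"
        \<comment> \<open>With h^N = 5V/k at most 2k/5 cells are used, so the 2N functionals number
          at most 4k/5, strictly fewer than k.\<close>
        define a where "a = 5 * V / real k"
        have a: "0 < a" using V k0 by (simp add: a_def)
        define h where "h = a powr (1 / real N)"
        have h: "0 < h" using a by (simp add: h_def)
        have hN: "h ^ N = a" unfolding h_def by (rule root_scale(1)[OF a N h1(1)])
        have "h < h1" unfolding h_def
          by (rule root_scale(2)[OF a N h1(1)]) (use K1(2)[of k] k in \<open>simp add: a_def\<close>)
        then have "real (card (grid_index h ` \<Omega>)) * a \<le> 2 * V"
          using h1(2)[OF h] unfolding V_def N_def[symmetric] hN by blast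
        then have "(real (card (grid_index h ` \<Omega>)) * 5) * V \<le> (2 * real k) * V"
          using k0 by (simp add: a_def field_simps)
        then have "real (card (grid_index h ` \<Omega>)) * 5 \<le> 2 * real k" using V by simp
        then have "2 * card (grid_index h ` \<Omega>) < k" using k0 by linarith
        then obtain X where X: "X \<in> D" "1 / (M * h powr (\<alpha> + \<beta>)) \<le> rayleigh p q \<alpha> \<beta> \<Omega> X"
          using rayleigh_lower_bound[OF pq ab op bd h D _ M_def] by blast
        have "h powr (\<alpha> + \<beta>) = a powr \<gamma>" unfolding h_def \<gamma>_def by (rule root_scale(3)[OF a N h1(1)])
        also have "\<dots> = 5 powr \<gamma> * (V / real k) powr \<gamma>" using V by (simp add: a_def powr_mult[symmetric])
        also have "(V / real k) powr \<gamma> = 1 / (real k / V) powr \<gamma>"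
          using V k0 by (simp add: powr_divide)
        finally have "1 / (M * h powr (\<alpha> + \<beta>)) = c * (real k / V) powr \<gamma>" by (simp add: c_def)
        then show "\<exists>X\<in>D. c * (real k / V) powr \<gamma> \<le> rayleigh p q \<alpha> \<beta> \<Omega> X" using X by auto
      qed
      with up show ?thesis by blast
    qed
    then show ?thesis unfolding V_def by blast
  qed
  then show ?thesis using c cC unfolding \<gamma>_def N_def by blast
qed

end
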